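(* Let $H$ be a complex Hilbert space and let $A\subseteq\mathcal B(H)$ be an abelian norm-closed subalgebra with the complete reduction property, and suppose that $A'\cap\mathcal K(H)$ acts nondegenerately on $H$. Then there exists a bounded invertible operator $S\in\mathcal B(H)$ such that $SAS^{-1}$ is contained in an abelian C*-subalgebra of $\mathcal B(H)$. Hence the $\sigma$-weak closure of $A$ is similar to a C*-algebra. If $A$ also has the total reduction property, then $A$ is itself similar to a C*-algebra.
   Context: $\mathcal K(H)$ is the algebra of compact operators on $H$ and $A'=\{T\in\mathcal B(H):Ta=aT\text{ for all }a\in A\}$ is the commutant. A set $B\subseteq\mathcal B(H)$ acts nondegenerately on $H$ if the closed linear span of $\{b\xi:b\in B,\xi\in H\}$ is $H$. A subalgebra $D\subseteq\mathcal B(H)$ is similar to a C*-algebra if there is a bounded invertible $S\in\mathcal B(H)$ such that $SDS^{-1}$ is a norm-closed self-adjoint subalgebra of $\mathcal B(H)$. A representation of a Banach algebra $A$ on a Hilbert space $L$ is a continuous algebra homomorphism $\theta:A\to\mathcal B(L)$ (not required to be unital); it makes $L$ an $A$-module, whose submodules are the norm-closed $\theta(A)$-invariant subspaces. $L$ has the reduction property if for every submodule $V\subseteq L$ there is a submodule $W\subseteq L$ with $L=V\oplus W$ (not necessarily orthogonal). $A\subseteq\mathcal B(H)$ has the complete reduction property if $H^{(\infty)}=H\otimes_2\ell^2(\mathbb N)$ (square-summable sequences in $H$, with the coordinatewise action of $A$) has the reduction property. $A$ has the total reduction property if for every representation of $A$ on a Hilbert space $L$, $L$ has the reduction property. *)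

theory Defs
  imports "HOL-Analysis.Analysis"
begin

section \<open>Complex Hilbert spaces\<close>

text \<open>The inner product is linear in the first argument. Positive definiteness is the last axiom,
  which also says that the norm of the underlying Banach space is the one given by the inner product.
  No dimension or separability assumption is made.\<close>

class complex_hilbert_space = banach +
  fixes scaleC :: "complex \<Rightarrow> 'a \<Rightarrow> 'a"  (infixr \<open>*\<^sub>C\<close> 75)
    and cinner :: "'a \<Rightarrow> 'a \<Rightarrow> complex"
  assumes scaleC_add_right: "c *\<^sub>C (x + y) = c *\<^sub>C x + c *\<^sub>C y"
    and scaleC_add_left: "(c + d) *\<^sub>C x = c *\<^sub>C x + d *\<^sub>C x"
    and scaleC_scaleC: "c *\<^sub>C d *\<^sub>C x = (c * d) *\<^sub>C x"
    and scaleR_scaleC: "r *\<^sub>R x = complex_of_real r *\<^sub>C x"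
    and cinner_add_left: "cinner (x + y) z = cinner x z + cinner y z"
    and cinner_scaleC_left: "cinner (c *\<^sub>C x) y = c * cinner x y"
    and cinner_commute: "cinner x y = cnj (cinner y x)"
    and cinner_self: "cinner x x = complex_of_real ((norm x)\<^sup>2)"

lemma scaleC_one: "1 *\<^sub>C x = (x :: 'a::complex_hilbert_space)"
  using scaleR_scaleC[of 1 x] by simp

global_interpretation complex_vector: vector_space "scaleC :: complex \<Rightarrow> 'a \<Rightarrow> 'a::complex_hilbert_space"
  defines csubspace = complex_vector.subspace
    and cspan = complex_vector.span
  by unfold_locales (simp_all add: scaleC_add_right scaleC_add_left scaleC_scaleC scaleC_one)

lemma cinner_add_right:
  "cinner z (x + y) = cinner z x + cinner z (y :: 'a::complex_hilbert_space)"
  by (metis cinner_add_left cinner_commute complex_cnj_add)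

lemma cinner_scaleC_right:
  "cinner x (c *\<^sub>C y) = cnj c * cinner x (y :: 'a::complex_hilbert_space)"
  by (metis cinner_commute cinner_scaleC_left complex_cnj_mult)

lemma norm_scaleC: "norm (c *\<^sub>C x) = cmod c * norm (x :: 'a::complex_hilbert_space)"
proof -
  have "complex_of_real ((norm (c *\<^sub>C x))\<^sup>2) = (c * cnj c) * complex_of_real ((norm x)\<^sup>2)"
    by (simp only: cinner_self[symmetric] cinner_scaleC_left cinner_scaleC_right mult_ac)
  also have "\<dots> = complex_of_real ((cmod c * norm x)\<^sup>2)"
    by (simp only: complex_norm_square[symmetric] of_real_mult of_real_power power_mult_distrib)
  finally have "(norm (c *\<^sub>C x))\<^sup>2 = (cmod c * norm x)\<^sup>2"
    by (simp only: of_real_eq_iff)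
  then show ?thesis
    by (rule power2_eq_imp_eq) simp_all
qed

lemma bounded_linear_scaleC: "bounded_linear (\<lambda>x :: 'a::complex_hilbert_space. c *\<^sub>C x)"
  by (rule bounded_linear_intro[where K = "cmod c"])
    (simp_all add: scaleC_add_right scaleR_scaleC scaleC_scaleC norm_scaleC mult.commute)

lemma cmod_cinner_le:
  "2 * cmod (cinner x y) \<le> (norm x)\<^sup>2 + (norm (y :: 'a::complex_hilbert_space))\<^sup>2"
proof (cases "cinner x y = 0")
  case False
  define u where "u = - cnj (sgn (cinner x y))"
  have u: "u * cinner x y = - complex_of_real (cmod (cinner x y))"
  proof -
    have "cnj (cinner x y) * cinner x y = complex_of_real (cmod (cinner x y)) ^ 2"
      by (metis complex_norm_square mult.commute of_real_power)
    then show ?thesis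
      using False unfolding u_def sgn_eq
      by (simp add: power2_eq_square)
  qed
  have cu: "cmod u = 1"
    using False by (simp add: u_def norm_sgn)
  let ?v = "u *\<^sub>C x + y"
  have c: "cinner y (u *\<^sub>C x) = - complex_of_real (cmod (cinner x y))"
    by (subst cinner_commute) (simp add: cinner_scaleC_left u)
  have "complex_of_real ((norm ?v)\<^sup>2) =
      cinner (u *\<^sub>C x) (u *\<^sub>C x) + cinner y y + cinner (u *\<^sub>C x) y + cinner y (u *\<^sub>C x)"
    by (simp only: cinner_self[symmetric] cinner_add_left cinner_add_right) simp
  also have "\<dots> = complex_of_real ((norm x)\<^sup>2 + (norm y)\<^sup>2 - 2 * cmod (cinner x y))"
    by (simp only: cinner_self norm_scaleC cu c cinner_scaleC_left u) simp
  finally have "(norm ?v)\<^sup>2 = (norm x)\<^sup>2 + (norm y)\<^sup>2 - 2 * cmod (cinner x y)"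
    by (simp only: of_real_eq_iff)
  then show ?thesis
    using zero_le_power2[of "norm ?v"] by linarith
qed simp

instantiation complex :: complex_hilbert_space
begin

definition scaleC_complex :: "complex \<Rightarrow> complex \<Rightarrow> complex"
  where "scaleC_complex c z = c * z"

definition cinner_complex :: "complex \<Rightarrow> complex \<Rightarrow> complex"
  where "cinner_complex z w = z * cnj w"

instance
  by standard
    (simp_all add: scaleC_complex_def cinner_complex_def algebra_simps scaleR_conv_of_real
      complex_norm_square[symmetric])

end

section \<open>Square-summable families\<close>

definition square_summable :: "('i \<Rightarrow> 'a::real_normed_vector) \<Rightarrow> bool"
  where "square_summable f \<longleftrightarrow> (\<lambda>i. (norm (f i))\<^sup>2) summable_on UNIV"

lemma square_summable_0: "square_summable (\<lambda>i. 0)"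
  by (simp add: square_summable_def)

lemma square_summable_bound:
  assumes "\<And>F. finite F \<Longrightarrow> (\<Sum>i\<in>F. (norm (f i))\<^sup>2) \<le> K"
  shows "square_summable f"
  unfolding square_summable_def
  by (rule nonneg_bdd_above_summable_on) (auto intro!: bdd_aboveI2[where M = K] assms)

lemma square_summable_add:
  assumes "square_summable f" "square_summable g"
  shows "square_summable (\<lambda>i. f i + g i)"
  unfolding square_summable_def
proof (rule summable_on_comparison_test)
  show "(\<lambda>i. 2 * (norm (f i))\<^sup>2 + 2 * (norm (g i))\<^sup>2) summable_on UNIV"
    using assms unfolding square_summable_def
    by (intro summable_on_add summable_on_cmult_right)
  fix i
  have "(norm (f i + g i))\<^sup>2 \<le> (norm (f i) + norm (g i))\<^sup>2"
    by (intro power_mono norm_triangle_ineq) simp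
  also have "\<dots> \<le> 2 * (norm (f i))\<^sup>2 + 2 * (norm (g i))\<^sup>2"
    using sum_squares_bound[of "norm (f i)" "norm (g i)"] by (simp add: power2_sum)
  finally show "(norm (f i + g i))\<^sup>2 \<le> 2 * (norm (f i))\<^sup>2 + 2 * (norm (g i))\<^sup>2" .
qed simp

lemma square_summable_lipschitz:
  assumes "square_summable f" "\<And>i. norm (g i) \<le> K * norm (f i)"
  shows "square_summable g"
  unfolding square_summable_def
proof (rule summable_on_comparison_test)
  show "(\<lambda>i. K\<^sup>2 * (norm (f i))\<^sup>2) summable_on UNIV"
    using assms(1) unfolding square_summable_def by (rule summable_on_cmult_right)
  show "(norm (g i))\<^sup>2 \<le> K\<^sup>2 * (norm (f i))\<^sup>2" for i
    using power_mono[OF assms(2), of i 2] by (simp add: power_mult_distrib)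
qed simp

lemma square_summable_uminus:
  "square_summable f \<Longrightarrow> square_summable (\<lambda>i. - f i)"
  by (simp add: square_summable_def)

lemma square_summable_diff:
  assumes "square_summable f" "square_summable g"
  shows "square_summable (\<lambda>i. f i - g i)"
  using square_summable_add[OF assms(1) square_summable_uminus[OF assms(2)]] by simp

lemma square_summable_scaleR: "square_summable f \<Longrightarrow> square_summable (\<lambda>i. r *\<^sub>R f i)"
  by (erule square_summable_lipschitz[where K = "\<bar>r\<bar>"]) simp

lemma square_summable_scaleC:
  fixes f :: "'i \<Rightarrow> 'a::complex_hilbert_space"
  shows "square_summable f \<Longrightarrow> square_summable (\<lambda>i. c *\<^sub>C f i)"
  by (erule square_summable_lipschitz[where K = "cmod c"]) (simp add: norm_scaleC)

lemma square_summable_blinfun: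
  "square_summable f \<Longrightarrow> square_summable (\<lambda>i. blinfun_apply T (f i))"
  by (erule square_summable_lipschitz[where K = "norm T"]) (rule norm_blinfun)

lemma square_summable_cinner:
  fixes f g :: "'i \<Rightarrow> 'a::complex_hilbert_space"
  assumes "square_summable f" "square_summable g"
  shows "(\<lambda>i. cinner (f i) (g i)) summable_on UNIV"
proof (rule Infinite_Sum.abs_summable_summable, rule Infinite_Sum.abs_summable_on_comparison_test')
  show "(\<lambda>i. (norm (f i))\<^sup>2 + (norm (g i))\<^sup>2) summable_on UNIV"
    using assms unfolding square_summable_def by (rule summable_on_add)
  show "cmod (cinner (f i) (g i)) \<le> (norm (f i))\<^sup>2 + (norm (g i))\<^sup>2" for i
    using cmod_cinner_le[of "f i" "g i"] norm_ge_zero[of "cinner (f i) (g i)"] by linarith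
qed

text \<open>The Hilbert space of square-summable families in \<open>'a\<close> indexed by \<open>'i\<close>.\<close>

typedef (overloaded) ('i, 'a) ell2 = "{f :: 'i \<Rightarrow> 'a::complex_hilbert_space. square_summable f}"
  morphisms ell2_nth Abs_ell2
  using square_summable_0 by blast

setup_lifting type_definition_ell2

lemma square_summable_nth: "square_summable (ell2_nth f)"
  using ell2_nth[of f] by simp

instantiation ell2 :: (type, complex_hilbert_space) real_normed_vector
begin

lift_definition zero_ell2 :: "('a, 'b) ell2" is "\<lambda>i. 0"
  by (rule square_summable_0)

lift_definition plus_ell2 :: "('a, 'b) ell2 \<Rightarrow> ('a, 'b) ell2 \<Rightarrow> ('a, 'b) ell2"
  is "\<lambda>f g i. f i + g i" by (rule square_summable_add)

lift_definition minus_ell2 :: "('a, 'b) ell2 \<Rightarrow> ('a, 'b) ell2 \<Rightarrow> ('a, 'b) ell2"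
  is "\<lambda>f g i. f i - g i" by (rule square_summable_diff)

lift_definition uminus_ell2 :: "('a, 'b) ell2 \<Rightarrow> ('a, 'b) ell2"
  is "\<lambda>f i. - f i" by (rule square_summable_uminus)

lift_definition scaleR_ell2 :: "real \<Rightarrow> ('a, 'b) ell2 \<Rightarrow> ('a, 'b) ell2"
  is "\<lambda>r f i. r *\<^sub>R f i" by (rule square_summable_scaleR)

lift_definition norm_ell2 :: "('a, 'b) ell2 \<Rightarrow> real"
  is "\<lambda>f. sqrt (\<Sum>\<^sub>\<infinity>i. (norm (f i))\<^sup>2)" .

definition sgn_ell2 :: "('a, 'b) ell2 \<Rightarrow> ('a, 'b) ell2"
  where "sgn_ell2 f = inverse (norm f) *\<^sub>R f"

definition dist_ell2 :: "('a, 'b) ell2 \<Rightarrow> ('a, 'b) ell2 \<Rightarrow> real"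
  where "dist_ell2 f g = norm (f - g)"

definition uniformity_ell2 :: "(('a, 'b) ell2 \<times> ('a, 'b) ell2) filter"
  where "uniformity_ell2 = (INF e\<in>{0 <..}. principal {(f, g). dist f g < e})"

definition open_ell2 :: "('a, 'b) ell2 set \<Rightarrow> bool"
  where "open_ell2 S = (\<forall>f\<in>S. \<forall>\<^sub>F (f', g) in uniformity. f' = f \<longrightarrow> g \<in> S)"

lemma norm_ell2_square: "(norm f)\<^sup>2 = (\<Sum>\<^sub>\<infinity>i. (norm (ell2_nth f i))\<^sup>2)"
  for f :: "('a, 'b) ell2"
  by (simp add: norm_ell2.rep_eq infsum_nonneg)

lemma norm_ell2_ge_0: "0 \<le> norm f" for f :: "('a, 'b) ell2"
  by (simp add: norm_ell2.rep_eq infsum_nonneg)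

lemma L2_set_le_norm_ell2: "finite F \<Longrightarrow> L2_set (\<lambda>i. norm (ell2_nth f i)) F \<le> norm f"
  for f :: "('a, 'b) ell2"
  unfolding L2_set_def norm_ell2.rep_eq
  using square_summable_nth[of f] unfolding square_summable_def
  by (intro real_sqrt_le_mono finite_sum_le_infsum) auto

lemma norm_ell2_leI:
  fixes f :: "('a, 'b) ell2"
  assumes "\<And>F. finite F \<Longrightarrow> L2_set (\<lambda>i. norm (ell2_nth f i)) F \<le> K"
  shows "norm f \<le> K"
proof -
  have K: "0 \<le> K"
    using assms[of "{}"] by simp
  have "(norm f)\<^sup>2 \<le> K\<^sup>2"
    unfolding norm_ell2_square
  proof (rule infsum_le_finite_sums)
    show "(\<lambda>i. (norm (ell2_nth f i))\<^sup>2) summable_on UNIV"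
      using square_summable_nth[of f] unfolding square_summable_def .
    fix F :: "'a set" assume "finite F"
    then have "sqrt (\<Sum>i\<in>F. (norm (ell2_nth f i))\<^sup>2) \<le> K"
      using assms[of F] by (simp add: L2_set_def)
    then show "(\<Sum>i\<in>F. (norm (ell2_nth f i))\<^sup>2) \<le> K\<^sup>2"
      by (rule sqrt_le_D)
  qed
  then show ?thesis
    using K by (rule power2_le_imp_le)
qed

lemma norm_nth_le_ell2: "norm (ell2_nth f i) \<le> norm f" for f :: "('a, 'b) ell2"
  using L2_set_le_norm_ell2[of "{i}" f] by simp

instance
proof
  fix f g h :: "('a, 'b) ell2" and r s :: real
  show "f + g + h = f + (g + h)" "f + g = g + f" "0 + f = f" "- f + f = 0" "f - g = f + - g"
    by (transfer, simp add: fun_eq_iff add_ac)+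
  show "r *\<^sub>R (f + g) = r *\<^sub>R f + r *\<^sub>R g" "(r + s) *\<^sub>R f = r *\<^sub>R f + s *\<^sub>R f"
    "r *\<^sub>R s *\<^sub>R f = (r * s) *\<^sub>R f" "1 *\<^sub>R f = f"
    by (transfer, simp add: fun_eq_iff algebra_simps)+
  show "dist f g = norm (f - g)" "sgn f = inverse (norm f) *\<^sub>R f"
    by (simp_all add: dist_ell2_def sgn_ell2_def)
  show "uniformity = (INF e\<in>{0 <..}. principal {(f, g :: ('a, 'b) ell2). dist f g < e})"
    by (rule uniformity_ell2_def)
  show "open U = (\<forall>f\<in>U. \<forall>\<^sub>F (f', g) in uniformity. f' = f \<longrightarrow> g \<in> U)"
    for U :: "('a, 'b) ell2 set"
    by (rule open_ell2_def)
  show "norm f = 0 \<longleftrightarrow> f = 0"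
  proof
    assume "norm f = 0"
    then have "ell2_nth f i = 0" for i
      using norm_nth_le_ell2[of f i] by simp
    then show "f = 0"
      by (intro ell2_nth_inject[THEN iffD1]) (simp add: zero_ell2.rep_eq fun_eq_iff)
  next
    assume "f = 0"
    then show "norm f = 0"
      by (simp add: norm_ell2.rep_eq zero_ell2.rep_eq)
  qed
  show "norm (f + g) \<le> norm f + norm g"
  proof (rule norm_ell2_leI)
    fix F :: "'a set" assume F: "finite F"
    have "L2_set (\<lambda>i. norm (ell2_nth (f + g) i)) F
        \<le> L2_set (\<lambda>i. norm (ell2_nth f i) + norm (ell2_nth g i)) F"
      by (rule L2_set_mono) (simp_all add: plus_ell2.rep_eq norm_triangle_ineq)
    also have "\<dots> \<le> L2_set (\<lambda>i. norm (ell2_nth f i)) F + L2_set (\<lambda>i. norm (ell2_nth g i)) F"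
      by (rule L2_set_triangle_ineq)
    also have "\<dots> \<le> norm f + norm g"
      by (intro add_mono L2_set_le_norm_ell2 F)
    finally show "L2_set (\<lambda>i. norm (ell2_nth (f + g) i)) F \<le> norm f + norm g" .
  qed
  show "norm (r *\<^sub>R f) = \<bar>r\<bar> * norm f"
    by (simp add: norm_ell2.rep_eq scaleR_ell2.rep_eq power_mult_distrib infsum_cmult_right'
        real_sqrt_mult)
qed

end

instance ell2 :: (type, complex_hilbert_space) banach
proof
  fix X :: "nat \<Rightarrow> ('a, 'b) ell2"
  assume "Cauchy X"
  then have C: "\<forall>e>0. \<exists>N. \<forall>m\<ge>N. \<forall>n\<ge>N. dist (X m) (X n) < e"
    unfolding Cauchy_def by blast
  have nth_diff: "ell2_nth (f - g) i = ell2_nth f i - ell2_nth g i" for f g :: "('a, 'b) ell2" and i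
    by (simp add: minus_ell2.rep_eq)
  have "Cauchy (\<lambda>n. ell2_nth (X n) i)" for i
  proof (rule CauchyI)
    fix e :: real assume "0 < e"
    with C obtain N where "\<forall>m\<ge>N. \<forall>n\<ge>N. dist (X m) (X n) < e" by blast
    then have "\<forall>m\<ge>N. \<forall>n\<ge>N. norm (ell2_nth (X m) i - ell2_nth (X n) i) < e"
      using norm_nth_le_ell2[of "X _ - X _" i]
      unfolding dist_ell2_def nth_diff by (meson le_less_trans)
    then show "\<exists>N. \<forall>m\<ge>N. \<forall>n\<ge>N. norm (ell2_nth (X m) i - ell2_nth (X n) i) < e" by blast
  qed
  then have "\<forall>i. \<exists>l. (\<lambda>n. ell2_nth (X n) i) \<longlonglongrightarrow> l"
    by (simp add: Cauchy_convergent_iff convergent_def)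
  then obtain g where g: "\<And>i. (\<lambda>n. ell2_nth (X n) i) \<longlonglongrightarrow> g i"
    by metis
  have fin: "L2_set (\<lambda>i. norm (ell2_nth (X n) i - g i)) F \<le> e"
    if "finite F" "n \<ge> N" and N: "\<forall>m\<ge>N. \<forall>n\<ge>N. dist (X m) (X n) < e" for F n N e
  proof (rule tendsto_upperbound)
    show "(\<lambda>m. L2_set (\<lambda>i. norm (ell2_nth (X n) i - ell2_nth (X m) i)) F)
        \<longlonglongrightarrow> L2_set (\<lambda>i. norm (ell2_nth (X n) i - g i)) F"
      unfolding L2_set_def by (intro tendsto_intros g)
    show "\<forall>\<^sub>F m in sequentially. L2_set (\<lambda>i. norm (ell2_nth (X n) i - ell2_nth (X m) i)) F \<le> e"
    proof (rule eventually_sequentiallyI[of N])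
      fix m assume "m \<ge> N"
      then have "norm (X n - X m) < e"
        using N \<open>n \<ge> N\<close> unfolding dist_ell2_def by blast
      then show "L2_set (\<lambda>i. norm (ell2_nth (X n) i - ell2_nth (X m) i)) F \<le> e"
        using L2_set_le_norm_ell2[OF \<open>finite F\<close>, of "X n - X m"] unfolding nth_diff by linarith
    qed
  qed simp
  from C obtain N1 where N1: "\<forall>m\<ge>N1. \<forall>n\<ge>N1. dist (X m) (X n) < 1"
    using zero_less_one by blast
  have "square_summable (\<lambda>i. ell2_nth (X N1) i - g i)"
  proof (rule square_summable_bound)
    fix F :: "'a set" assume "finite F"
    from fin[OF this order_refl N1] show "(\<Sum>i\<in>F. (norm (ell2_nth (X N1) i - g i))\<^sup>2) \<le> 1"
      by (simp add: L2_set_def)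
  qed
  from square_summable_diff[OF square_summable_nth[of "X N1"] this] have "square_summable g"
    by simp
  then have G: "ell2_nth (Abs_ell2 g) = g"
    by (simp add: Abs_ell2_inverse)
  have "X \<longlonglongrightarrow> Abs_ell2 g"
    unfolding tendsto_iff eventually_sequentially dist_ell2_def
  proof (intro allI impI)
    fix e :: real assume "0 < e"
    then obtain N where N: "\<forall>m\<ge>N. \<forall>n\<ge>N. dist (X m) (X n) < e / 2"
      using C half_gt_zero by blast
    have "norm (X n - Abs_ell2 g) < e" if "n \<ge> N" for n
    proof -
      have "norm (X n - Abs_ell2 g) \<le> e / 2"
        by (rule norm_ell2_leI) (unfold nth_diff G, rule fin[OF _ that N])
      with \<open>0 < e\<close> show ?thesis by simp
    qed
    then show "\<exists>N. \<forall>n\<ge>N. norm (X n - Abs_ell2 g) < e" by blast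
  qed
  then show "convergent X"
    by (rule convergentI)
qed

instantiation ell2 :: (type, complex_hilbert_space) complex_hilbert_space
begin

lift_definition scaleC_ell2 :: "complex \<Rightarrow> ('a, 'b) ell2 \<Rightarrow> ('a, 'b) ell2"
  is "\<lambda>c f i. c *\<^sub>C f i" by (rule square_summable_scaleC)

lift_definition cinner_ell2 :: "('a, 'b) ell2 \<Rightarrow> ('a, 'b) ell2 \<Rightarrow> complex"
  is "\<lambda>f g. \<Sum>\<^sub>\<infinity>i. cinner (f i) (g i)" .

instance
proof
  fix f g h :: "('a, 'b) ell2" and r :: real and c d :: complex
  show "c *\<^sub>C (f + g) = c *\<^sub>C f + c *\<^sub>C g" "(c + d) *\<^sub>C f = c *\<^sub>C f + d *\<^sub>C f"
    "c *\<^sub>C d *\<^sub>C f = (c * d) *\<^sub>C f" "r *\<^sub>R f = complex_of_real r *\<^sub>C f"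
    by (transfer, simp add: fun_eq_iff scaleC_add_right scaleC_add_left scaleC_scaleC scaleR_scaleC)+
  show "cinner (f + g) h = cinner f h + cinner g h"
    by (transfer, simp add: cinner_add_left infsum_add square_summable_cinner)
  show "cinner (c *\<^sub>C f) g = c * cinner f g"
    by (transfer, simp add: cinner_scaleC_left infsum_cmult_right')
  show "cinner f g = cnj (cinner g f)"
    by (transfer, subst cinner_commute, rule infsum_cnj)
  have "((\<lambda>i. (norm (ell2_nth f i))\<^sup>2) has_sum (norm f)\<^sup>2) UNIV"
    unfolding norm_ell2_square
    using square_summable_nth[of f] unfolding square_summable_def by (rule has_sum_infsum)
  then have "((\<lambda>i. complex_of_real ((norm (ell2_nth f i))\<^sup>2)) has_sum complex_of_real ((norm f)\<^sup>2)) UNIV"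
    by (rule has_sum_of_real)
  then show "cinner f f = complex_of_real ((norm f)\<^sup>2)"
    unfolding cinner_ell2.rep_eq cinner_self by (rule infsumI)
qed

end

section \<open>Bounded operators and operator algebras\<close>

text \<open>The type \<open>'a \<Rightarrow>\<^sub>L 'a\<close> of the library consists of the real-linear bounded maps, with the operator
  norm. The complex-linear ones form a closed subset, which is \<open>B(H)\<close>.\<close>

definition bounded_operators :: "('a::complex_hilbert_space \<Rightarrow>\<^sub>L 'a) set"
  where "bounded_operators =
    {T. \<forall>c x. blinfun_apply T (c *\<^sub>C x) = c *\<^sub>C blinfun_apply T x}"

lift_definition scaleC_op ::
    "complex \<Rightarrow> ('a::complex_hilbert_space \<Rightarrow>\<^sub>L 'a) \<Rightarrow> ('a \<Rightarrow>\<^sub>L 'a)"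
  is "\<lambda>c T x. c *\<^sub>C T x"
  by (rule bounded_linear_compose[OF bounded_linear_scaleC])

definition is_adjoint :: "('a::complex_hilbert_space \<Rightarrow>\<^sub>L 'a) \<Rightarrow> ('a \<Rightarrow>\<^sub>L 'a) \<Rightarrow> bool"
  where "is_adjoint T T' \<longleftrightarrow> (\<forall>x y. cinner (blinfun_apply T x) y = cinner x (blinfun_apply T' y))"

definition self_adjoint_set :: "('a::complex_hilbert_space \<Rightarrow>\<^sub>L 'a) set \<Rightarrow> bool"
  where "self_adjoint_set D \<longleftrightarrow> (\<forall>T\<in>D. \<exists>T'\<in>D. is_adjoint T T')"

definition subalgebra :: "('a::complex_hilbert_space \<Rightarrow>\<^sub>L 'a) set \<Rightarrow> bool"
  where "subalgebra D \<longleftrightarrow> D \<subseteq> bounded_operators \<and> 0 \<in> D \<and>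
    (\<forall>S\<in>D. \<forall>T\<in>D. S + T \<in> D \<and> S o\<^sub>L T \<in> D) \<and> (\<forall>c. \<forall>T\<in>D. scaleC_op c T \<in> D)"

definition abelian :: "('a::complex_hilbert_space \<Rightarrow>\<^sub>L 'a) set \<Rightarrow> bool"
  where "abelian D \<longleftrightarrow> (\<forall>S\<in>D. \<forall>T\<in>D. S o\<^sub>L T = T o\<^sub>L S)"

definition cstar_subalgebra :: "('a::complex_hilbert_space \<Rightarrow>\<^sub>L 'a) set \<Rightarrow> bool"
  where "cstar_subalgebra D \<longleftrightarrow> subalgebra D \<and> closed D \<and> self_adjoint_set D"

definition inverse_operators :: "('a::complex_hilbert_space \<Rightarrow>\<^sub>L 'a) \<Rightarrow> ('a \<Rightarrow>\<^sub>L 'a) \<Rightarrow> bool"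
  where "inverse_operators S R \<longleftrightarrow> S \<in> bounded_operators \<and> R \<in> bounded_operators \<and>
    S o\<^sub>L R = id_blinfun \<and> R o\<^sub>L S = id_blinfun"

text \<open>In the following two definitions \<open>R\<close> is the inverse of \<open>S\<close>.\<close>

definition conjugate ::
    "('a::complex_hilbert_space \<Rightarrow>\<^sub>L 'a) \<Rightarrow> ('a \<Rightarrow>\<^sub>L 'a) \<Rightarrow> ('a \<Rightarrow>\<^sub>L 'a) set \<Rightarrow> ('a \<Rightarrow>\<^sub>L 'a) set"
  where "conjugate S R D = (\<lambda>T. S o\<^sub>L T o\<^sub>L R) ` D"

definition similar_to_cstar_algebra :: "('a::complex_hilbert_space \<Rightarrow>\<^sub>L 'a) set \<Rightarrow> bool"
  where "similar_to_cstar_algebra D \<longleftrightarrow>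
    (\<exists>S R. inverse_operators S R \<and> cstar_subalgebra (conjugate S R D))"

definition commutant :: "('a::complex_hilbert_space \<Rightarrow>\<^sub>L 'a) set \<Rightarrow> ('a \<Rightarrow>\<^sub>L 'a) set"
  where "commutant D = {T \<in> bounded_operators. \<forall>S\<in>D. T o\<^sub>L S = S o\<^sub>L T}"

definition compact_operators :: "('a::complex_hilbert_space \<Rightarrow>\<^sub>L 'a) set"
  where "compact_operators =
    {T \<in> bounded_operators. compact (closure (blinfun_apply T ` cball 0 1))}"

definition acts_nondegenerately :: "('a::complex_hilbert_space \<Rightarrow>\<^sub>L 'a) set \<Rightarrow> bool"
  where "acts_nondegenerately B \<longleftrightarrow>
    closure (cspan {blinfun_apply T x | T x. T \<in> B}) = UNIV"

definition sigma_weak_functional ::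
    "(nat, 'a::complex_hilbert_space) ell2 \<Rightarrow> (nat, 'a) ell2 \<Rightarrow> ('a \<Rightarrow>\<^sub>L 'a) \<Rightarrow> complex"
  where "sigma_weak_functional x y T =
    (\<Sum>\<^sub>\<infinity>n. cinner (blinfun_apply T (ell2_nth x n)) (ell2_nth y n))"

definition sigma_weak_topology :: "('a::complex_hilbert_space \<Rightarrow>\<^sub>L 'a) topology"
  where "sigma_weak_topology = subtopology
    (topology_generated_by {sigma_weak_functional x y -` U | x y U. open U}) bounded_operators"

section \<open>The reduction properties\<close>

text \<open>\<open>L\<close> is a closed complex subspace of the ambient Hilbert space and \<open>B\<close> a set of
  operators leaving \<open>L\<close> invariant.\<close>

definition submodule ::
    "('h::complex_hilbert_space \<Rightarrow>\<^sub>L 'h) set \<Rightarrow> 'h set \<Rightarrow> 'h set \<Rightarrow> bool"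
  where "submodule B L V \<longleftrightarrow> csubspace V \<and> closed V \<and> V \<subseteq> L \<and>
    (\<forall>T\<in>B. blinfun_apply T ` V \<subseteq> V)"

definition reduction_property ::
    "('h::complex_hilbert_space \<Rightarrow>\<^sub>L 'h) set \<Rightarrow> 'h set \<Rightarrow> bool"
  where "reduction_property B L \<longleftrightarrow>
    (\<forall>V. submodule B L V \<longrightarrow>
      (\<exists>W. submodule B L W \<and> V \<inter> W = {0} \<and> L = {v + w | v w. v \<in> V \<and> w \<in> W}))"

lift_definition ell2_map ::
    "('a::complex_hilbert_space \<Rightarrow>\<^sub>L 'a) \<Rightarrow> ('i, 'a) ell2 \<Rightarrow> ('i, 'a) ell2"
  is "\<lambda>T f i. blinfun_apply T (f i)"
  by (rule square_summable_blinfun)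

lemma bounded_linear_ell2_map: "bounded_linear (ell2_map T :: ('i, 'a::complex_hilbert_space) ell2 \<Rightarrow> _)"
proof (rule bounded_linear_intro[where K = "norm T"])
  show "ell2_map T (x + y) = ell2_map T x + ell2_map T y" for x y
    by (transfer, simp add: blinfun.add_right)
  show "ell2_map T (r *\<^sub>R x) = r *\<^sub>R ell2_map T x" for r x
    by (transfer, simp add: blinfun.scaleR_right)
  show "norm (ell2_map T x) \<le> norm x * norm T" for x :: "('i, 'a) ell2"
  proof (rule norm_ell2_leI)
    fix F :: "'i set" assume F: "finite F"
    have "L2_set (\<lambda>i. norm (ell2_nth (ell2_map T x) i)) F
        \<le> L2_set (\<lambda>i. norm T * norm (ell2_nth x i)) F"
      by (rule L2_set_mono) (simp_all add: ell2_map.rep_eq norm_blinfun)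
    also have "\<dots> = norm T * L2_set (\<lambda>i. norm (ell2_nth x i)) F"
      by (rule L2_set_right_distrib[symmetric]) simp
    also have "\<dots> \<le> norm x * norm T"
      using mult_left_mono[OF L2_set_le_norm_ell2[OF F, of x] norm_ge_zero[of T]] by (simp add: mult.commute)
    finally show "L2_set (\<lambda>i. norm (ell2_nth (ell2_map T x) i)) F \<le> norm x * norm T" .
  qed
qed

lift_definition amplification ::
    "('a::complex_hilbert_space \<Rightarrow>\<^sub>L 'a) \<Rightarrow> (('i, 'a) ell2 \<Rightarrow>\<^sub>L ('i, 'a) ell2)"
  is ell2_map by (rule bounded_linear_ell2_map)

definition complete_reduction_property :: "('a::complex_hilbert_space \<Rightarrow>\<^sub>L 'a) set \<Rightarrow> bool"
  where "complete_reduction_property A \<longleftrightarrow>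
    reduction_property (amplification ` A) (UNIV :: (nat, 'a) ell2 set)"

text \<open>\<open>B(L)\<close> for a closed subspace \<open>L\<close>: an operator on \<open>L\<close> is identified with its extension to the
  ambient space that vanishes on the orthogonal complement of \<open>L\<close>. This identification is
  isometric and respects the algebra operations (but not the unit).\<close>

definition operators_on :: "'h::complex_hilbert_space set \<Rightarrow> ('h \<Rightarrow>\<^sub>L 'h) set"
  where "operators_on L = {T \<in> bounded_operators. range (blinfun_apply T) \<subseteq> L \<and>
    (\<forall>x. (\<forall>y\<in>L. cinner x y = 0) \<longrightarrow> blinfun_apply T x = 0)}"

definition representation_on ::
    "('a::complex_hilbert_space \<Rightarrow>\<^sub>L 'a) set \<Rightarrow> 'h::complex_hilbert_space set \<Rightarrow>
      (('a \<Rightarrow>\<^sub>L 'a) \<Rightarrow> ('h \<Rightarrow>\<^sub>L 'h)) \<Rightarrow> bool"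
  where "representation_on A L \<theta> \<longleftrightarrow> (\<forall>a\<in>A. \<theta> a \<in> operators_on L) \<and>
    (\<forall>a\<in>A. \<forall>b\<in>A. \<theta> (a + b) = \<theta> a + \<theta> b \<and> \<theta> (a o\<^sub>L b) = \<theta> a o\<^sub>L \<theta> b) \<and>
    (\<forall>c. \<forall>a\<in>A. \<theta> (scaleC_op c a) = scaleC_op c (\<theta> a)) \<and>
    continuous_on A \<theta>"

text \<open>A formula of HOL cannot quantify over all Hilbert spaces. Here \<open>L\<close> ranges over the closed
  subspaces of \<open>\<ell>\<^sup>2(I)\<close>, where \<open>I\<close> is the type \<open>'a \<Rightarrow>\<^sub>L 'a\<close>, that is, up to unitary equivalence over all
  Hilbert spaces whose orthonormal bases have at most \<open>|I|\<close> elements.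

  For a subalgebra \<open>A\<close> of \<open>B(H)\<close> this bound loses nothing: the property below is equivalent to the
  reduction property for all representations of \<open>A\<close>. If \<open>H = 0\<close>, both hold, so let \<open>H \<noteq> 0\<close>; then
  \<open>\<kappa> = |I|\<close> is infinite with \<open>|A| \<le> \<kappa>\<close>. Let \<open>\<theta>\<close> be a representation on a Hilbert space \<open>M\<close> of any size and
  \<open>V \<subseteq> M\<close> a submodule. Each finite subset of \<open>M\<close> lies in a submodule \<open>N\<close> of \<open>M\<close> of dimension at
  most \<open>\<kappa>\<close>, and each such \<open>N\<close> has a bounded module projection onto \<open>V \<inter> N\<close>. These projections can be
  chosen bounded by one constant: otherwise pick \<open>N\<^sub>1, N\<^sub>2, \<dots>\<close> whose optimal constants are unbounded; the
  Hilbert sum of the \<open>N\<^sub>n\<close> has dimension at most \<open>\<kappa>\<close> and hence a module projection onto the sum of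
  the \<open>V \<inter> N\<^sub>n\<close>, and its compressions to the \<open>N\<^sub>n\<close> are module projections bounded by its norm. A weak
  cluster point of the projections, along the directed set of all such \<open>N\<close>, is a module projection of
  \<open>M\<close> onto \<open>V\<close>, whose kernel is a complement of \<open>V\<close>.\<close>

definition total_reduction_property :: "('a::complex_hilbert_space \<Rightarrow>\<^sub>L 'a) set \<Rightarrow> bool"
  where "total_reduction_property A \<longleftrightarrow>
    (\<forall>(L :: ('a \<Rightarrow>\<^sub>L 'a, complex) ell2 set) \<theta>.
      csubspace L \<and> closed L \<and> representation_on A L \<theta> \<longrightarrow> reduction_property (\<theta> ` A) L)"

end

theory Submission
  imports Defs "HOL-Computational_Algebra.Fundamental_Theorem_Algebra"
begin

text \<open>Complete reduction makes the commutant \<open>A'\<close> semiprime: if \<open>\<tau> \<in> A'\<close> and \<open>\<tau> A' \<tau> = 0\<close>, a module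
  projection built from the graphs of the multiples of \<open>\<tau>\<close> forces \<open>\<tau> = 0\<close>. Hence every closed
  \<open>A'\<close>-invariant subspace is the range of a central idempotent of \<open>A'\<close>, with a uniform bound on the
  norms, and Dixmier's similarity makes all these idempotents self-adjoint. A compact operator in
  \<open>A'\<close> attains its norm on a minimal such subspace, where Lomonosov's lemma yields a nonzero
  finite-dimensional \<open>A\<close>-submodule. So the joint eigenvectors of \<open>A\<close> are total, the eigenspaces are
  orthogonal, and \<open>A''\<close> is an abelian C*-algebra. Complete reduction also identifies the
  \<open>\<sigma>\<close>-weak closure of \<open>A\<close> with the part of \<open>A''\<close> vanishing on the common kernel of \<open>A\<close>.

  Under total reduction, suppose that \<open>b\<close> lies in the (already diagonalised) \<open>A\<close> but \<open>b\<^sup>*\<close> does not, at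
  distance \<open>d > 0\<close>. Separation of convex sets gives a state \<open>\<omega>\<close> of the C*-algebra with
  \<open>\<omega> (|b\<^sup>* - a|\<^sup>2) \<ge> d\<^sup>2\<close> for all \<open>a \<in> A\<close>. In its Gelfand-Naimark-Segal representation the module projection onto the
  closure of \<open>\<pi>(A) \<xi>\<close> commutes with \<open>\<pi>(b)\<close>, hence with \<open>\<pi>(b\<^sup>*)\<close> by Fuglede, so \<open>\<pi>(b\<^sup>*) \<xi>\<close> would lie
  in that closure.\<close>

section \<open>Complex Hilbert spaces\<close>

text \<open>Complete reduction provides idempotents not in \<open>A\<close> but in infinite matrices
  over \<open>commutant A\<close>, which is why the commutant carries the argument. The infinitely
  many coordinates turn existence into uniform bounds: one bounded projection treats countably many
  submodules of H at once. Only central idempotents are made self-adjoint, because their involutions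
  2q - 1 form a bounded commutative group, for which an invariant inner product exists. Since
  \<open>A\<close> may lack a unit, a vector z need not lie in the closure of its orbit A z; this is
  the origin of the kernel condition in the description of the closure, and of the splitting of a
  vector into its projection and a remainder killed by \<open>A\<close> in both density arguments.
  Complete reduction sees only sums of copies of H, hence the sigma-weak topology. A state that
  detects the norm distance to \<open>A\<close> need not be sigma-weakly continuous, and its
  representation need not occur in a sum of copies of H; this is where total reduction
  enters.\<close>

lemma cauchy_schwarz: "cmod (cinner x y) \<le> norm x * norm (y :: 'a::complex_hilbert_space)"
proof (cases "x = 0 \<or> y = 0")
  case True
  have "cinner 0 y = 0" "cinner x 0 = 0"
    using cinner_scaleC_left[of 0 0 y] cinner_scaleC_right[of x 0 0] by simp_all
  with True show ?thesis
    by auto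
next
  case False
  define a b where "a = complex_of_real (inverse (norm x))" and "b = complex_of_real (inverse (norm y))"
  have n: "norm (a *\<^sub>C x) = 1" "norm (b *\<^sub>C y) = 1"
    using False by (simp_all add: norm_scaleC a_def b_def norm_inverse)
  have "2 * cmod (cinner (a *\<^sub>C x) (b *\<^sub>C y)) \<le> 2"
    using cmod_cinner_le[of "a *\<^sub>C x" "b *\<^sub>C y"] unfolding n by simp
  then have "inverse (norm x) * (inverse (norm y) * cmod (cinner x y)) \<le> 1"
    by (simp add: cinner_scaleC_left cinner_scaleC_right norm_mult a_def b_def norm_inverse mult.left_commute)
  with False show ?thesis
    by (simp add: field_simps)
qed

interpretation cinner: bounded_bilinear "cinner :: 'a::complex_hilbert_space \<Rightarrow> 'a \<Rightarrow> complex"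
proof
  show "\<exists>K. \<forall>(a::'a) b. norm (cinner a b) \<le> norm a * norm b * K"
    using cauchy_schwarz by (intro exI[of _ 1]) auto
qed (simp_all add: cinner_add_left cinner_add_right scaleR_scaleC cinner_scaleC_left
    cinner_scaleC_right scaleC_complex_def)

declare cinner.zero_left [simp] cinner.zero_right [simp]

interpretation scaleC: bounded_bilinear "scaleC :: complex \<Rightarrow> 'a \<Rightarrow> 'a::complex_hilbert_space"
proof
  show "\<exists>K. \<forall>a (b::'a). norm (a *\<^sub>C b) \<le> norm a * norm b * K"
    by (intro exI[of _ 1]) (simp add: norm_scaleC)
qed (simp_all add: scaleC_add_right scaleC_add_left scaleR_scaleC scaleC_scaleC scaleC_complex_def mult.commute)

lemma norm_square_cinner: "(norm x)\<^sup>2 = Re (cinner x (x :: 'a::complex_hilbert_space))"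
  by (simp add: cinner_self)

lemma cinner_eq_zero_commute: "cinner x y = 0 \<longleftrightarrow> cinner y (x :: 'a::complex_hilbert_space) = 0"
  by (metis cinner_commute complex_cnj_zero)

lemma cinner_self_eq_zero [simp]: "cinner x x = 0 \<longleftrightarrow> x = (0 :: 'a::complex_hilbert_space)"
  by (simp add: cinner_self)

lemma cinner_ext:
  assumes "\<And>y. cinner x y = cinner x' (y :: 'a::complex_hilbert_space)"
  shows "x = x'"
  using assms[of "x - x'"] cinner_self_eq_zero[of "x - x'"] by (simp add: cinner.diff_left)

lemma norm_square_add:
  "(norm (x + y))\<^sup>2 = (norm x)\<^sup>2 + (norm (y :: 'a::complex_hilbert_space))\<^sup>2 + 2 * Re (cinner x y)"
proof -
  have "Re (cinner y x) = Re (cinner x y)"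
    by (subst cinner_commute) simp
  then show ?thesis
    by (simp add: norm_square_cinner cinner_add_left cinner_add_right)
qed

lemma norm_square_diff:
  "(norm (x - y))\<^sup>2 = (norm x)\<^sup>2 + (norm (y :: 'a::complex_hilbert_space))\<^sup>2 - 2 * Re (cinner x y)"
  using norm_square_add[of x "- y"] by (simp add: cinner.minus_right)

lemma pythagoras:
  "cinner x y = 0 \<Longrightarrow> (norm (x + y))\<^sup>2 = (norm x)\<^sup>2 + (norm (y :: 'a::complex_hilbert_space))\<^sup>2"
  by (simp add: norm_square_add)

lemma parallelogram:
  "(norm (x + y))\<^sup>2 + (norm (x - y))\<^sup>2 = 2 * (norm x)\<^sup>2 + 2 * (norm (y :: 'a::complex_hilbert_space))\<^sup>2"
  by (simp add: norm_square_add norm_square_diff)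

lemma csubspace_diff: "csubspace V \<Longrightarrow> x \<in> V \<Longrightarrow> y \<in> V \<Longrightarrow> x - y \<in> V"
  by (simp add: complex_vector.subspace_diff)

lemma csubspace_scaleR: "csubspace V \<Longrightarrow> x \<in> V \<Longrightarrow> r *\<^sub>R x \<in> V"
  by (simp add: complex_vector.subspace_scale scaleR_scaleC)

lemma csubspace_closure:
  assumes "csubspace (V :: 'a::complex_hilbert_space set)"
  shows "csubspace (closure V)"
proof (rule complex_vector.subspaceI)
  show "0 \<in> closure V"
    using assms closure_subset complex_vector.subspace_0 by blast
next
  fix x y assume "x \<in> closure V" "y \<in> closure V"
  then obtain f g where "\<And>n::nat. f n \<in> V" "f \<longlonglongrightarrow> x" "\<And>n::nat. g n \<in> V" "g \<longlonglongrightarrow> y"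
    unfolding closure_sequential by blast
  then show "x + y \<in> closure V"
    unfolding closure_sequential using assms
    by (intro exI[of _ "\<lambda>n. f n + g n"]) (auto intro: tendsto_add complex_vector.subspace_add)
next
  fix c x assume "x \<in> closure V"
  then obtain f where "\<And>n::nat. f n \<in> V" "f \<longlonglongrightarrow> x"
    unfolding closure_sequential by blast
  then show "c *\<^sub>C x \<in> closure V"
    unfolding closure_sequential using assms
    by (intro exI[of _ "\<lambda>n. c *\<^sub>C f n"])
      (auto intro: complex_vector.subspace_scale scaleC.tendsto[OF tendsto_const])
qed

section \<open>Orthogonal complements and nearest points\<close>

definition orth :: "'a::complex_hilbert_space set \<Rightarrow> 'a set"
  where "orth V = {x. \<forall>v\<in>V. cinner x v = 0}"

lemma csubspace_orth: "csubspace (orth V)"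
  by (rule complex_vector.subspaceI) (auto simp: orth_def cinner_add_left cinner_scaleC_left)

lemma closed_orth: "closed (orth V)"
proof -
  have "orth V = (\<Inter>v\<in>V. {x. cinner x v = 0})"
    by (auto simp: orth_def)
  also have "closed \<dots>"
    by (intro closed_INT ballI closed_Collect_eq continuous_intros cinner.continuous_on)
  finally show ?thesis .
qed

lemma orth_disjoint: "x \<in> V \<Longrightarrow> x \<in> orth V \<Longrightarrow> x = 0"
  using cinner_self_eq_zero by (auto simp: orth_def)

theorem closest_point_orthogonal:
  fixes x :: "'a::complex_hilbert_space"
  assumes V: "csubspace V" "closed V"
  shows "\<exists>v\<in>V. x - v \<in> orth V"
proof -
  define d where "d = infdist x V"
  have ne: "V \<noteq> {}"
    using V(1) complex_vector.subspace_0 by blast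
  have d0: "0 \<le> d"
    by (simp add: d_def infdist_nonneg)
  have dle: "d \<le> norm (x - v)" if "v \<in> V" for v
    using infdist_le[OF that, of x] by (simp add: d_def dist_norm)
  have "\<exists>v\<in>V. (norm (x - v))\<^sup>2 \<le> d\<^sup>2 + inverse (real (Suc n))" for n
  proof -
    have "d < sqrt (d\<^sup>2 + inverse (real (Suc n)))"
      by (rule real_less_rsqrt) simp
    then obtain v where v: "v \<in> V" "dist x v < sqrt (d\<^sup>2 + inverse (real (Suc n)))"
      unfolding d_def infdist_notempty[OF ne] by (subst (asm) cINF_less_iff[OF ne]) auto
    have "(norm (x - v))\<^sup>2 \<le> (sqrt (d\<^sup>2 + inverse (real (Suc n))))\<^sup>2"
      using v(2) by (intro power_mono) (simp_all add: dist_norm)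
    then show ?thesis
      using v(1) by (intro bexI[of _ v]) simp_all
  qed
  then obtain v where v: "\<And>n. v n \<in> V" "\<And>n. (norm (x - v n))\<^sup>2 \<le> d\<^sup>2 + inverse (real (Suc n))"
    by metis
  \<comment> \<open>The midpoint of two near-minimisers lies in V, so its distance to x is at least
    d; the parallelogram law then bounds their mutual distance.\<close>
  have dist_v: "(norm (v m - v n))\<^sup>2 \<le> 2 * inverse (real (Suc m)) + 2 * inverse (real (Suc n))" for m n
  proof -
    have "(1/2) *\<^sub>R (v m + v n) \<in> V"
      using V(1) v(1) by (intro csubspace_scaleR complex_vector.subspace_add)
    from dle[OF this] have "d\<^sup>2 \<le> (norm (x - (1/2) *\<^sub>R (v m + v n)))\<^sup>2"
      using d0 by (intro power_mono)
    also have "x - (1/2) *\<^sub>R (v m + v n) = (1/2) *\<^sub>R ((x - v m) + (x - v n))"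
      by (simp add: algebra_simps scaleR_left_distrib[symmetric])
    also have "(norm \<dots>)\<^sup>2 = (norm ((x - v m) + (x - v n)))\<^sup>2 / 4"
      by (simp add: power_mult_distrib power_divide)
    finally have "4 * d\<^sup>2 \<le> (norm ((x - v m) + (x - v n)))\<^sup>2" by simp
    moreover have "(x - v m) - (x - v n) = - (v m - v n)" by simp
    ultimately show ?thesis
      using parallelogram[of "x - v m" "x - v n"] v(2)[of m] v(2)[of n]
      by (simp only: norm_minus_cancel)
  qed
  have "Cauchy v"
  proof (rule CauchyI)
    fix e :: real assume e: "0 < e"
    then obtain M where M: "inverse (real (Suc M)) < e\<^sup>2 / 4"
      using reals_Archimedean[of "e\<^sup>2 / 4"] by auto
    have "norm (v m - v n) < e" if "m \<ge> M" "n \<ge> M" for m n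
    proof -
      have i: "inverse (real (Suc k)) \<le> inverse (real (Suc M))" if "k \<ge> M" for k
        using that by (simp add: inverse_le_iff_le)
      have "(norm (v m - v n))\<^sup>2 < e\<^sup>2"
        using dist_v[of m n] M i[OF that(1)] i[OF that(2)] by linarith
      then show ?thesis
        using e by (simp add: power_less_imp_less_base)
    qed
    then show "\<exists>M. \<forall>m\<ge>M. \<forall>n\<ge>M. norm (v m - v n) < e" by blast
  qed
  then obtain w where w: "v \<longlonglongrightarrow> w"
    using Cauchy_convergent_iff convergent_def by blast
  have wV: "w \<in> V"
    using closed_sequentially[OF V(2)] v(1) w by blast
  have wd: "(norm (x - w))\<^sup>2 \<le> d\<^sup>2"
  proof (rule LIMSEQ_le)
    show "(\<lambda>n. (norm (x - v n))\<^sup>2) \<longlonglongrightarrow> (norm (x - w))\<^sup>2"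
      by (intro tendsto_intros w)
    show "(\<lambda>n. d\<^sup>2 + inverse (real (Suc n))) \<longlonglongrightarrow> d\<^sup>2"
      using tendsto_add[OF tendsto_const LIMSEQ_inverse_real_of_nat, of "d\<^sup>2"] by simp
  qed (use v(2) in blast)
  have "cinner (x - w) u = 0" if u: "u \<in> V" for u
  proof (rule ccontr)
    define a where "a = cinner (x - w) u"
    assume "cinner (x - w) u \<noteq> 0"
    then have a0: "a \<noteq> 0" "u \<noteq> 0"
      by (auto simp: a_def cinner.zero_right)
    \<comment> \<open>For this t the point w + t a u is the nearest one to x on the complex line
      through w in direction u, so it is strictly nearer than w when a is nonzero.\<close>
    define t where "t = inverse ((norm u)\<^sup>2)"
    let ?c = "complex_of_real t * a"
    have "w + ?c *\<^sub>C u \<in> V"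
      using V(1) wV u by (intro complex_vector.subspace_add complex_vector.subspace_scale)
    from dle[OF this] have "d\<^sup>2 \<le> (norm ((x - w) - ?c *\<^sub>C u))\<^sup>2"
      using d0 by (simp add: power_mono diff_diff_eq)
    also have "\<dots> = (norm (x - w))\<^sup>2 + (t * cmod a * norm u)\<^sup>2 - 2 * Re (cnj ?c * a)"
      unfolding norm_square_diff by (simp add: cinner_scaleC_right norm_scaleC norm_mult norm_inverse norm_power a_def[symmetric] t_def)
    also have "Re (cnj ?c * a) = t * (cmod a)\<^sup>2"
      unfolding cmod_power2 by (simp add: power2_eq_square algebra_simps)
    also have "(t * cmod a * norm u)\<^sup>2 = t * (cmod a)\<^sup>2"
      using a0 by (simp add: t_def power_mult_distrib) (simp add: power2_eq_square field_simps)
    finally have "t * (cmod a)\<^sup>2 \<le> 0"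
      using wd by linarith
    moreover have "0 < t * (cmod a)\<^sup>2"
      using a0 by (simp add: t_def)
    ultimately show False by linarith
  qed
  then show ?thesis
    using wV by (auto simp: orth_def)
qed

subsection \<open>Operators\<close>

lemma bounded_operatorsD: "T \<in> bounded_operators \<Longrightarrow> blinfun_apply T (c *\<^sub>C x) = c *\<^sub>C blinfun_apply T x"
  by (simp add: bounded_operators_def)

lemma ex_operator:
  fixes f :: "'a::complex_hilbert_space \<Rightarrow> 'a"
  assumes "\<And>x y. f (x + y) = f x + f y" "\<And>c x. f (c *\<^sub>C x) = c *\<^sub>C f x"
    and "\<And>x. norm (f x) \<le> K * norm x"
  shows "\<exists>T\<in>bounded_operators. (\<forall>x. blinfun_apply T x = f x) \<and> norm T \<le> \<bar>K\<bar>"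
proof -
  have bl: "bounded_linear f"
    by (rule bounded_linear_intro[of _ "K"]) (use assms in \<open>simp_all add: scaleR_scaleC mult.commute\<close>)
  have "norm (Blinfun f) \<le> \<bar>K\<bar>"
  proof (rule norm_blinfun_bound)
    show "norm (Blinfun f x) \<le> \<bar>K\<bar> * norm x" for x
      using assms(3)[of x] mult_right_mono[OF abs_ge_self[of K] norm_ge_zero[of x]] bl
      by (simp add: bounded_linear_Blinfun_apply)
  qed simp
  with bl assms(2) show ?thesis
    by (intro bexI[of _ "Blinfun f"]) (auto simp: bounded_operators_def bounded_linear_Blinfun_apply)
qed

lemma scaleC_op_apply [simp]: "blinfun_apply (scaleC_op c T) x = c *\<^sub>C blinfun_apply T x"
  by (simp add: scaleC_op.rep_eq)

lemma bounded_operators_simps [simp, intro]: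
  "0 \<in> bounded_operators" "id_blinfun \<in> bounded_operators"
  "S \<in> bounded_operators \<Longrightarrow> T \<in> bounded_operators \<Longrightarrow> S + T \<in> bounded_operators"
  "S \<in> bounded_operators \<Longrightarrow> T \<in> bounded_operators \<Longrightarrow> S - T \<in> bounded_operators"
  "S \<in> bounded_operators \<Longrightarrow> T \<in> bounded_operators \<Longrightarrow> S o\<^sub>L T \<in> bounded_operators"
  "T \<in> bounded_operators \<Longrightarrow> - T \<in> bounded_operators"
  "T \<in> bounded_operators \<Longrightarrow> scaleC_op c T \<in> bounded_operators"
  "T \<in> bounded_operators \<Longrightarrow> r *\<^sub>R T \<in> bounded_operators"
  by (auto simp: bounded_operators_def blinfun.bilinear_simps scaleC_add_right scaleC.diff_right
      scaleC.minus_right scaleC_scaleC scaleR_scaleC mult.commute)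

lemma scaleR_eq_scaleC_op: "r *\<^sub>R T = scaleC_op (complex_of_real r) T"
  by (rule blinfun_eqI) (simp add: blinfun.scaleR_left scaleR_scaleC)

lemma norm_scaleC_op: "norm (scaleC_op c T) = cmod c * norm T"
proof (rule antisym)
  show *: "norm (scaleC_op c T) \<le> cmod c * norm T" for c and T :: "'a \<Rightarrow>\<^sub>L 'a"
    by (rule norm_blinfun_bound) (auto simp: norm_scaleC mult.assoc intro: mult_left_mono norm_blinfun)
  show "cmod c * norm T \<le> norm (scaleC_op c T)"
  proof (cases "c = 0")
    case False
    have "scaleC_op (inverse c) (scaleC_op c T) = T"
      using False by (intro blinfun_eqI) (simp add: scaleC_scaleC scaleC_one)
    with *[of "inverse c" "scaleC_op c T"] have "norm T \<le> norm (scaleC_op c T) / cmod c"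
      by (simp add: norm_inverse divide_inverse mult.commute)
    with False show ?thesis
      by (simp add: le_divide_eq mult.commute)
  qed simp
qed

lemma closed_bounded_operators: "closed (bounded_operators :: ('a::complex_hilbert_space \<Rightarrow>\<^sub>L 'a) set)"
proof -
  have "bounded_operators = (\<Inter>c. \<Inter>x::'a. {T. blinfun_apply T (c *\<^sub>C x) = c *\<^sub>C blinfun_apply T x})"
    by (auto simp: bounded_operators_def)
  also have "closed \<dots>"
    by (intro closed_INT ballI closed_Collect_eq continuous_intros scaleC.continuous_on)
  finally show ?thesis .
qed

lemma csubspace_eq_set:
  assumes "S \<in> bounded_operators" "T \<in> bounded_operators"
  shows "csubspace {x. blinfun_apply S x = blinfun_apply T x}"
  by (rule complex_vector.subspaceI) (use assms in \<open>auto simp: blinfun.add_right bounded_operatorsD\<close>)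

lemma closed_eq_set: "closed {x. blinfun_apply S x = blinfun_apply T x}"
  by (intro closed_Collect_eq continuous_intros)

lemma csubspace_vimage: "T \<in> bounded_operators \<Longrightarrow> csubspace V \<Longrightarrow> csubspace (blinfun_apply T -` V)"
  by (rule complex_vector.subspaceI)
    (auto simp: blinfun.add_right bounded_operatorsD complex_vector.subspace_add
       complex_vector.subspace_scale complex_vector.subspace_0)

lemma closed_cspan_subset:
  assumes "csubspace V" "closed V" "E \<subseteq> V"
  shows "closure (cspan E) \<subseteq> V"
  using assms by (meson closure_minimal complex_vector.span_minimal)

lemma invariant_closed_cspan:
  assumes T: "T \<in> bounded_operators" and E: "\<And>x. x \<in> E \<Longrightarrow> blinfun_apply T x \<in> closure (cspan E)"
    and x: "x \<in> closure (cspan E)"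
  shows "blinfun_apply T x \<in> closure (cspan E)"
proof -
  have "closure (cspan E) \<subseteq> blinfun_apply T -` closure (cspan E)"
    using E by (intro closed_cspan_subset csubspace_vimage T csubspace_closure
        complex_vector.subspace_span closed_vimage continuous_intros) auto
  with x show ?thesis by blast
qed

lemma operators_eq_if_eq_on_total:
  assumes "S \<in> bounded_operators" "T \<in> bounded_operators" "closure (cspan E) = UNIV"
    and "\<And>x. x \<in> E \<Longrightarrow> blinfun_apply S x = blinfun_apply T x"
  shows "S = T"
proof (rule blinfun_eqI)
  fix x
  have "closure (cspan E) \<subseteq> {x. blinfun_apply S x = blinfun_apply T x}"
    using assms by (intro closed_cspan_subset csubspace_eq_set closed_eq_set) auto
  then show "blinfun_apply S x = blinfun_apply T x"
    using assms(3) by blast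
qed

lemma ex_orthogonal_projection:
  assumes V: "csubspace V" "closed V"
  shows "\<exists>P\<in>bounded_operators. (\<forall>x. blinfun_apply P x \<in> V \<and> x - blinfun_apply P x \<in> orth V)"
proof -
  from closest_point_orthogonal[OF V] obtain f where f: "\<And>x. f x \<in> V" "\<And>x. x - f x \<in> orth V"
    by metis
  have unique: "f x = v" if "v \<in> V" "x - v \<in> orth V" for x v
  proof -
    have "(x - v) - (x - f x) \<in> orth V"
      using that(2) f(2) csubspace_orth by (rule csubspace_diff[rotated])
    moreover have "(x - v) - (x - f x) \<in> V"
      using csubspace_diff[OF V(1) f(1) that(1)] by simp
    ultimately have "(x - v) - (x - f x) = 0"
      using orth_disjoint by blast
    then show ?thesis by simp
  qed
  have "f (x + y) = f x + f y" for x y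
  proof (rule unique)
    show "f x + f y \<in> V"
      by (intro complex_vector.subspace_add V f)
    have "(x - f x) + (y - f y) \<in> orth V"
      by (intro complex_vector.subspace_add csubspace_orth f)
    then show "x + y - (f x + f y) \<in> orth V"
      by (simp add: algebra_simps)
  qed
  moreover have "f (c *\<^sub>C x) = c *\<^sub>C f x" for c x
    by (rule unique) (use f[of x] V(1) in
      \<open>auto simp: complex_vector.subspace_scale[OF csubspace_orth]
        complex_vector.subspace_scale scaleC.diff_right[symmetric]\<close>)
  moreover have "norm (f x) \<le> 1 * norm x" for x
  proof -
    have "cinner (x - f x) (f x) = 0"
      using f[of x] by (auto simp: orth_def)
    from pythagoras[OF this] have "(norm (f x))\<^sup>2 \<le> (norm x)\<^sup>2"
      by simp
    then show ?thesis
      using power2_le_imp_le norm_ge_zero by fastforce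
  qed
  ultimately obtain P where "P \<in> bounded_operators" "\<And>x. blinfun_apply P x = f x"
    using ex_operator[of f 1] by blast
  with f show ?thesis
    by (intro bexI[of _ P]) simp_all
qed

definition cproj :: "'a::complex_hilbert_space set \<Rightarrow> 'a \<Rightarrow>\<^sub>L 'a"
  where "cproj V = (SOME P. P \<in> bounded_operators \<and>
    (\<forall>x. blinfun_apply P x \<in> V \<and> x - blinfun_apply P x \<in> orth V))"

context
  fixes V :: "'a::complex_hilbert_space set"
  assumes V: "csubspace V" "closed V"
begin

lemma cproj: "cproj V \<in> bounded_operators" "blinfun_apply (cproj V) x \<in> V"
    "x - blinfun_apply (cproj V) x \<in> orth V"
  using someI_ex[of "\<lambda>P. P \<in> bounded_operators \<and>
    (\<forall>x. blinfun_apply P x \<in> V \<and> x - blinfun_apply P x \<in> orth V)"] ex_orthogonal_projection[OF V]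
  unfolding cproj_def by blast+

lemma cproj_unique:
  assumes "v \<in> V" "x - v \<in> orth V"
  shows "blinfun_apply (cproj V) x = v"
proof -
  have "(x - v) - (x - cproj V x) \<in> orth V"
    using assms(2) cproj(3) csubspace_orth by (rule csubspace_diff[rotated])
  moreover have "(x - v) - (x - cproj V x) \<in> V"
    using csubspace_diff[OF V(1) cproj(2) assms(1)] by simp
  ultimately have "(x - v) - (x - cproj V x) = 0"
    using orth_disjoint by blast
  then show ?thesis by simp
qed

lemma cproj_same: "x \<in> V \<Longrightarrow> blinfun_apply (cproj V) x = x"
  by (rule cproj_unique) (auto simp: orth_def cinner.zero_left)

lemma cproj_orth: "x \<in> orth V \<Longrightarrow> blinfun_apply (cproj V) x = 0"
  using V by (intro cproj_unique) (auto simp: complex_vector.subspace_0)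

end

lemma closed_csubspace_eq_UNIV:
  assumes "csubspace V" "closed V" "orth V \<subseteq> {0}"
  shows "V = UNIV"
proof (rule UNIV_eq_I[symmetric])
  fix x
  have "x - cproj V x = 0"
    using cproj(3)[OF assms(1,2)] assms(3) by blast
  then show "x \<in> V"
    using cproj(2)[OF assms(1,2), of x] by simp
qed

section \<open>Riesz representation, sesquilinear forms and adjoints\<close>

theorem riesz_representation:
  fixes \<phi> :: "'a::complex_hilbert_space \<Rightarrow> complex"
  assumes add: "\<And>x y. \<phi> (x + y) = \<phi> x + \<phi> y" and scale: "\<And>c x. \<phi> (c *\<^sub>C x) = c * \<phi> x"
    and bd: "\<And>x. cmod (\<phi> x) \<le> K * norm x"
  shows "\<exists>u. (\<forall>x. \<phi> x = cinner x u) \<and> norm u \<le> \<bar>K\<bar>"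
proof -
  have "\<exists>u. \<forall>x. \<phi> x = cinner x u"
  proof (cases "\<forall>x. \<phi> x = 0")
    case True
    then show ?thesis
      by (intro exI[of _ 0]) (simp add: cinner.zero_right)
  next
    case False
    then obtain x where x: "\<phi> x \<noteq> 0" by blast
    have bl: "bounded_linear \<phi>"
      by (rule bounded_linear_intro[of _ K])
        (use add scale bd in \<open>simp_all add: scaleR_scaleC scaleC_complex_def mult.commute\<close>)
    let ?V = "{x. \<phi> x = 0}"
    have V: "csubspace ?V" "closed ?V"
      by (rule complex_vector.subspaceI)
        (use add scale bl in \<open>auto simp: bounded_linear.linear linear_0
          intro!: closed_Collect_eq linear_continuous_on continuous_intros\<close>)
    define w where "w = x - cproj ?V x"
    have w: "w \<in> orth ?V"
      unfolding w_def by (rule cproj(3)[OF V])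
    have "\<phi> w = \<phi> x"
      using cproj(2)[OF V, of x] linear_diff[OF bounded_linear.linear[OF bl]] by (simp add: w_def)
    with x have fw: "\<phi> w \<noteq> 0" by simp
    then have w0: "w \<noteq> 0"
      using linear_0[OF bounded_linear.linear[OF bl]] by auto
    have "\<phi> y = cinner y (cnj (\<phi> w / complex_of_real ((norm w)\<^sup>2)) *\<^sub>C w)" for y
    proof -
      have "\<phi> w *\<^sub>C y - \<phi> y *\<^sub>C w \<in> ?V"
        using linear_diff[OF bounded_linear.linear[OF bl]] by (simp add: scale mult.commute)
      then have "cinner (\<phi> w *\<^sub>C y - \<phi> y *\<^sub>C w) w = 0"
        using w cinner_eq_zero_commute by (auto simp: orth_def)
      then have "\<phi> w * cinner y w = \<phi> y * complex_of_real ((norm w)\<^sup>2)"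
        by (simp add: cinner.diff_left cinner_scaleC_left cinner_self)
      then show ?thesis
        using w0 by (simp add: cinner_scaleC_right field_simps)
    qed
    then show ?thesis by blast
  qed
  then obtain u where u: "\<And>x. \<phi> x = cinner x u" by blast
  have "(norm u)\<^sup>2 \<le> \<bar>K\<bar> * norm u"
    using bd[of u] mult_right_mono[OF abs_ge_self[of K] norm_ge_zero[of u]]
    by (simp add: u cinner_self norm_power)
  then have "norm u \<le> \<bar>K\<bar>"
    by (cases "u = 0") (simp_all add: power2_eq_square)
  with u show ?thesis by blast
qed

theorem sesquilinear_representation:
  fixes B :: "'a::complex_hilbert_space \<Rightarrow> 'a \<Rightarrow> complex"
  assumes "\<And>x y z. B (x + y) z = B x z + B y z" "\<And>c x y. B (c *\<^sub>C x) y = c * B x y"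
    and "\<And>x y z. B x (y + z) = B x y + B x z" "\<And>c x y. B x (c *\<^sub>C y) = cnj c * B x y"
    and bd: "\<And>x y. cmod (B x y) \<le> K * norm x * norm y"
  shows "\<exists>Q\<in>bounded_operators. (\<forall>x y. B x y = cinner (blinfun_apply Q x) y) \<and> norm Q \<le> \<bar>K\<bar>"
proof -
  have "\<exists>u. (\<forall>y. cnj (B x y) = cinner y u) \<and> norm u \<le> \<bar>K * norm x\<bar>" for x
    by (rule riesz_representation) (use assms in simp_all)
  then obtain f where f: "\<And>x y. cnj (B x y) = cinner y (f x)" "\<And>x. norm (f x) \<le> \<bar>K * norm x\<bar>"
    by metis
  have Bf: "B x y = cinner (f x) y" for x y
    using arg_cong[OF f(1)[of x y], of cnj] cinner_commute[of "f x" y] by simp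
  have "f (x + y) = f x + f y" for x y
    by (rule cinner_ext) (simp add: Bf[symmetric] assms cinner_add_left)
  moreover have "f (c *\<^sub>C x) = c *\<^sub>C f x" for c x
    by (rule cinner_ext) (simp add: Bf[symmetric] assms cinner_scaleC_left)
  moreover have "norm (f x) \<le> \<bar>K\<bar> * norm x" for x
    using f(2)[of x] by (simp add: abs_mult)
  ultimately obtain Q where "Q \<in> bounded_operators" "\<And>x. blinfun_apply Q x = f x" "norm Q \<le> \<bar>K\<bar>"
    using ex_operator[of f "\<bar>K\<bar>"] by auto
  then show ?thesis
    using Bf by (intro bexI[of _ Q]) simp_all
qed

lemma ex_adjoint:
  assumes T: "T \<in> bounded_operators"
  shows "\<exists>T'\<in>bounded_operators. is_adjoint T T' \<and> norm T' \<le> norm T"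
proof -
  have "\<exists>Q\<in>bounded_operators. (\<forall>x y. cinner x (T y) = cinner (blinfun_apply Q x) y) \<and> norm Q \<le> \<bar>norm T\<bar>"
  proof (rule sesquilinear_representation)
    show "cmod (cinner x (T y)) \<le> norm T * norm x * norm y" for x y
      using order_trans[OF cauchy_schwarz mult_left_mono[OF norm_blinfun[of T y] norm_ge_zero[of x]]]
      by (simp add: mult_ac)
  qed (simp_all add: cinner_add_left cinner_add_right cinner_scaleC_left cinner_scaleC_right
      blinfun.add_right bounded_operatorsD[OF T])
  then obtain Q where Q: "Q \<in> bounded_operators" "\<And>x y. cinner x (T y) = cinner (Q x) y" "norm Q \<le> norm T"
    by auto
  have "is_adjoint T Q"
    unfolding is_adjoint_def using Q(2) cinner_commute by metis
  with Q show ?thesis by blast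
qed

definition cadj :: "('a::complex_hilbert_space \<Rightarrow>\<^sub>L 'a) \<Rightarrow> ('a \<Rightarrow>\<^sub>L 'a)"
  where "cadj T = (SOME T'. T' \<in> bounded_operators \<and> is_adjoint T T' \<and> norm T' \<le> norm T)"

lemma cadj:
  assumes "T \<in> bounded_operators"
  shows "cadj T \<in> bounded_operators" "cinner (blinfun_apply T x) y = cinner x (blinfun_apply (cadj T) y)"
    "cinner (blinfun_apply (cadj T) x) y = cinner x (blinfun_apply T y)" "norm (cadj T) \<le> norm T"
proof -
  have *: "cadj T \<in> bounded_operators \<and> is_adjoint T (cadj T) \<and> norm (cadj T) \<le> norm T"
    using someI_ex[of "\<lambda>T'. T' \<in> bounded_operators \<and> is_adjoint T T' \<and> norm T' \<le> norm T"]
      ex_adjoint[OF assms] unfolding cadj_def by blast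
  then show "cadj T \<in> bounded_operators" "cinner (blinfun_apply T x) y = cinner x (blinfun_apply (cadj T) y)"
    "norm (cadj T) \<le> norm T" for x y
    by (simp_all add: is_adjoint_def)
  then show "cinner (blinfun_apply (cadj T) x) y = cinner x (blinfun_apply T y)"
    using cinner_commute by metis
qed

lemma cadj_unique:
  assumes "T \<in> bounded_operators" "\<And>x y. cinner (blinfun_apply T x) y = cinner x (blinfun_apply S y)"
  shows "cadj T = S"
proof (rule blinfun_eqI, rule cinner_ext)
  fix y z
  show "cinner (cadj T y) z = cinner (S y) z"
    using cadj(2)[OF assms(1)] assms(2) cinner_commute by metis
qed

section \<open>Schauder's fixed point theorem\<close>

text \<open>The dimension is a number and not a type, because in Schauder's theorem it is the size
  of a finite net found during the proof.\<close>

definition nat_cube :: "nat \<Rightarrow> (nat \<Rightarrow> real) set"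
  where "nat_cube n = {x. (\<forall>i<n. 0 \<le> x i \<and> x i \<le> 1) \<and> (\<forall>i\<ge>n. x i = 0)}"

lemma compact_nat_cube: "compact (nat_cube n)"
proof -
  have "nat_cube n = Pi\<^sub>E UNIV (\<lambda>i. if i < n then {0..1} else {0})"
    unfolding nat_cube_def PiE_UNIV_domain by (auto simp: Pi_iff split: if_splits)
  moreover have "compactin (product_topology (\<lambda>i. euclidean) UNIV)
      (Pi\<^sub>E UNIV (\<lambda>i::nat. if i < n then {0..1::real} else {0}))"
    by (subst compactin_PiE) auto
  ultimately show ?thesis
    by (metis compactin_euclidean_iff euclidean_product_topology)
qed

lemma tendsto_funI:
  fixes f :: "'a \<Rightarrow> 'i \<Rightarrow> 'b::topological_space"
  assumes "\<And>i. ((\<lambda>x. f x i) \<longlongrightarrow> l i) F"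
  shows "(f \<longlongrightarrow> l) F"
  using assms limitin_componentwise[of "\<lambda>i::'i. euclidean :: 'b topology" UNIV f l F]
  by (simp add: euclidean_product_topology)

lemma tendsto_funD:
  fixes f :: "'a \<Rightarrow> 'i \<Rightarrow> 'b::topological_space"
  assumes "(f \<longlongrightarrow> l) F"
  shows "((\<lambda>x. f x i) \<longlongrightarrow> l i) F"
  using assms limitin_componentwise[of "\<lambda>i::'i. euclidean :: 'b topology" UNIV f l F]
  by (simp add: euclidean_product_topology)

text \<open>Kuhn's labelling: the label 0 or 1 of coordinate i records whether f pushes that
  coordinate up or down. On each grid a small cube carries both labels in every coordinate; at a
  limit of such cubes no coordinate is moved.\<close>

lemma brouwer_nat_cube:
  fixes f :: "(nat \<Rightarrow> real) \<Rightarrow> nat \<Rightarrow> real"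
  assumes cont: "continuous_on (nat_cube n) f" and f: "\<And>x. x \<in> nat_cube n \<Longrightarrow> f x \<in> nat_cube n"
  shows "\<exists>x\<in>nat_cube n. f x = x"
proof -
  have 1: "\<forall>x. x \<in> nat_cube n \<longrightarrow> f x \<in> nat_cube n"
    using f by blast
  have 2: "\<forall>x. x \<in> nat_cube n \<longrightarrow> (\<forall>i. i < n \<longrightarrow> 0 \<le> x i \<and> x i \<le> 1)"
    by (simp add: nat_cube_def)
  obtain l where l1: "\<And>x i. l x i \<le> (1::nat)" and
    l0: "\<And>x i. x \<in> nat_cube n \<Longrightarrow> i < n \<Longrightarrow> x i = 0 \<Longrightarrow> l x i = 0" and
    l2: "\<And>x i. x \<in> nat_cube n \<Longrightarrow> i < n \<Longrightarrow> x i = 1 \<Longrightarrow> l x i = 1" and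
    l3: "\<And>x i. x \<in> nat_cube n \<Longrightarrow> i < n \<Longrightarrow> l x i = 0 \<Longrightarrow> x i \<le> f x i" and
    l4: "\<And>x i. x \<in> nat_cube n \<Longrightarrow> i < n \<Longrightarrow> l x i = 1 \<Longrightarrow> f x i \<le> x i"
    using kuhn_labelling_lemma'[OF 1 2] by blast
  \<comment> \<open>Grid points of mesh 1 / (p + 1); numerators run from 0 to p + 1, so the faces of
    the cube belong to the grid.\<close>
  define pt where "pt p (r :: nat \<Rightarrow> nat) = (\<lambda>i. if i < n then real (r i) / real (Suc p) else 0)" for p r
  have pt: "pt p r \<in> nat_cube n" if "\<And>i. i < n \<Longrightarrow> r i \<le> Suc p" for p r
    using that of_nat_mono[OF that, where 'a=real] by (auto simp: nat_cube_def pt_def)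
  have "\<exists>q. (\<forall>i<n. q i < Suc p) \<and> (\<forall>i<n. \<exists>r s. (\<forall>j<n. q j \<le> r j \<and> r j \<le> q j + 1) \<and>
      (\<forall>j<n. q j \<le> s j \<and> s j \<le> q j + 1) \<and> l (pt p r) i \<noteq> l (pt p s) i)" for p
  proof -
    have a: "\<forall>x. (\<forall>i<n. x i \<le> Suc p) \<longrightarrow> (\<forall>i<n. l (pt p x) i = (0::nat) \<or> l (pt p x) i = 1)"
      using l1 by (simp add: le_Suc_eq)
    have b: "\<forall>x. (\<forall>i<n. x i \<le> Suc p) \<longrightarrow> (\<forall>i<n. x i = 0 \<longrightarrow> l (pt p x) i = 0)"
      using pt l0 by (simp add: pt_def)
    have c: "\<forall>x. (\<forall>i<n. x i \<le> Suc p) \<longrightarrow> (\<forall>i<n. x i = Suc p \<longrightarrow> l (pt p x) i = 1)"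
    proof (intro allI impI)
      fix x i assume "\<forall>i<n. x i \<le> Suc p" "i < n" "x i = Suc p"
      then show "l (pt p x) i = 1"
        using l2[OF pt[of x p]] by (simp add: pt_def)
    qed
    show ?thesis
      using kuhn_lemma[of "Suc p" n "\<lambda>x. l (pt p x)", OF _ a b c] by (metis zero_less_Suc)
  qed
  then have "\<forall>p. \<exists>q. (\<forall>i<n. q i < Suc p) \<and> (\<forall>i<n. \<exists>r s. (\<forall>j<n. q j \<le> r j \<and> r j \<le> q j + 1) \<and>
      (\<forall>j<n. q j \<le> s j \<and> s j \<le> q j + 1) \<and> l (pt p r) i \<noteq> l (pt p s) i)"
    by blast
  from choice[OF this] obtain q where q: "\<And>p i. i < n \<Longrightarrow> q p i < Suc p"
    and ex: "\<And>p i. i < n \<Longrightarrow> \<exists>r s. (\<forall>j<n. q p j \<le> r j \<and> r j \<le> q p j + 1) \<and>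
      (\<forall>j<n. q p j \<le> s j \<and> s j \<le> q p j + 1) \<and> l (pt p r) i \<noteq> l (pt p s) i"
    by blast
  have ex': "\<exists>r s. (\<forall>j<n. q p j \<le> r j \<and> r j \<le> q p j + 1) \<and>
      (\<forall>j<n. q p j \<le> s j \<and> s j \<le> q p j + 1) \<and> l (pt p r) i = 0 \<and> l (pt p s) i = 1"
    if "i < n" for p i
  proof -
    have l01: "l x i = 0 \<or> l x i = 1" for x
      using l1[of x i] by linarith
    from ex[OF that, of p] obtain r s where rs: "\<forall>j<n. q p j \<le> r j \<and> r j \<le> q p j + 1"
      "\<forall>j<n. q p j \<le> s j \<and> s j \<le> q p j + 1" and d: "l (pt p r) i \<noteq> l (pt p s) i"
      by blast
    show ?thesis
    proof (cases "l (pt p r) i = 0")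
      case True
      with d l01 have "l (pt p s) i = 1" by metis
      with True rs show ?thesis by blast
    next
      case False
      with d l01 have "l (pt p r) i = 1" "l (pt p s) i = 0" by metis+
      with rs show ?thesis by blast
    qed
  qed
  define z where "z p = pt p (q p)" for p
  have "seq_compact (nat_cube n)"
    using compact_nat_cube compact_imp_seq_compact by blast
  moreover have "z p \<in> nat_cube n" for p
    unfolding z_def by (rule pt) (simp add: q less_imp_le)
  ultimately obtain x \<sigma> where x: "x \<in> nat_cube n" and \<sigma>: "strict_mono \<sigma>" "(z \<circ> \<sigma>) \<longlonglongrightarrow> x"
    unfolding seq_compact_def by metis
  \<comment> \<open>Whichever corners of the small cubes are chosen, the limit is the same, so the
    inequalities from the two labels meet at one point x.\<close>
  have near: "(\<lambda>p. pt (\<sigma> p) (r (\<sigma> p))) \<longlonglongrightarrow> x"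
    if r: "\<And>p j. j < n \<Longrightarrow> q p j \<le> r p j \<and> r p j \<le> q p j + 1" for r
  proof (rule tendsto_funI)
    fix i
    have zi: "(\<lambda>p. z (\<sigma> p) i) \<longlonglongrightarrow> x i"
      using tendsto_funD[OF \<sigma>(2)] by (simp add: o_def)
    have d: "norm (pt p (r p) i - z p i) \<le> 1 / real (Suc p)" for p
      using r[of i p] by (auto simp: pt_def z_def diff_divide_distrib[symmetric] divide_simps)
    have "(\<lambda>p. pt (\<sigma> p) (r (\<sigma> p)) i - z (\<sigma> p) i) \<longlonglongrightarrow> 0"
    proof (rule Lim_null_comparison)
      show "(\<lambda>p. 1 / real (Suc (\<sigma> p))) \<longlonglongrightarrow> 0"
        using LIMSEQ_subseq_LIMSEQ[OF LIMSEQ_inverse_real_of_nat \<sigma>(1)]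
        by (simp add: o_def inverse_eq_divide)
      show "\<forall>\<^sub>F p in sequentially. norm (pt (\<sigma> p) (r (\<sigma> p)) i - z (\<sigma> p) i) \<le> 1 / real (Suc (\<sigma> p))"
        by (intro always_eventually allI d)
    qed
    from tendsto_add[OF this zi] show "(\<lambda>p. pt (\<sigma> p) (r (\<sigma> p)) i) \<longlonglongrightarrow> x i"
      by simp
  qed
  have lim: "(\<lambda>p. f (pt (\<sigma> p) (r (\<sigma> p))) i) \<longlonglongrightarrow> f x i"
    if r: "\<And>p j. j < n \<Longrightarrow> q p j \<le> r p j \<and> r p j \<le> q p j + 1" for r i
  proof -
    have in_cube: "pt p (r p) \<in> nat_cube n" for p
    proof (rule pt)
      show "r p i \<le> Suc p" if "i < n" for i
        using r[OF that, of p] q[OF that, of p] by linarith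
    qed
    have "(\<lambda>p. f (pt (\<sigma> p) (r (\<sigma> p)))) \<longlonglongrightarrow> f x"
      by (rule continuous_on_tendsto_compose[OF cont near[OF r] x]) (simp_all add: in_cube)
    then show ?thesis
      by (rule tendsto_funD)
  qed
  have "f x i = x i" if i: "i < n" for i
  proof -
    have "\<forall>p. \<exists>r. \<exists>s. (\<forall>j<n. q p j \<le> r j \<and> r j \<le> q p j + 1) \<and>
      (\<forall>j<n. q p j \<le> s j \<and> s j \<le> q p j + 1) \<and> l (pt p r) i = 0 \<and> l (pt p s) i = 1"
      using ex'[OF i] by blast
    from choice[OF this] obtain r where r': "\<forall>p. \<exists>s. (\<forall>j<n. q p j \<le> r p j \<and> r p j \<le> q p j + 1) \<and>
      (\<forall>j<n. q p j \<le> s j \<and> s j \<le> q p j + 1) \<and> l (pt p (r p)) i = 0 \<and> l (pt p s) i = 1"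
      by blast
    from choice[OF this] obtain s where r: "\<And>p j. j < n \<Longrightarrow> q p j \<le> r p j \<and> r p j \<le> q p j + 1"
      and s: "\<And>p j. j < n \<Longrightarrow> q p j \<le> s p j \<and> s p j \<le> q p j + 1"
      and lr: "\<And>p. l (pt p (r p)) i = 0" and ls: "\<And>p. l (pt p (s p)) i = 1"
      by blast
    have "pt p (r p) \<in> nat_cube n" "pt p (s p) \<in> nat_cube n" for p
    proof -
      show "pt p (r p) \<in> nat_cube n"
      proof (rule pt)
        show "r p i \<le> Suc p" if "i < n" for i
          using r[OF that, of p] q[OF that, of p] by linarith
      qed
      show "pt p (s p) \<in> nat_cube n"
      proof (rule pt)
        show "s p i \<le> Suc p" if "i < n" for i
          using s[OF that, of p] q[OF that, of p] by linarith
      qed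
    qed
    then have le: "pt p (r p) i \<le> f (pt p (r p)) i" "f (pt p (s p)) i \<le> pt p (s p) i" for p
      using l3[of "pt p (r p)"] l4[of "pt p (s p)"] i lr[of p] ls[of p] by simp_all
    have "x i \<le> f x i"
      by (rule LIMSEQ_le[OF tendsto_funD[OF near[OF r]] lim[OF r]]) (simp_all add: le)
    moreover have "f x i \<le> x i"
      by (rule LIMSEQ_le[OF lim[OF s] tendsto_funD[OF near[OF s]]]) (simp_all add: le)
    ultimately show ?thesis
      by simp
  qed
  moreover have "f x i = x i" if "i \<ge> n" for i
    using f[OF x] x that by (auto simp: nat_cube_def)
  ultimately have "f x = x"
    by (intro ext) (metis linorder_not_le)
  with x show ?thesis
    by blast
qed

text \<open>The Schauder projection onto the hull of a finite net moves points of D by at most e. It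
  is composed with F and read in the coordinates c of a cube, so that Brouwer's theorem applies even
  when the points of the net are affinely dependent.\<close>

lemma schauder_approx:
  fixes F :: "'a::real_normed_vector \<Rightarrow> 'a"
  assumes \<Omega>: "convex \<Omega>" and D: "compact D" "D \<subseteq> \<Omega>" and ne: "\<Omega> \<noteq> {}"
    and cont: "continuous_on \<Omega> F" and F: "F ` \<Omega> \<subseteq> D" and e: "0 < e"
  shows "\<exists>x\<in>\<Omega>. norm (F x - x) \<le> e"
proof -
  have "D \<subseteq> (\<Union>z\<in>D. ball z e)"
    using e by auto
  then obtain Z where Z: "Z \<subseteq> D" "finite Z" "D \<subseteq> (\<Union>z\<in>Z. ball z e)"
    using compactE_image[OF D(1), of D "\<lambda>z. ball z e"] by auto
  obtain n and z :: "nat \<Rightarrow> 'a" where zn: "Z = z ` {i. i < n}"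
    using finite_imp_nat_seg_image_inj_on[OF Z(2)] by auto
  have zD: "z j \<in> D" if "j < n" for j
    using Z(1) zn that by auto
  have "n \<noteq> 0"
    using F ne Z(3) zn by auto
  define psi where "psi j y = max 0 (e - norm (y - z j))" for j y
  have psi0: "0 \<le> psi j y" for j y
    by (simp add: psi_def)
  have pos: "0 < (\<Sum>j<n. psi j y)" if y: "y \<in> D" for y
  proof -
    obtain j where "j < n" "dist (z j) y < e"
      using subsetD[OF Z(3) y] zn by auto
    then show ?thesis
      by (intro sum_pos2[of _ j]) (auto simp: psi_def dist_norm norm_minus_commute)
  qed
  \<comment> \<open>Division by the maximum of 1 and the total mass, rather than by the mass itself,
    keeps \<open>w\<close> continuous on the whole cube and its sum at most 1; the missing mass goes
    to \<open>z 0\<close> in \<open>pt\<close>. At the fixed point the mass is 1 and this correction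
    vanishes.\<close>
  define w where "w c = (\<lambda>j::nat. c j / max 1 (\<Sum>i<n. c i))" for c :: "nat \<Rightarrow> real"
  define pt where "pt c = z 0 + (\<Sum>j<n. w c j *\<^sub>R (z j - z 0))" for c
  have pt_in: "pt c \<in> \<Omega>" if c: "c \<in> nat_cube n" for c
  proof -
    have c0: "0 \<le> c j" if "j < n" for j
      using c that by (simp add: nat_cube_def)
    have w0: "0 \<le> w c j" if "j < n" for j
      using c0[OF that] by (simp add: w_def)
    have sw: "(\<Sum>j<n. w c j) \<le> 1"
      by (simp add: w_def sum_divide_distrib[symmetric] divide_le_eq)
    let ?u = "\<lambda>j. w c j + (if j = 0 then 1 - (\<Sum>j<n. w c j) else 0)"
    have "pt c = (\<Sum>j<n. ?u j *\<^sub>R z j)"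
    proof -
      have "(\<Sum>j<n. (if j = 0 then 1 - (\<Sum>j<n. w c j) else 0) *\<^sub>R z j) =
          (\<Sum>j<n. if j = 0 then (1 - (\<Sum>j<n. w c j)) *\<^sub>R z 0 else 0)"
        by (intro sum.cong) auto
      also have "\<dots> = (1 - (\<Sum>j<n. w c j)) *\<^sub>R z 0"
        using \<open>n \<noteq> 0\<close> by simp
      finally show ?thesis
        by (simp add: pt_def scaleR_diff_right sum_subtractf scaleR_left.sum[symmetric]
            scaleR_add_left sum.distrib algebra_simps)
    qed
    also have "\<dots> \<in> \<Omega>"
    proof (rule convex_sum[OF _ \<Omega>])
      show "(\<Sum>j<n. ?u j) = 1"
        using \<open>n \<noteq> 0\<close> by (simp add: sum.distrib)
      show "0 \<le> ?u j" if "j \<in> {..<n}" for j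
        using w0 sw that by auto
      show "z j \<in> \<Omega>" if "j \<in> {..<n}" for j
        using zD D(2) that by auto
    qed simp
    finally show ?thesis .
  qed
  define G where "G c = (\<lambda>j. if j < n then psi j (F (pt c)) / (\<Sum>i<n. psi i (F (pt c))) else 0)" for c
  have FD: "F (pt c) \<in> D" if "c \<in> nat_cube n" for c
    using pt_in[OF that] F by auto
  have Gc: "G c \<in> nat_cube n" if "c \<in> nat_cube n" for c
    using pos[OF FD[OF that]] psi0 member_le_sum[of _ "{..<n}" "\<lambda>i. psi i (F (pt c))"]
    by (auto simp: nat_cube_def G_def divide_le_eq)
  have cc: "continuous_on (nat_cube n) (\<lambda>c. c i)" for i
    by (rule continuous_on_product_coordinates[THEN continuous_on_subset]) simp
  have cpt: "continuous_on (nat_cube n) pt"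
    unfolding pt_def w_def by (intro continuous_intros cc) auto
  have cFpt: "continuous_on (nat_cube n) (\<lambda>c. F (pt c))"
    by (rule continuous_on_compose2[OF cont cpt]) (use pt_in in auto)
  have "continuous_on (nat_cube n) G"
  proof (rule continuous_on_coordinatewise_then_product)
    show "continuous_on (nat_cube n) (\<lambda>c. G c j)" for j
    proof (cases "j < n")
      case True
      then show ?thesis
        unfolding G_def psi_def using pos[OF FD]
        by (auto intro!: continuous_intros cFpt simp: psi_def) (metis less_irrefl)
    qed (simp add: G_def)
  qed
  from brouwer_nat_cube[OF this Gc] obtain c where c: "c \<in> nat_cube n" "G c = c"
    by blast
  let ?y = "F (pt c)"
  have p: "0 < (\<Sum>i<n. psi i ?y)"
    using pos FD c(1) by blast
  have cj: "c j = psi j ?y / (\<Sum>i<n. psi i ?y)" if "j < n" for j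
    using c(2) that by (metis G_def)
  have sc: "(\<Sum>j<n. c j) = 1"
    using p by (simp add: cj sum_divide_distrib[symmetric])
  have "?y - pt c = (\<Sum>j<n. c j *\<^sub>R (?y - z j))"
    using sc by (simp add: pt_def w_def scaleR_diff_right sum_subtractf scaleR_left.sum[symmetric])
  also have "norm \<dots> \<le> (\<Sum>j<n. c j * e)"
  proof (rule sum_norm_le)
    fix j assume j: "j \<in> {..<n}"
    then have c0: "0 \<le> c j"
      using c(1) by (simp add: nat_cube_def)
    show "norm (c j *\<^sub>R (?y - z j)) \<le> c j * e"
    proof (cases "norm (?y - z j) \<le> e")
      case True
      then show ?thesis
        using c0 by (simp add: mult_left_mono)
    next
      case False
      then have "c j = 0"
        using cj j by (simp add: psi_def)
      then show ?thesis by simp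
    qed
  qed
  also have "\<dots> = e"
    by (simp add: sum_distrib_right[symmetric] sc)
  finally show ?thesis
    using pt_in[OF c(1)] by blast
qed

text \<open>Approximate fixed points suffice: their images lie in the compact set D, and a limit of
  a subsequence of the images is also a limit of the points themselves.\<close>

theorem schauder:
  fixes F :: "'a::real_normed_vector \<Rightarrow> 'a"
  assumes \<Omega>: "convex \<Omega>" and D: "compact D" "D \<subseteq> \<Omega>" and ne: "\<Omega> \<noteq> {}"
    and cont: "continuous_on \<Omega> F" and F: "F ` \<Omega> \<subseteq> D"
  shows "\<exists>x\<in>D. F x = x"
proof -
  have "\<exists>x\<in>\<Omega>. norm (F x - x) \<le> inverse (real (Suc m))" for m
    by (rule schauder_approx[OF assms]) simp
  then obtain x where x: "\<And>m. x m \<in> \<Omega>" "\<And>m. norm (F (x m) - x m) \<le> inverse (real (Suc m))"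
    by metis
  have "F (x m) \<in> D" for m
    using x(1) F by auto
  then obtain y \<sigma> where y: "y \<in> D" "strict_mono \<sigma>" "(\<lambda>m. F (x (\<sigma> m))) \<longlonglongrightarrow> y"
    using D(1)[unfolded compact_eq_seq_compact_metric seq_compact_def, rule_format, of "\<lambda>m. F (x m)"] by (auto simp: o_def)
  have "(\<lambda>m. F (x (\<sigma> m)) - x (\<sigma> m)) \<longlonglongrightarrow> 0"
  proof (rule Lim_null_comparison)
    show "\<forall>\<^sub>F m in sequentially. norm (F (x (\<sigma> m)) - x (\<sigma> m)) \<le> inverse (real (Suc (\<sigma> m)))"
      using x(2) by (intro always_eventually allI)
    show "(\<lambda>m. inverse (real (Suc (\<sigma> m)))) \<longlonglongrightarrow> 0"
      using LIMSEQ_subseq_LIMSEQ[OF LIMSEQ_inverse_real_of_nat y(2)] by (simp add: o_def)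
  qed
  from tendsto_diff[OF y(3) this] have xl: "(\<lambda>m. x (\<sigma> m)) \<longlonglongrightarrow> y"
    by simp
  have "(\<lambda>m. F (x (\<sigma> m))) \<longlonglongrightarrow> F y"
    by (rule continuous_on_tendsto_compose[OF cont xl]) (use y(1) D(2) x(1) in auto)
  then show ?thesis
    using LIMSEQ_unique[OF y(3)] y(1) by metis
qed

section \<open>Module projections\<close>

text \<open>The Baire half of the open mapping theorem for the sum map from V and W. The bound is
  kept on the V-part, since the projection to be built takes its values in V.\<close>

lemma approximate_decomposition:
  fixes V W :: "'h::complex_hilbert_space set"
  assumes V: "csubspace V" and W: "csubspace W" and sum: "\<And>x. \<exists>v\<in>V. \<exists>w\<in>W. x = v + w"
  shows "\<exists>C\<ge>0. \<forall>x. \<exists>v\<in>V. \<exists>w\<in>W. norm v \<le> C * norm x \<and> norm (x - (v + w)) \<le> norm x / 2"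
proof -
  define X where "X n = {v + w | v w. v \<in> V \<and> w \<in> W \<and> norm v \<le> real n}" for n
  have "\<exists>n. interior (closure (X n)) \<noteq> {}"
  proof (rule ccontr)
    assume "\<nexists>n. interior (closure (X n)) \<noteq> {}"
    then have "euclidean interior_of \<Union>(range (\<lambda>n. closure (X n))) = {}"
      by (intro Baire_category_alt) (auto simp: completely_metrizable_space_euclidean)
    moreover have "\<Union>(range (\<lambda>n. closure (X n))) = UNIV"
    proof (intro UNIV_eq_I[symmetric])
      fix x
      obtain v w where "v \<in> V" "w \<in> W" "x = v + w"
        using sum by blast
      moreover obtain n where "norm v \<le> real n"
        using real_arch_simple by blast
      ultimately have "x \<in> X n"
        by (auto simp: X_def)
      then show "x \<in> \<Union>(range (\<lambda>n. closure (X n)))"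
        using closure_subset by blast
    qed
    ultimately show False by simp
  qed
  then obtain n z e where e: "0 < e" "ball z e \<subseteq> closure (X n)"
    by (metis equals0I mem_interior)
  \<comment> \<open>Half differences of elements of the closure stay in it, which recentres the ball
    at 0.\<close>
  have half: "(1/2) *\<^sub>R (a - b) \<in> closure (X n)" if "a \<in> closure (X n)" "b \<in> closure (X n)" for a b
  proof -
    obtain f g where fg: "\<And>k::nat. f k \<in> X n" "f \<longlonglongrightarrow> a" "\<And>k::nat. g k \<in> X n" "g \<longlonglongrightarrow> b"
      using \<open>a \<in> closure (X n)\<close> \<open>b \<in> closure (X n)\<close> unfolding closure_sequential by blast
    have "(1/2) *\<^sub>R (f k - g k) \<in> X n" for k
    proof -
      obtain v w v' w' where *: "v \<in> V" "w \<in> W" "v' \<in> V" "w' \<in> W" "norm v \<le> real n" "norm v' \<le> real n"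
        "f k = v + w" "g k = v' + w'"
        using fg(1)[of k] fg(3)[of k] unfolding X_def by blast
      have "norm ((1/2) *\<^sub>R (v - v')) \<le> real n"
        using norm_triangle_ineq4[of v v'] *(5,6) by simp
      moreover have "(1/2) *\<^sub>R (f k - g k) = (1/2) *\<^sub>R (v - v') + (1/2) *\<^sub>R (w - w')"
        by (simp add: * algebra_simps)
      moreover have "(1/2) *\<^sub>R (v - v') \<in> V" "(1/2) *\<^sub>R (w - w') \<in> W"
        using * V W by (auto intro!: csubspace_scaleR csubspace_diff)
      ultimately show ?thesis
        unfolding X_def by blast
    qed
    then show ?thesis
      unfolding closure_sequential
      by (intro exI[of _ "\<lambda>k. (1/2) *\<^sub>R (f k - g k)"]) (auto intro!: tendsto_intros fg)
  qed
  have ball0: "y \<in> closure (X n)" if "norm y < e" for y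
  proof -
    have "z + y \<in> ball z e" "z - y \<in> ball z e"
      using that by (auto simp: dist_norm)
    then have "(1/2) *\<^sub>R ((z + y) - (z - y)) \<in> closure (X n)"
      using e(2) half by blast
    also have "(1/2) *\<^sub>R ((z + y) - (z - y)) = y"
      by (simp add: algebra_simps scaleR_2[symmetric])
    finally show ?thesis .
  qed
  have "\<exists>v\<in>V. \<exists>w\<in>W. norm v \<le> (2 * real n / e) * norm x \<and> norm (x - (v + w)) \<le> norm x / 2" for x
  proof (cases "x = 0")
    case True
    then show ?thesis
      using V W by (intro bexI[of _ 0]) (auto simp: complex_vector.subspace_0)
  next
    case False
    \<comment> \<open>Division by s brings x to norm e / 2, inside the ball, and an approximation up
      to e / 4 scales back to an error of half the norm of x.\<close>
    define s where "s = 2 * norm x / e"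
    have s: "0 < s"
      using False e by (simp add: s_def)
    have "norm ((1/s) *\<^sub>R x) < e"
      using s e False by (simp add: s_def)
    then obtain y where y: "y \<in> X n" "dist y ((1/s) *\<^sub>R x) < e / 4"
      using ball0 e(1) closure_approachable by (metis divide_pos_pos zero_less_numeral)
    then obtain v w where vw: "v \<in> V" "w \<in> W" "norm v \<le> real n" "y = v + w"
      unfolding X_def by blast
    have "norm (s *\<^sub>R v) \<le> (2 * real n / e) * norm x"
      using mult_left_mono[OF vw(3), of s] s e(1) by (simp add: s_def mult_ac)
    moreover have "norm (x - (s *\<^sub>R v + s *\<^sub>R w)) \<le> norm x / 2"
    proof -
      have "x - (s *\<^sub>R v + s *\<^sub>R w) = s *\<^sub>R ((1/s) *\<^sub>R x - y)"
        using s by (simp add: vw(4) algebra_simps)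
      then have "norm (x - (s *\<^sub>R v + s *\<^sub>R w)) = s * dist y ((1/s) *\<^sub>R x)"
        using s by (simp add: dist_norm norm_minus_commute)
      also have "\<dots> \<le> s * (e / 4)"
        using y(2) s by (intro mult_left_mono) auto
      also have "\<dots> = norm x / 2"
        using e by (simp add: s_def)
      finally show ?thesis .
    qed
    ultimately show ?thesis
      using vw V W by (meson csubspace_scaleR)
  qed
  then show ?thesis
    using e(1) by (intro exI[of _ "2 * real n / e"]) auto
qed

text \<open>Successive approximation: the remainders halve, so the V-parts are dominated by a
  geometric series. The partial sums of the W-parts converge as differences of convergent sequences,
  and closedness puts both limits in the right subspaces.\<close>

theorem complement_projection:
  fixes V W :: "'h::complex_hilbert_space set"
  assumes V: "csubspace V" "closed V" and W: "csubspace W" "closed W"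
    and int: "V \<inter> W = {0}" and sum: "\<And>x. \<exists>v\<in>V. \<exists>w\<in>W. x = v + w"
  shows "\<exists>P\<in>bounded_operators. (\<forall>x. blinfun_apply P x \<in> V \<and> x - blinfun_apply P x \<in> W)"
proof -
  obtain C where C: "C \<ge> 0" "\<And>x. \<exists>v\<in>V. \<exists>w\<in>W. norm v \<le> C * norm x \<and> norm (x - (v + w)) \<le> norm x / 2"
    using approximate_decomposition[OF V(1) W(1) sum] by blast
  then obtain g h where gh: "\<And>x. g x \<in> V" "\<And>x. h x \<in> W" "\<And>x. norm (g x) \<le> C * norm x"
    "\<And>x. norm (x - (g x + h x)) \<le> norm x / 2"
    by metis
  define r where "r x = x - (g x + h x)" for x
  have rn: "norm ((r ^^ k) x) \<le> norm x * (1/2) ^ k" for k x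
  proof (induction k)
    case (Suc k)
    have "norm (r ((r ^^ k) x)) \<le> norm ((r ^^ k) x) / 2"
      using gh(4) by (simp add: r_def)
    with Suc show ?case by simp
  qed simp
  have unique: "v = v'" if "v \<in> V" "w \<in> W" "v' \<in> V" "w' \<in> W" "v + w = v' + w'" for v w v' w'
  proof -
    have "v - v' = w' - w"
      using that(5) by (metis add_diff_cancel_left' add_diff_eq diff_add_eq diff_diff_eq2)
    then have "v - v' \<in> V \<inter> W"
      using that V(1) W(1) csubspace_diff by (metis IntI)
    then show ?thesis
      using int by auto
  qed
  have "\<exists>v\<in>V. \<exists>w\<in>W. x = v + w \<and> norm v \<le> (2 * C) * norm x" for x
  proof -
    let ?a = "\<lambda>k. g ((r ^^ k) x)"
    have na: "norm (?a k) \<le> (C * norm x) * (1/2) ^ k" for k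
      using order_trans[OF gh(3)[of "(r ^^ k) x"] mult_left_mono[OF rn[of k x] C(1)]] by (simp add: mult.assoc)
    have gs: "(\<lambda>k. (C * norm x) * (1/2) ^ k) sums ((C * norm x) * 2)"
      using sums_mult[OF geometric_sums[of "1/2::real"], of "C * norm x"] by simp
    have sn: "summable (\<lambda>k. norm (?a k))"
      using na by (intro summable_comparison_test'[OF sums_summable[OF gs]]) auto
    then have s: "summable ?a"
      by (rule summable_norm_cancel)
    define v where "v = suminf ?a"
    have lim: "(\<lambda>n. \<Sum>k<n. ?a k) \<longlonglongrightarrow> v"
      unfolding v_def using summable_LIMSEQ[OF s] .
    have vV: "v \<in> V"
      using closed_sequentially[OF V(2) _ lim] gh(1) V(1) by (simp add: complex_vector.subspace_sum)
    have "norm v \<le> (\<Sum>k. norm (?a k))"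
      unfolding v_def by (rule summable_norm[OF sn])
    also have "\<dots> \<le> (C * norm x) * 2"
      using suminf_le[OF na sn sums_summable[OF gs]] sums_unique[OF gs] by simp
    finally have nv: "norm v \<le> (2 * C) * norm x"
      by (simp add: mult_ac)
    have part: "(\<Sum>k<n. ?a k) + (\<Sum>k<n. h ((r ^^ k) x)) = x - (r ^^ n) x" for n
      by (induction n) (simp_all add: r_def algebra_simps)
    have "(\<lambda>n. (r ^^ n) x) \<longlonglongrightarrow> 0"
    proof (rule Lim_null_comparison)
      show "\<forall>\<^sub>F n in sequentially. norm ((r ^^ n) x) \<le> norm x * (1/2) ^ n"
        using rn by (intro always_eventually allI)
      show "(\<lambda>n. norm x * (1/2) ^ n) \<longlonglongrightarrow> 0"
        using tendsto_mult_right_zero[OF LIMSEQ_power_zero[of "1/2::real"], of "norm x"] by simp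
    qed
    then have "(\<lambda>n. x - (r ^^ n) x - (\<Sum>k<n. ?a k)) \<longlonglongrightarrow> x - 0 - v"
      by (intro tendsto_intros lim)
    moreover have "x - (r ^^ n) x - (\<Sum>k<n. ?a k) = (\<Sum>k<n. h ((r ^^ k) x))" for n
      using part[of n] by (simp add: algebra_simps)
    ultimately have "(\<lambda>n. \<Sum>k<n. h ((r ^^ k) x)) \<longlonglongrightarrow> x - v"
      by simp
    then have "x - v \<in> W"
      using closed_sequentially[OF W(2)] gh(2) W(1) complex_vector.subspace_sum
      by (metis (no_types, lifting))
    with vV nv show ?thesis
      by (intro bexI[of _ v] bexI[of _ "x - v"]) auto
  qed
  then have "\<exists>v. v \<in> V \<and> x - v \<in> W \<and> norm v \<le> (2 * C) * norm x" for x
    by (metis add_diff_cancel_left')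
  then obtain p where p: "\<And>x. p x \<in> V" "\<And>x. x - p x \<in> W" "\<And>x. norm (p x) \<le> (2 * C) * norm x"
    by metis
  have padd: "p (x + y) = p x + p y" for x y
  proof (rule unique[OF p(1) p(2)[of "x + y"]])
    show "p x + p y \<in> V"
      by (intro complex_vector.subspace_add V p)
    show "(x - p x) + (y - p y) \<in> W"
      by (intro complex_vector.subspace_add W p)
  qed simp
  have pscale: "p (c *\<^sub>C x) = c *\<^sub>C p x" for c x
  proof (rule unique[OF p(1) p(2)[of "c *\<^sub>C x"]])
    show "c *\<^sub>C p x \<in> V"
      by (intro complex_vector.subspace_scale V p)
    show "c *\<^sub>C (x - p x) \<in> W"
      by (intro complex_vector.subspace_scale W p)
  qed (simp add: scaleC.diff_right)
  obtain P where P: "P \<in> bounded_operators" "\<And>x. blinfun_apply P x = p x"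
    using ex_operator[OF padd pscale p(3)] by blast
  with p show ?thesis
    by (intro bexI[of _ P]) simp_all
qed

text \<open>The complement is a parameter because it is obtained in two ways: directly from the
  reduction property of the whole space, and by extending a complement found inside a closed
  subspace.\<close>

lemma submodule_complement_projection:
  fixes B :: "('h::complex_hilbert_space \<Rightarrow>\<^sub>L 'h) set"
  assumes V: "submodule B UNIV V" and W: "submodule B UNIV W" "V \<inter> W = {0}" "\<And>x. \<exists>v\<in>V. \<exists>w\<in>W. x = v + w"
  shows "\<exists>P\<in>bounded_operators. (\<forall>x. blinfun_apply P x \<in> V) \<and> (\<forall>x\<in>V. blinfun_apply P x = x) \<and>
    (\<forall>T\<in>B. \<forall>x. blinfun_apply T (blinfun_apply P x) = blinfun_apply P (blinfun_apply T x))"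
proof -
  have sub: "csubspace V" "closed V" "csubspace W" "closed W"
    using V W(1) by (simp_all add: submodule_def)
  obtain P where P: "P \<in> bounded_operators" "\<And>x. blinfun_apply P x \<in> V" "\<And>x. x - blinfun_apply P x \<in> W"
    using complement_projection[OF sub W(2,3)] by blast
  have unique: "blinfun_apply P x = v" if "v \<in> V" "x - v \<in> W" for x v
  proof -
    have "P x - v \<in> V"
      by (intro csubspace_diff sub P that)
    moreover have "(x - v) - (x - P x) \<in> W"
      by (intro csubspace_diff sub P that)
    ultimately have "P x - v \<in> V \<inter> W"
      by simp
    then show ?thesis
      unfolding W(2) by simp
  qed
  have "P x = x" if "x \<in> V" for x
    by (rule unique) (use that sub in \<open>auto simp: complex_vector.subspace_0\<close>)
  moreover have "T (P x) = P (T x)" if "T \<in> B" for T x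
  proof (rule unique[symmetric])
    show "T (P x) \<in> V"
      using V that P(2) by (auto simp: submodule_def)
    have "T (x - P x) \<in> W"
      using W(1) that P(3) unfolding submodule_def by blast
    then show "T x - T (P x) \<in> W"
      by (simp add: blinfun.diff_right)
  qed
  ultimately show ?thesis
    using P by blast
qed

lemma module_projection:
  fixes B :: "('h::complex_hilbert_space \<Rightarrow>\<^sub>L 'h) set"
  assumes red: "reduction_property B UNIV" and V: "submodule B UNIV V"
  shows "\<exists>P\<in>bounded_operators. (\<forall>x. blinfun_apply P x \<in> V) \<and> (\<forall>x\<in>V. blinfun_apply P x = x) \<and>
    (\<forall>T\<in>B. \<forall>x. blinfun_apply T (blinfun_apply P x) = blinfun_apply P (blinfun_apply T x))"
proof -
  from red V have "\<exists>W. submodule B UNIV W \<and> V \<inter> W = {0} \<and> UNIV = {v + w | v w. v \<in> V \<and> w \<in> W}"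
    unfolding reduction_property_def by simp
  then obtain W where W: "submodule B UNIV W" "V \<inter> W = {0}" "UNIV = {v + w | v w. v \<in> V \<and> w \<in> W}"
    by auto
  have "\<exists>v\<in>V. \<exists>w\<in>W. x = v + w" for x
  proof -
    have "x \<in> {v + w | v w. v \<in> V \<and> w \<in> W}"
      using W(3) by simp
    then show ?thesis by blast
  qed
  then show ?thesis
    by (rule submodule_complement_projection[OF V W(1,2)])
qed

subsection \<open>Entries of operators on amplifications\<close>

lemma ell2_eqI: "(\<And>i. ell2_nth f i = ell2_nth g i) \<Longrightarrow> f = g"
  by (simp add: ell2_nth_inject[symmetric] fun_eq_iff)

lemmas ell2_nth_simps [simp] = zero_ell2.rep_eq plus_ell2.rep_eq minus_ell2.rep_eq scaleR_ell2.rep_eq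
  scaleC_ell2.rep_eq ell2_map.rep_eq amplification.rep_eq

lemma bounded_linear_ell2_nth: "bounded_linear (\<lambda>f :: ('i, 'a::complex_hilbert_space) ell2. ell2_nth f i)"
  by (rule bounded_linear_intro[of _ 1]) (simp_all add: norm_nth_le_ell2)

lemmas continuous_on_ell2_nth [continuous_intros] =
  bounded_linear.continuous_on[OF bounded_linear_ell2_nth]

lift_definition ell2_single :: "'i \<Rightarrow> 'a \<Rightarrow> ('i, 'a::complex_hilbert_space) ell2"
  is "\<lambda>i x j. if j = i then x else 0"
proof (rule square_summable_bound)
  fix i x and F :: "'i set"
  assume "finite F"
  then have "(\<Sum>j\<in>F. (norm (if j = i then x else (0::'a)))\<^sup>2) = (\<Sum>j\<in>F. if j = i then (norm x)\<^sup>2 else 0)"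
    by (intro sum.cong) auto
  also have "\<dots> \<le> (norm x)\<^sup>2"
    using \<open>finite F\<close> by simp
  finally show "(\<Sum>j\<in>F. (norm (if j = i then x else 0))\<^sup>2) \<le> (norm x)\<^sup>2" .
qed

lemmas ell2_nth_single [simp] = ell2_single.rep_eq

lemma norm_ell2_single_le: "norm (ell2_single i x) \<le> norm x"
proof (rule norm_ell2_leI)
  fix F :: "'a set"
  assume "finite F"
  have "(\<Sum>j\<in>F. (norm (ell2_nth (ell2_single i x) j))\<^sup>2) = (\<Sum>j\<in>F. if j = i then (norm x)\<^sup>2 else 0)"
    by (intro sum.cong) auto
  also have "\<dots> \<le> (norm x)\<^sup>2"
    using \<open>finite F\<close> by simp
  finally show "L2_set (\<lambda>j. norm (ell2_nth (ell2_single i x) j)) F \<le> norm x"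
    unfolding L2_set_def by (simp add: real_le_lsqrt sum_nonneg)
qed

lemma bounded_linear_ell2_single: "bounded_linear (ell2_single i)"
  by (rule bounded_linear_intro[of _ 1]) (auto intro!: ell2_eqI simp: norm_ell2_single_le)

lemma ell2_single_scaleC: "ell2_single i (c *\<^sub>C x) = c *\<^sub>C ell2_single i x"
  by (rule ell2_eqI) simp

definition entry :: "(('i, 'a) ell2 \<Rightarrow>\<^sub>L ('i, 'a::complex_hilbert_space) ell2) \<Rightarrow> 'i \<Rightarrow> 'i \<Rightarrow> 'a \<Rightarrow>\<^sub>L 'a"
  where "entry P i j = Blinfun (\<lambda>x. ell2_nth (blinfun_apply P (ell2_single j x)) i)"

lemma entry_apply [simp]: "blinfun_apply (entry P i j) x = ell2_nth (blinfun_apply P (ell2_single j x)) i"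
  unfolding entry_def
  by (subst bounded_linear_Blinfun_apply)
    (intro bounded_linear_compose[OF bounded_linear_ell2_nth]
      bounded_linear_compose[OF blinfun.bounded_linear_right] bounded_linear_ell2_single, simp)

lemma norm_entry_apply_le: "norm (blinfun_apply (entry P i j) x) \<le> norm P * norm x"
  by (simp, rule order_trans[OF norm_nth_le_ell2 order_trans[OF norm_blinfun]])
    (simp add: mult_left_mono norm_ell2_single_le)

lemma entry_bounded_operators: "P \<in> bounded_operators \<Longrightarrow> entry P i j \<in> bounded_operators"
  by (simp add: bounded_operators_def ell2_single_scaleC)

lemma amplification_single: "blinfun_apply (amplification T) (ell2_single j x) = ell2_single j (blinfun_apply T x)"
  by (rule ell2_eqI) simp

section \<open>Commutants\<close>

lemma commutantI:
  assumes "T \<in> bounded_operators" "\<And>S x. S \<in> D \<Longrightarrow> blinfun_apply T (blinfun_apply S x) = blinfun_apply S (blinfun_apply T x)"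
  shows "T \<in> commutant D"
  using assms by (auto simp: commutant_def intro!: blinfun_eqI)

lemma commutantD:
  assumes "T \<in> commutant D"
  shows "T \<in> bounded_operators" "S \<in> D \<Longrightarrow> blinfun_apply T (blinfun_apply S x) = blinfun_apply S (blinfun_apply T x)"
  using assms unfolding commutant_def by (auto simp: blinfun_compose.rep_eq dest!: arg_cong[of _ _ "\<lambda>T. blinfun_apply T x"])

lemma commutant_simps [simp, intro]:
  "0 \<in> commutant D" "id_blinfun \<in> commutant D"
  "S \<in> commutant D \<Longrightarrow> T \<in> commutant D \<Longrightarrow> S + T \<in> commutant D"
  "S \<in> commutant D \<Longrightarrow> T \<in> commutant D \<Longrightarrow> S - T \<in> commutant D"
  "S \<in> commutant D \<Longrightarrow> T \<in> commutant D \<Longrightarrow> S o\<^sub>L T \<in> commutant D"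
  "D \<subseteq> bounded_operators \<Longrightarrow> T \<in> commutant D \<Longrightarrow> scaleC_op c T \<in> commutant D"
  "T \<in> commutant D \<Longrightarrow> r *\<^sub>R T \<in> commutant D"
  by (auto intro!: commutantI simp: commutantD(1) blinfun.bilinear_simps,
      auto simp: commutantD(2) bounded_operatorsD subset_iff)

lemma commutant_antimono: "D \<subseteq> E \<Longrightarrow> commutant E \<subseteq> commutant D"
  by (auto simp: commutant_def)

lemma subset_commutant_commutant: "D \<subseteq> bounded_operators \<Longrightarrow> D \<subseteq> commutant (commutant D)"
  by (auto simp: commutant_def)

text \<open>The source of elements of the commutant: an amplification is diagonal with equal
  entries, so commuting with it is a condition on each matrix entry separately.\<close>

lemma entry_commutant:
  assumes "P \<in> bounded_operators" "\<And>T x. T \<in> A \<Longrightarrow>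
    blinfun_apply (amplification T) (blinfun_apply P x) = blinfun_apply P (blinfun_apply (amplification T) x)"
  shows "entry P i j \<in> commutant A"
proof (rule commutantI)
  fix T x assume T: "T \<in> A"
  show "entry P i j (T x) = T (entry P i j x)"
    using assms(2)[OF T, of "ell2_single j x"] by (simp add: amplification_single[symmetric])
      (metis amplification.rep_eq ell2_map.rep_eq)
qed (rule entry_bounded_operators[OF assms(1)])

section \<open>Consequences of complete reduction for the commutant\<close>

locale crp_algebra =
  fixes A :: "('a::complex_hilbert_space \<Rightarrow>\<^sub>L 'a) set"
  assumes A: "A \<subseteq> bounded_operators" and abel: "abelian A" and crp: "complete_reduction_property A"
begin

lemma crp_projection:
  fixes V :: "(nat, 'a) ell2 set"
  assumes "csubspace V" "closed V" and inv: "\<And>T \<xi>. T \<in> A \<Longrightarrow> \<xi> \<in> V \<Longrightarrow> ell2_map T \<xi> \<in> V"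
  shows "\<exists>P\<in>bounded_operators. (\<forall>\<xi>. blinfun_apply P \<xi> \<in> V) \<and> (\<forall>\<xi>\<in>V. blinfun_apply P \<xi> = \<xi>) \<and>
    (\<forall>i j. entry P i j \<in> commutant A) \<and>
    (\<forall>T\<in>A. \<forall>\<xi>. ell2_map T (blinfun_apply P \<xi>) = blinfun_apply P (ell2_map T \<xi>))"
proof -
  have "submodule (amplification ` A) UNIV V"
    using assms by (auto simp: submodule_def amplification.rep_eq)
  from module_projection[OF crp[unfolded complete_reduction_property_def] this]
  obtain P where P: "P \<in> bounded_operators" "\<And>\<xi>. blinfun_apply P \<xi> \<in> V" "\<And>\<xi>. \<xi> \<in> V \<Longrightarrow> blinfun_apply P \<xi> = \<xi>"
    "\<And>T \<xi>. T \<in> A \<Longrightarrow> amplification T (P \<xi>) = P (amplification T \<xi>)"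
    by auto
  with entry_commutant[OF P(1) P(4)] show ?thesis
    by (intro bexI[of _ P]) (simp_all add: amplification.rep_eq)
qed

text \<open>The graphs of the multiples of \<open>\<tau>\<close> are submodules. A single bounded module projection onto
  their sum forces \<open>\<tau>\<close> to vanish if \<open>\<tau> X \<tau> = 0\<close> for all module maps \<open>X\<close>.\<close>

lemma semiprime:
  assumes tau: "\<tau> \<in> commutant A"
    and z: "\<And>X x. X \<in> commutant A \<Longrightarrow> blinfun_apply \<tau> (blinfun_apply X (blinfun_apply \<tau> x)) = 0"
  shows "blinfun_apply \<tau> x = 0"
proof -
  \<comment> \<open>Coordinates 2n and 2n + 1 hold an argument and its value under n times
    \<open>\<tau>\<close>; the factors grow while the projection onto V stays one bounded
    operator.\<close>
  define V where "V = {\<xi> :: (nat, 'a) ell2. \<forall>n. ell2_nth \<xi> (2 * n + 1) = real n *\<^sub>R blinfun_apply \<tau> (ell2_nth \<xi> (2 * n))}"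
  have "csubspace V"
    by (rule complex_vector.subspaceI)
      (use bounded_operatorsD[OF commutantD(1)[OF tau]] in
        \<open>auto simp: V_def blinfun.bilinear_simps scaleR_right_distrib scaleC.scaleR_right\<close>)
  moreover have "closed V"
  proof -
    have "V = (\<Inter>n. {\<xi>. ell2_nth \<xi> (2 * n + 1) = real n *\<^sub>R blinfun_apply \<tau> (ell2_nth \<xi> (2 * n))})"
      by (auto simp: V_def)
    also have "closed \<dots>"
      by (intro closed_INT ballI closed_Collect_eq continuous_intros)
    finally show ?thesis .
  qed
  moreover have "ell2_map T \<xi> \<in> V" if "T \<in> A" "\<xi> \<in> V" for T \<xi>
    using that commutantD(2)[OF tau] by (auto simp: V_def blinfun.bilinear_simps)
  ultimately obtain P where P: "\<And>\<xi>. blinfun_apply P \<xi> \<in> V" "\<And>\<xi>. \<xi> \<in> V \<Longrightarrow> blinfun_apply P \<xi> = \<xi>"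
    "\<And>i j. entry P i j \<in> commutant A"
    using crp_projection[of V] by blast
  have "real n * norm (\<tau> x) \<le> norm P * norm x" for n
  proof -
    define \<alpha> where "\<alpha> = entry P (2 * n) (2 * n)"
    define \<beta> where "\<beta> = entry P (2 * n) (2 * n + 1)"
    let ?\<xi> = "ell2_single (2 * n) x + ell2_single (2 * n + 1) (real n *\<^sub>R \<tau> x)"
    have "?\<xi> \<in> V"
    proof -
      have "2 * m + 1 = 2 * n + 1 \<longleftrightarrow> m = n" "2 * m + 1 \<noteq> 2 * n" "2 * m \<noteq> 2 * n + 1" for m
        by presburger+
      then show ?thesis
        by (auto simp: V_def blinfun.bilinear_simps)
    qed
    then have "ell2_nth (P ?\<xi>) (2 * n) = ell2_nth ?\<xi> (2 * n)"
      using P(2) by simp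
    then have 1: "\<alpha> x + \<beta> (real n *\<^sub>R \<tau> x) = x"
      by (simp add: blinfun.add_right \<alpha>_def \<beta>_def)
    \<comment> \<open>Applying \<open>\<tau>\<close> to the first coordinate removes the term with
      \<open>\<beta>\<close>, by \<open>z\<close>. The vector n \<open>\<tau>\<close>
      \<open>\<alpha>\<close> x is the second coordinate of a vector of V, hence given by an entry
      of P, so its norm is bounded independently of n.\<close>
    have "\<tau> x = \<tau> (\<alpha> x) + real n *\<^sub>R \<tau> (\<beta> (\<tau> x))"
      using arg_cong[OF 1, of \<tau>] by (simp add: blinfun.add_right blinfun.scaleR_right)
    also have "\<tau> (\<beta> (\<tau> x)) = 0"
      by (rule z) (simp only: \<beta>_def P(3))
    finally have "real n *\<^sub>R \<tau> x = real n *\<^sub>R \<tau> (\<alpha> x)"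
      by simp
    also have "\<dots> = entry P (2 * n + 1) (2 * n) x"
      using P(1)[of "ell2_single (2 * n) x"] by (simp add: V_def \<alpha>_def)
    finally show ?thesis
      using norm_entry_apply_le[of P "2 * n + 1" "2 * n" x] by (metis norm_scaleR abs_of_nat)
  qed
  then have "norm (\<tau> x) = 0"
    by (intro real_archimedian_rdiv_eq_0[of _ "norm P * norm x"]) auto
  then show ?thesis by simp
qed

definition Z where "Z = {q \<in> commutant A \<inter> commutant (commutant A). q o\<^sub>L q = q}"

lemma A_subset_commutant: "A \<subseteq> commutant A"
  using A abel by (auto simp: commutant_def abelian_def)

text \<open>A diagonal entry q of a projection onto the sequences in U is an idempotent module map
  onto U. Invariance of U gives q T q = T q for T in the commutant. The other corner q T (1 - q)
  gives 0 when multiplied by itself with any module map in between, so it vanishes by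
  \<open>semiprime\<close>, and q is central.\<close>

lemma hyperinvariant_central_idempotent:
  assumes U: "csubspace U" "closed U" and inv: "\<And>T x. T \<in> commutant A \<Longrightarrow> x \<in> U \<Longrightarrow> blinfun_apply T x \<in> U"
  shows "\<exists>q\<in>Z. U = range (blinfun_apply q)"
proof -
  define V where "V = {\<xi> :: (nat, 'a) ell2. \<forall>n. ell2_nth \<xi> n \<in> U}"
  have "csubspace V"
    by (rule complex_vector.subspaceI)
      (use U(1) in \<open>auto simp: V_def complex_vector.subspace_0 complex_vector.subspace_add complex_vector.subspace_scale\<close>)
  moreover have "closed V"
  proof -
    have "V = (\<Inter>n. (\<lambda>\<xi>. ell2_nth \<xi> n) -` U)"
      by (auto simp: V_def)
    also have "closed \<dots>"
      by (intro closed_INT ballI closed_vimage U continuous_intros)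
    finally show ?thesis .
  qed
  moreover have "ell2_map T \<xi> \<in> V" if "T \<in> A" "\<xi> \<in> V" for T \<xi>
    using that inv A_subset_commutant by (auto simp: V_def)
  ultimately obtain P where P: "\<And>\<xi>. blinfun_apply P \<xi> \<in> V" "\<And>\<xi>. \<xi> \<in> V \<Longrightarrow> blinfun_apply P \<xi> = \<xi>"
    "\<And>i j. entry P i j \<in> commutant A"
    using crp_projection[of V] by blast
  define q where "q = entry P 0 0"
  have qU: "q x \<in> U" for x
    using P(1) by (auto simp: q_def V_def)
  have q1: "q x = x" if "x \<in> U" for x
  proof -
    have "ell2_single 0 x \<in> V"
      using that U(1) by (auto simp: V_def complex_vector.subspace_0)
    then show ?thesis
      using P(2) by (simp add: q_def)
  qed
  have qc: "q \<in> commutant A"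
    unfolding q_def by (rule P(3))
  have "q (T x) = T (q x)" if T: "T \<in> commutant A" for T x
  proof -
    define \<tau> where "\<tau> = q o\<^sub>L T o\<^sub>L (id_blinfun - q)"
    have tau: "\<tau> y = q (T (y - q y))" for y
      by (simp add: \<tau>_def blinfun.diff_left)
    have z: "\<tau> (X (\<tau> y)) = 0" if "X \<in> commutant A" for X y
      using q1[OF inv[OF that qU]] by (simp add: tau)
    have "\<tau> \<in> commutant A"
      unfolding \<tau>_def by (intro commutant_simps qc T)
    from semiprime[OF this z] have "\<tau> x = 0"
      by blast
    then have "q (T x) = q (T (q x))"
      by (simp add: tau blinfun.diff_right)
    also have "\<dots> = T (q x)"
      by (intro q1 inv[OF T] qU)
    finally show ?thesis .
  qed
  then have "q \<in> commutant (commutant A)"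
    using qc commutantD(1) by (intro commutantI)
  moreover have "q o\<^sub>L q = q"
    by (rule blinfun_eqI) (simp add: q1 qU)
  moreover have "U = range q"
    using qU q1 by (metis UNIV_I image_iff subsetI subset_antisym image_subset_iff)
  ultimately show ?thesis
    using qc by (auto simp: Z_def)
qed

text \<open>If the norms were unbounded, the ranges of suitable q n could be placed in the
  coordinates n of one submodule. The diagonal entry at n of its projection is idempotent with the
  range of q n; centrality of q n makes the two commute, hence coincide.\<close>

lemma Z_bounded: "\<exists>K. \<forall>q\<in>Z. norm q \<le> K"
proof (rule ccontr)
  assume "\<nexists>K. \<forall>q\<in>Z. norm q \<le> K"
  then have "\<exists>q\<in>Z. norm q > real n" for n
    by (meson not_le)
  then obtain q where q: "\<And>n. q n \<in> Z" "\<And>n. norm (q n) > real n"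
    by metis
  have qq: "q n (q n x) = q n x" for n x
    using q(1)[of n] unfolding Z_def by (metis (mono_tags, lifting) blinfun_apply_blinfun_compose mem_Collect_eq)
  have qb: "q n \<in> bounded_operators" for n
    using q(1)[of n] by (auto simp: Z_def commutant_def)
  define V where "V = {\<xi> :: (nat, 'a) ell2. \<forall>n. q n (ell2_nth \<xi> n) = ell2_nth \<xi> n}"
  have "csubspace V"
    by (rule complex_vector.subspaceI)
      (use qb in \<open>auto simp: V_def blinfun.bilinear_simps bounded_operatorsD\<close>)
  moreover have "closed V"
  proof -
    have "V = (\<Inter>n. {\<xi>. q n (ell2_nth \<xi> n) = ell2_nth \<xi> n})"
      by (auto simp: V_def)
    also have "closed \<dots>"
      by (intro closed_INT ballI closed_Collect_eq continuous_intros)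
    finally show ?thesis .
  qed
  moreover have "ell2_map T \<xi> \<in> V" if "T \<in> A" "\<xi> \<in> V" for T \<xi>
  proof -
    have "q n (T x) = T (q n x)" for n x
      using q(1)[of n] \<open>T \<in> A\<close> by (intro commutantD(2)) (auto simp: Z_def)
    with that(2) show ?thesis
      by (simp add: V_def)
  qed
  ultimately obtain P where P: "\<And>\<xi>. blinfun_apply P \<xi> \<in> V" "\<And>\<xi>. \<xi> \<in> V \<Longrightarrow> blinfun_apply P \<xi> = \<xi>"
    "\<And>i j. entry P i j \<in> commutant A"
    using crp_projection[of V] by blast
  have "norm (q n) \<le> norm P" for n
  proof (rule norm_blinfun_bound)
    fix x
    have "q n (entry P n n x) = entry P n n x"
      using P(1)[of "ell2_single n x"] by (simp add: V_def)
    moreover have "q n (entry P n n x) = entry P n n (q n x)"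
      using q(1)[of n] P(3) by (intro commutantD(2)[where D = "commutant A"]) (auto simp: Z_def)
    moreover have "entry P n n (q n x) = q n x"
    proof -
      have "ell2_single n (q n x) \<in> V"
        by (auto simp: V_def qq)
      then show ?thesis
        using P(2) by simp
    qed
    ultimately have "q n x = entry P n n x"
      by simp
    then show "norm (q n x) \<le> norm P * norm x"
      using norm_entry_apply_le[of P n n x] by simp
  qed simp
  moreover obtain n where "norm P \<le> real n"
    using real_arch_simple by blast
  ultimately show False
    using q(2)[of n] by (meson less_le_trans not_le order_trans)
qed

end

section \<open>Lomonosov's lemma\<close>

lemma compact_operators_image:
  assumes k: "k \<in> compact_operators"
  shows "\<exists>K. compact K \<and> blinfun_apply k ` cball 0 r \<subseteq> K"
proof -
  \<comment> \<open>Scaling by |r| + 1 instead of r avoids a division by zero.\<close>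
  have "blinfun_apply k x \<in> (\<lambda>y. (\<bar>r\<bar> + 1) *\<^sub>R y) ` closure (blinfun_apply k ` cball 0 1)" if "norm x \<le> r" for x
  proof (rule image_eqI)
    have "\<bar>r\<bar> + 1 \<noteq> 0"
      by linarith
    then show "k x = (\<bar>r\<bar> + 1) *\<^sub>R k ((1 / (\<bar>r\<bar> + 1)) *\<^sub>R x)"
      by (simp add: blinfun.scaleR_right)
    have "norm ((1 / (\<bar>r\<bar> + 1)) *\<^sub>R x) \<le> 1"
      using that norm_ge_zero[of x] by (simp add: divide_le_eq del: norm_ge_zero)
    then show "k ((1 / (\<bar>r\<bar> + 1)) *\<^sub>R x) \<in> closure (blinfun_apply k ` cball 0 1)"
      by (intro subsetD[OF closure_subset] imageI) simp
  qed
  moreover have "compact ((\<lambda>y. (\<bar>r\<bar> + 1) *\<^sub>R y) ` closure (blinfun_apply k ` cball 0 1))"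
    using k by (intro compact_scaling) (simp add: compact_operators_def)
  ultimately show ?thesis
    by (intro exI[of _ "(\<lambda>y. (\<bar>r\<bar> + 1) *\<^sub>R y) ` closure (blinfun_apply k ` cball 0 1)"]) auto
qed

lemma csubspace_convex: "csubspace U \<Longrightarrow> convex U"
  by (auto simp: convex_def csubspace_scaleR complex_vector.subspace_add)

text \<open>Local inverses of \<open>k\<close> taken from \<open>B\<close> are glued by a partition of unity,
  and Schauder's theorem is applied to the resulting nonlinear map.\<close>

lemma lomonosov:
  fixes U :: "'a::complex_hilbert_space set"
  assumes B: "0 \<in> B" "\<And>S T. S \<in> B \<Longrightarrow> T \<in> B \<Longrightarrow> S + T \<in> B" "\<And>(r::real) T. T \<in> B \<Longrightarrow> r *\<^sub>R T \<in> B"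
    and U: "csubspace U" "closed U" and BU: "\<And>T x. T \<in> B \<Longrightarrow> x \<in> U \<Longrightarrow> blinfun_apply T x \<in> U"
    and k: "k \<in> compact_operators" "\<And>x. x \<in> U \<Longrightarrow> blinfun_apply k x \<in> U"
    and trans: "\<And>y. y \<in> U \<Longrightarrow> y \<noteq> 0 \<Longrightarrow> U \<subseteq> closure {blinfun_apply T y | T. T \<in> B}"
    and x0: "x0 \<in> U" "blinfun_apply k x0 \<noteq> 0"
  shows "\<exists>T\<in>B. \<exists>x\<in>U. x \<noteq> 0 \<and> blinfun_apply T (blinfun_apply k x) = x"
proof -
  \<comment> \<open>On the ball of this radius k changes vectors by at most half the norm of k x0.
    Hence the closure C of the image avoids 0, and \<open>trans\<close> supplies at each point of C
    an element of B that carries it close to x0.\<close>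
  define r where "r = norm (k x0) / (2 * (norm k + 1))"
  have r: "0 < r"
    using x0(2) by (simp add: r_def add_nonneg_pos)
  define \<Omega> where "\<Omega> = U \<inter> cball x0 r"
  have kx: "norm (k x) \<ge> norm (k x0) / 2" if "x \<in> \<Omega>" for x
  proof -
    have "norm (k (x - x0)) \<le> norm k * r"
      using that by (intro order_trans[OF norm_blinfun] mult_left_mono)
        (auto simp: \<Omega>_def dist_norm norm_minus_commute)
    also have "norm k * r \<le> (norm k + 1) * r"
      using r by simp
    also have "\<dots> = norm (k x0) / 2"
    proof -
      have "norm k + 1 \<noteq> 0"
        using norm_ge_zero[of k] by linarith
      moreover have "a * (b / (2 * a)) = b / 2" if "a \<noteq> 0" for a b :: real
        using that by simp
      ultimately show ?thesis
        unfolding r_def by blast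
    qed
    finally show ?thesis
      using norm_triangle_ineq2[of "k x0" "k x"] by (simp add: blinfun.diff_right norm_minus_commute)
  qed
  define C where "C = closure (blinfun_apply k ` \<Omega>)"
  have "blinfun_apply k ` \<Omega> \<subseteq> blinfun_apply k ` cball 0 (norm x0 + r)"
  proof (intro image_mono subsetI)
    fix x assume "x \<in> \<Omega>"
    then show "x \<in> cball 0 (norm x0 + r)"
      using norm_triangle_ineq[of x0 "x - x0"] by (simp add: \<Omega>_def dist_norm norm_minus_commute)
  qed
  then obtain K where K: "compact K" "blinfun_apply k ` \<Omega> \<subseteq> K"
    using compact_operators_image[OF k(1), of "norm x0 + r"] by blast
  have C: "compact C"
    unfolding C_def using K by (metis closure_minimal compact_Int_closed closed_closure compact_imp_closed inf.absorb_iff2)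
  have CU: "C \<subseteq> U"
    unfolding C_def by (rule closure_minimal) (use k(2) U(2) in \<open>auto simp: \<Omega>_def\<close>)
  have "C \<subseteq> {y. norm (k x0) / 2 \<le> norm y}"
    unfolding C_def
  proof (rule closure_minimal)
    show "blinfun_apply k ` \<Omega> \<subseteq> {y. norm (k x0) / 2 \<le> norm y}"
      using kx by blast
  qed (intro closed_Collect_le continuous_intros)
  then have C0: "0 \<notin> C"
    using x0(2) by auto
  have cover: "C \<subseteq> (\<Union>T\<in>B. {y. norm (blinfun_apply T y - x0) < r})"
  proof
    fix y assume y: "y \<in> C"
    then have "x0 \<in> closure {blinfun_apply T y | T. T \<in> B}"
      using trans[of y] CU C0 x0(1) by blast
    then obtain T where "T \<in> B" "dist (T y) x0 < r"
      unfolding closure_approachable using r by blast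
    then show "y \<in> (\<Union>T\<in>B. {y. norm (blinfun_apply T y - x0) < r})"
      by (auto simp: dist_norm)
  qed
  have op: "open {y. norm (blinfun_apply T y - x0) < r}" for T
    by (intro open_Collect_less continuous_intros)
  obtain \<T> where T: "\<T> \<subseteq> B" "finite \<T>" "C \<subseteq> (\<Union>T\<in>\<T>. {y. norm (blinfun_apply T y - x0) < r})"
    using compactE_image[OF C op cover] .
  define \<phi> where "\<phi> T y = max 0 (r - norm (blinfun_apply T y - x0))"
    for T :: "'a \<Rightarrow>\<^sub>L 'a" and y
  have \<phi>0: "0 \<le> \<phi> T y" for T y
    by (simp add: \<phi>_def)
  have pos: "0 < (\<Sum>T\<in>\<T>. \<phi> T y)" if y: "y \<in> C" for y
  proof -
    obtain T0 where "T0 \<in> \<T>" "norm (T0 y - x0) < r"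
      using subsetD[OF T(3) y] by auto
    then show ?thesis
      using T(2) by (intro sum_pos2[of _ T0]) (auto simp: \<phi>_def)
  qed
  define w where "w T y = \<phi> T y / (\<Sum>S\<in>\<T>. \<phi> S y)" for T y
  have w0: "0 \<le> w T y" for T y
    unfolding w_def by (intro divide_nonneg_nonneg sum_nonneg \<phi>0)
  have w1: "(\<Sum>T\<in>\<T>. w T y) = 1" if "y \<in> C" for y
    using pos[OF that] by (simp add: w_def sum_divide_distrib[symmetric])
  define \<Psi> where "\<Psi> y = (\<Sum>T\<in>\<T>. w T y *\<^sub>R blinfun_apply T y)" for y
  have \<Psi>: "\<Psi> y \<in> \<Omega>" if y: "y \<in> C" for y
  proof -
    have "\<Psi> y \<in> U"
      unfolding \<Psi>_def using y CU T(1) BU U(1)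
      by (intro complex_vector.subspace_sum csubspace_scaleR) auto
    moreover have "norm (\<Psi> y - x0) \<le> r"
    proof -
      have "\<Psi> y - x0 = (\<Sum>T\<in>\<T>. w T y *\<^sub>R (T y - x0))"
        using w1[OF y] by (simp add: \<Psi>_def scaleR_diff_right sum_subtractf scaleR_left.sum[symmetric])
      also have "norm \<dots> \<le> (\<Sum>T\<in>\<T>. w T y * r)"
      proof (rule sum_norm_le)
        fix T assume "T \<in> \<T>"
        show "norm (w T y *\<^sub>R (T y - x0)) \<le> w T y * r"
        proof (cases "norm (T y - x0) \<le> r")
          case True
          then show ?thesis
            using w0[of T y] by (simp add: mult_left_mono)
        next
          case False
          then have "w T y = 0"
            by (simp add: w_def \<phi>_def)
          then show ?thesis by simp
        qed
      qed
      also have "\<dots> = r"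
        by (simp add: sum_distrib_right[symmetric] w1[OF y])
      finally show ?thesis .
    qed
    ultimately show ?thesis
      by (simp add: \<Omega>_def dist_norm norm_minus_commute)
  qed
  have c\<phi>: "continuous_on C (\<phi> T)" for T
    unfolding \<phi>_def by (intro continuous_intros)
  have c\<Psi>: "continuous_on C \<Psi>"
    unfolding \<Psi>_def w_def using pos by (intro continuous_intros c\<phi>) (metis less_irrefl)
  have "\<exists>x\<in>\<Psi> ` C. \<Psi> (k x) = x"
  proof (rule schauder)
    show "convex \<Omega>"
      unfolding \<Omega>_def by (intro convex_Int csubspace_convex U convex_cball)
    show "compact (\<Psi> ` C)"
      by (intro compact_continuous_image c\<Psi> C)
    show "\<Psi> ` C \<subseteq> \<Omega>"
      using \<Psi> by blast
    show "\<Omega> \<noteq> {}"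
      using x0(1) r by (auto simp: \<Omega>_def)
    have kC: "k x \<in> C" if "x \<in> \<Omega>" for x
      unfolding C_def by (intro subsetD[OF closure_subset] imageI that)
    then show "(\<lambda>x. \<Psi> (k x)) ` \<Omega> \<subseteq> \<Psi> ` C"
      by (intro image_subsetI imageI)
    show "continuous_on \<Omega> (\<lambda>x. \<Psi> (k x))"
      by (rule continuous_on_compose2[OF c\<Psi>]) (auto intro!: continuous_intros kC)
  qed
  then obtain x where x: "x \<in> \<Psi> ` C" "\<Psi> (k x) = x"
    by blast
  have x\<Omega>: "x \<in> \<Omega>"
    using x(1) \<Psi> by blast
  have sumB: "(\<Sum>T\<in>F. f T *\<^sub>R T) \<in> B" if "finite F" "F \<subseteq> B" for F and f :: "_ \<Rightarrow> real"
    using that by (induction F rule: finite_induct) (auto intro: B)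
  \<comment> \<open>The weights are frozen at the fixed point: there the nonlinear map agrees with
    one linear operator from B.\<close>
  have "(\<Sum>T\<in>\<T>. w T (k x) *\<^sub>R T) \<in> B"
    by (rule sumB) (use T in auto)
  moreover have "blinfun_apply (\<Sum>T\<in>\<T>. w T (k x) *\<^sub>R T) (k x) = x"
    using x(2) by (simp add: \<Psi>_def blinfun.sum_left blinfun.scaleR_left)
  moreover have "x \<noteq> 0"
    using kx[OF x\<Omega>] x0(2) by auto
  ultimately show ?thesis
    using x\<Omega> unfolding \<Omega>_def by blast
qed

text \<open>Distinct orthonormal vectors are at distance root 2, so two of them never share a point
  of a 1/2-net of K. The net bounds the size of orthonormal sets in F, and one of maximal size
  spans.\<close>

lemma finite_orthonormal_span:
  fixes F :: "'a::complex_hilbert_space set"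
  assumes F: "csubspace F" and K: "compact K" "F \<inter> cball 0 1 \<subseteq> K"
  shows "\<exists>E. finite E \<and> F \<subseteq> cspan E"
proof -
  define on where "on E \<longleftrightarrow> finite E \<and> E \<subseteq> F \<and> (\<forall>x\<in>E. norm x = 1) \<and> (\<forall>x\<in>E. \<forall>y\<in>E. x \<noteq> y \<longrightarrow> cinner x y = 0)"
    for E :: "'a set"
  have "K \<subseteq> (\<Union>z\<in>K. ball z (1/2))"
    by auto
  then obtain Y where Y: "Y \<subseteq> K" "finite Y" "K \<subseteq> (\<Union>z\<in>Y. ball z (1/2))"
    using compactE_image[OF K(1), of K "\<lambda>z. ball z (1/2)"] by auto
  have bound: "card E \<le> card Y" if E: "on E" for E
  proof -
    have "\<forall>x\<in>E. \<exists>z\<in>Y. dist z x < 1/2"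
      using E K(2) Y(3) unfolding on_def by (fastforce simp: subset_iff)
    then obtain f where f: "\<And>x. x \<in> E \<Longrightarrow> f x \<in> Y" "\<And>x. x \<in> E \<Longrightarrow> dist (f x) x < 1/2"
      by metis
    have "inj_on f E"
    proof (rule inj_onI, rule ccontr)
      fix x y assume xy: "x \<in> E" "y \<in> E" "f x = f y" "x \<noteq> y"
      have "dist x y < 1"
        using dist_triangle[of x y "f x"] f(2)[OF xy(1)] f(2)[OF xy(2)] xy(3) by (simp add: dist_commute)
      then have "(norm (x - y))\<^sup>2 < 1"
        by (simp add: dist_norm power_less_one_iff)
      moreover have "(norm (x - y))\<^sup>2 = 2"
        using E xy by (simp add: on_def norm_square_diff)
      ultimately show False by simp
    qed
    then show ?thesis
      using f(1) Y(2) by (intro card_inj_on_le[of f]) auto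
  qed
  have "on {}"
    by (simp add: on_def)
  then obtain E where E: "on E" "\<And>E'. on E' \<Longrightarrow> card E' \<le> card E"
    using ex_has_greatest_nat[of on "{}" card "Suc (card Y)"] bound le_imp_less_Suc by blast
  have fin: "finite E"
    using E(1) by (simp add: on_def)
  have "x \<in> cspan E" if x: "x \<in> F" for x
  proof -
    define p where "p = (\<Sum>e\<in>E. cinner x e *\<^sub>C e)"
    have p: "p \<in> cspan E"
      unfolding p_def by (intro complex_vector.span_sum complex_vector.span_scale complex_vector.span_base)
    have pF: "p \<in> F"
      unfolding p_def using E(1) F by (intro complex_vector.subspace_sum complex_vector.subspace_scale) (auto simp: on_def)
    have orth: "cinner (x - p) e = 0" if e: "e \<in> E" for e
    proof -
      have "cinner p e = (\<Sum>d\<in>E. cinner x d * cinner d e)"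
        by (simp add: p_def cinner.sum_left cinner_scaleC_left)
      also have "\<dots> = (\<Sum>d\<in>E. if d = e then cinner x e else 0)"
        using E(1) e by (intro sum.cong) (auto simp: on_def cinner_self)
      also have "\<dots> = cinner x e"
        using fin e by simp
      finally show ?thesis
        by (simp add: cinner.diff_left)
    qed
    have "x - p = 0"
    proof (rule ccontr)
      assume ne: "x - p \<noteq> 0"
      define u where "u = (1 / norm (x - p)) *\<^sub>R (x - p)"
      have u: "norm u = 1" "u \<in> F"
        using ne x pF F by (simp_all add: u_def csubspace_scaleR csubspace_diff)
      have uo: "cinner u e = 0" if "e \<in> E" for e
        using orth[OF that] by (simp add: u_def cinner.scaleR_left)
      have uo': "cinner e u = 0" if "e \<in> E" for e
        using uo[OF that] cinner_eq_zero_commute by blast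
      have "u \<notin> E"
        using uo(1)[of u] u(1) by (auto simp: cinner_self)
      moreover have "on (insert u E)"
        using E(1) u uo uo' by (auto simp: on_def)
      ultimately show False
        using E(2)[of "insert u E"] fin by simp
    qed
    then show ?thesis
      using p by simp
  qed
  then show ?thesis
    using fin by blast
qed

text \<open>The powers of a applied to y lie in a finitely generated space, so some nonzero
  polynomial p has p(a) y = 0. Splitting a root z off one of least degree leaves q with q(a) y
  nonzero and (a - z) q(a) y = 0.\<close>

lemma invariant_compact_ball_eigenvector:
  fixes F :: "'a::complex_hilbert_space set"
  assumes F: "csubspace F" and K: "compact K" "F \<inter> cball 0 1 \<subseteq> K"
    and a: "a \<in> bounded_operators" "\<And>x. x \<in> F \<Longrightarrow> blinfun_apply a x \<in> F"
    and y: "y \<in> F" "y \<noteq> 0"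
  shows "\<exists>c. \<exists>x\<in>F. x \<noteq> 0 \<and> blinfun_apply a x = c *\<^sub>C x"
proof -
  obtain E where E: "finite E" "F \<subseteq> cspan E"
    using finite_orthonormal_span[OF F K] by blast
  \<comment> \<open>Horner's scheme: \<open>pe p\<close> is p(a) y.\<close>
  define pe where "pe p = fold_coeffs (\<lambda>c v. c *\<^sub>C y + blinfun_apply a v) p 0" for p
  have pe0: "pe 0 = 0"
    by (simp add: pe_def)
  have pe_pCons: "pe (pCons c p) = c *\<^sub>C y + a (pe p)" for c p
    by (cases "p = 0 \<and> c = 0") (auto simp: pe_def)
  have pe_add: "pe (p + q) = pe p + pe q" for p q
  proof (induction p arbitrary: q)
    case (pCons c p)
    show ?case
    proof (cases q)
      case (pCons d q')
      then show ?thesis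
        by (simp add: pe_pCons pCons.IH blinfun.add_right scaleC_add_left)
    qed
  qed (simp add: pe0)
  have pe_smult: "pe (smult c p) = c *\<^sub>C pe p" for c p
    by (induction p) (simp_all add: pe0 pe_pCons bounded_operatorsD[OF a(1)] scaleC_add_right scaleC_scaleC)
  have pe_F: "pe p \<in> F" for p
    by (induction p) (use F y(1) a(2) in
      \<open>auto simp: pe0 pe_pCons complex_vector.subspace_0 intro!: complex_vector.subspace_add complex_vector.subspace_scale\<close>)
  have pe_sum: "pe (\<Sum>i\<in>I. f i) = (\<Sum>i\<in>I. pe (f i))" for I :: "nat set" and f
    by (induction I rule: infinite_finite_induct) (simp_all add: pe0 pe_add)
  have "\<exists>p. p \<noteq> 0 \<and> pe p = 0"
  proof (rule ccontr)
    assume no: "\<nexists>p. p \<noteq> 0 \<and> pe p = 0"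
    \<comment> \<open>The vectors a^i y; if no polynomial annihilated y, the first card E + 1 of
      them would be independent in the span of E.\<close>
    define f where "f i = pe (monom 1 i)" for i
    have inj: "inj f"
    proof (rule injI)
      fix i j assume "f i = f j"
      then have "pe (monom 1 i + smult (-1) (monom 1 j)) = 0"
        unfolding pe_add pe_smult f_def by (simp add: scaleC.minus_left scaleC_one)
      then have "monom 1 i + smult (-1) (monom 1 j) = (0 :: complex poly)"
        using no by blast
      then show "i = j"
        by (simp add: smult_monom) (metis add.right_inverse minus_monom monom_eq_iff' add_right_cancel one_neq_zero)
    qed
    have "complex_vector.independent (f ` {..card E})"
    proof
      assume "complex_vector.dependent (f ` {..card E})"
      then obtain u v where uv: "v \<in> f ` {..card E}" "u v \<noteq> 0" "(\<Sum>v\<in>f ` {..card E}. u v *\<^sub>C v) = 0"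
        by (subst (asm) complex_vector.dependent_finite) auto
      then obtain i where i: "i \<le> card E" "u (f i) \<noteq> 0" by auto
      have "pe (\<Sum>i\<le>card E. smult (u (f i)) (monom 1 i)) = (\<Sum>v\<in>f ` {..card E}. u v *\<^sub>C v)"
        by (subst sum.reindex) (auto intro: inj_on_subset[OF inj] simp: pe_sum pe_smult f_def)
      then have "(\<Sum>i\<le>card E. smult (u (f i)) (monom 1 i)) = 0"
        using uv(3) no by auto
      then have "coeff (\<Sum>i\<le>card E. smult (u (f i)) (monom 1 i)) i = 0"
        by simp
      then show False
        using i by (simp add: coeff_sum smult_monom)
    qed
    moreover have "f ` {..card E} \<subseteq> cspan E"
      using E(2) pe_F by (auto simp: f_def)
    ultimately have "card (f ` {..card E}) \<le> card E"
      using complex_vector.independent_span_bound[OF E(1)] by blast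
    then show False
      by (simp add: card_image inj_on_subset[OF inj])
  qed
  then obtain p0 where "p0 \<noteq> 0 \<and> pe p0 = 0" by blast
  then obtain p where p: "p \<noteq> 0" "pe p = 0" "\<And>q. q \<noteq> 0 \<Longrightarrow> pe q = 0 \<Longrightarrow> degree p \<le> degree q"
    using ex_has_least_nat[of "\<lambda>p. p \<noteq> 0 \<and> pe p = 0" p0 degree] by auto
  have "\<not> constant (poly p)"
  proof
    assume "constant (poly p)"
    then have "degree p = 0"
      by (simp add: constant_degree)
    then obtain c where "p = [:c:]"
      by (metis degree_eq_zeroE)
    then show False
      using p(1,2) y(2) by (auto simp: pe_pCons pe0 scaleC_scaleC scaleC_one dest!: arg_cong[of _ _ "\<lambda>x. inverse c *\<^sub>C x"])
  qed
  then obtain z where "poly p z = 0"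
    using fundamental_theorem_of_algebra by blast
  then obtain q where q: "p = [:- z, 1:] * q"
    using poly_eq_0_iff_dvd by blast
  have q0: "q \<noteq> 0"
    using q p(1) by auto
  have "pe q \<noteq> 0"
  proof
    assume "pe q = 0"
    from p(3)[OF q0 this] have "degree p \<le> degree q" .
    moreover have "degree p = Suc (degree q)"
      unfolding q using q0 by (subst degree_mult_eq) auto
    ultimately show False by simp
  qed
  moreover have "a (pe q) = z *\<^sub>C pe q"
  proof -
    have "p = smult (- z) q + pCons 0 q"
      by (simp add: q)
    from p(2)[unfolded this pe_add pe_smult pe_pCons] show ?thesis
      by (simp add: scaleC.minus_left)
  qed
  ultimately show ?thesis
    using pe_F by blast
qed

section \<open>Dixmier's similarity\<close>

lemma inverse_operatorsD:
  assumes "inverse_operators S R"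
  shows "S \<in> bounded_operators" "R \<in> bounded_operators"
    "blinfun_apply S (blinfun_apply R x) = x" "blinfun_apply R (blinfun_apply S x) = x"
proof -
  have "S o\<^sub>L R = id_blinfun" "R o\<^sub>L S = id_blinfun"
    using assms by (simp_all add: inverse_operators_def)
  from this[THEN arg_cong, of "\<lambda>T. blinfun_apply T x"]
  show "blinfun_apply S (blinfun_apply R x) = x" "blinfun_apply R (blinfun_apply S x) = x"
    by simp_all
qed (use assms in \<open>simp_all add: inverse_operators_def\<close>)

text \<open>The inverse sends w to the fixed point of the contraction that maps x to w + z x;
  uniqueness of the fixed point gives linearity.\<close>

lemma ex_inverse_id_minus:
  fixes z :: "'a::complex_hilbert_space \<Rightarrow>\<^sub>L 'a"
  assumes z: "z \<in> bounded_operators" and n: "norm z \<le> \<eta>" "\<eta> < 1"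
  shows "\<exists>R. inverse_operators (id_blinfun - z) R"
proof -
  have e0: "0 \<le> \<eta>"
    using n(1) norm_ge_zero order_trans by blast
  have ex: "\<exists>!x. w + z x = x" for w
  proof (rule banach_fix_type[OF e0 n(2)], intro allI)
    fix x y
    have "norm (z (x - y)) \<le> \<eta> * norm (x - y)"
      using order_trans[OF norm_blinfun mult_right_mono[OF n(1) norm_ge_zero]] .
    then show "dist (w + z x) (w + z y) \<le> \<eta> * dist x y"
      by (simp add: dist_norm blinfun.diff_right)
  qed
  define f where "f w = (THE x. w + z x = x)" for w
  have f: "w + z (f w) = f w" for w
    unfolding f_def by (rule theI'[OF ex])
  have u: "f w = x" if "w + z x = x" for w x
    using ex[of w] f[of w] that by blast
  have fadd: "f (x + y) = f x + f y" for x y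
  proof (rule u)
    have "x + y + z (f x + f y) = (x + z (f x)) + (y + z (f y))"
      by (simp add: blinfun.add_right)
    then show "x + y + z (f x + f y) = f x + f y"
      by (simp add: f)
  qed
  have fscale: "f (c *\<^sub>C x) = c *\<^sub>C f x" for c x
  proof (rule u)
    have "c *\<^sub>C x + z (c *\<^sub>C f x) = c *\<^sub>C (x + z (f x))"
      by (simp add: bounded_operatorsD[OF z] scaleC_add_right)
    then show "c *\<^sub>C x + z (c *\<^sub>C f x) = c *\<^sub>C f x"
      by (simp add: f)
  qed
  have fbd: "norm (f w) \<le> (1 / (1 - \<eta>)) * norm w" for w
  proof -
    have "norm (f w) \<le> norm w + norm (z (f w))"
      using norm_triangle_ineq[of w "z (f w)"] by (simp add: f)
    also have "norm (z (f w)) \<le> \<eta> * norm (f w)"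
      using order_trans[OF norm_blinfun mult_right_mono[OF n(1) norm_ge_zero]] .
    finally show ?thesis
      using n(2) by (simp add: field_simps)
  qed
  obtain R where R: "R \<in> bounded_operators" "\<And>x. blinfun_apply R x = f x"
    using ex_operator[OF fadd fscale fbd] by blast
  have "(id_blinfun - z) o\<^sub>L R = id_blinfun"
  proof (rule blinfun_eqI)
    fix w
    show "blinfun_apply ((id_blinfun - z) o\<^sub>L R) w = blinfun_apply id_blinfun w"
      using f[of w] by (simp add: R(2) blinfun.diff_left) (metis add_diff_cancel_right')
  qed
  moreover have "R o\<^sub>L (id_blinfun - z) = id_blinfun"
    by (rule blinfun_eqI) (simp add: R(2) blinfun.diff_left u)
  ultimately show ?thesis
    using R(1) z unfolding inverse_operators_def by (intro exI[of _ R]) auto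
qed

text \<open>The square root of \<open>1 - y\<close> is \<open>1 - z\<close>, where \<open>z\<close> is the fixed point of the contraction
  \<open>z \<mapsto> (y + z\<^sup>2) / 2\<close>.\<close>

lemma ex_positive_square_root:
  fixes Q :: "'a::complex_hilbert_space \<Rightarrow>\<^sub>L 'a"
  assumes Q: "Q \<in> bounded_operators" and adj: "\<And>x y. cinner (blinfun_apply Q x) y = cinner x (blinfun_apply Q y)"
    and m: "0 < m" "\<And>x. m * (norm x)\<^sup>2 \<le> Re (cinner (blinfun_apply Q x) x)"
  shows "\<exists>c>0. \<exists>S R. inverse_operators S R \<and>
    (\<forall>x y. cinner (blinfun_apply S x) y = cinner x (blinfun_apply S y)) \<and> (\<forall>x. blinfun_apply S (blinfun_apply S x) = c *\<^sub>R blinfun_apply Q x)"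
proof -
  define M where "M = norm Q + m"
  have M: "norm Q \<le> M" "m \<le> M" "0 < M"
    using m(1) by (simp_all add: M_def add_nonneg_pos)
  \<comment> \<open>This c minimises 1 - 2 c m + c^2 M^2, the bound for the squared norm of 1 - c Q.
    The minimum 1 - m^2 / M^2 is the square of \<open>\<eta>\<close> and less than 1.\<close>
  define c where "c = m / M\<^sup>2"
  have c: "0 < c"
    using m(1) M by (simp add: c_def)
  define \<eta> where "\<eta> = sqrt (1 - m\<^sup>2 / M\<^sup>2)"
  have r: "0 \<le> 1 - m\<^sup>2 / M\<^sup>2" "1 - m\<^sup>2 / M\<^sup>2 < 1"
    using M m(1) by (simp_all add: divide_le_eq power_mono)
  have \<eta>: "0 \<le> \<eta>" "\<eta> < 1" "\<eta>\<^sup>2 = 1 - m\<^sup>2 / M\<^sup>2"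
    using r unfolding \<eta>_def by (simp_all add: real_sqrt_lt_1_iff)
  define y where "y = id_blinfun - c *\<^sub>R Q"
  have y: "y \<in> bounded_operators"
    unfolding y_def using Q by auto
  have yadj: "cinner (y u) v = cinner u (y v)" for u v
    by (simp add: y_def blinfun.diff_left blinfun.scaleR_left cinner.diff_left cinner.diff_right
        cinner.scaleR_left cinner.scaleR_right adj)
  have yn: "norm y \<le> \<eta>"
  proof (rule norm_blinfun_bound[OF \<eta>(1)])
    fix x
    have "(norm (y x))\<^sup>2 = (norm x)\<^sup>2 + c\<^sup>2 * (norm (Q x))\<^sup>2 - 2 * c * Re (cinner (Q x) x)"
      by (simp add: y_def blinfun.diff_left blinfun.scaleR_left norm_square_diff cinner.scaleR_right
          power_mult_distrib adj)
    also have "\<dots> \<le> (norm x)\<^sup>2 + c\<^sup>2 * (M\<^sup>2 * (norm x)\<^sup>2) - 2 * c * (m * (norm x)\<^sup>2)"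
    proof -
      have "norm (Q x) \<le> M * norm x"
        using order_trans[OF norm_blinfun mult_right_mono[OF M(1) norm_ge_zero]] .
      then have "(norm (Q x))\<^sup>2 \<le> M\<^sup>2 * (norm x)\<^sup>2"
        using power_mono[of "norm (Q x)" "M * norm x" 2] by (simp add: power_mult_distrib)
      then have "c\<^sup>2 * (norm (Q x))\<^sup>2 \<le> c\<^sup>2 * (M\<^sup>2 * (norm x)\<^sup>2)"
        by (simp add: mult_left_mono)
      moreover have "2 * c * (m * (norm x)\<^sup>2) \<le> 2 * c * Re (cinner (Q x) x)"
        using m(2)[of x] c by simp
      ultimately show ?thesis by linarith
    qed
    also have "\<dots> = (1 - m\<^sup>2 / M\<^sup>2) * (norm x)\<^sup>2"
      using M(3) by (simp add: c_def power2_eq_square field_simps)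
    also have "\<dots> = (\<eta> * norm x)\<^sup>2"
      by (simp add: power_mult_distrib \<eta>(3))
    finally show "norm (y x) \<le> \<eta> * norm x"
      by (rule power2_le_imp_le) (use \<eta>(1) in simp)
  qed
  \<comment> \<open>Self-adjointness is built into the complete set on which the contraction acts,
    so that the fixed point inherits it.\<close>
  define D where "D = {z :: 'a \<Rightarrow>\<^sub>L 'a. z \<in> bounded_operators \<and> norm z \<le> \<eta> \<and>
    (\<forall>u v. cinner (blinfun_apply z u) v = cinner u (blinfun_apply z v))}"
  define F where "F z = (1/2) *\<^sub>R (y + (z o\<^sub>L z))" for z :: "'a \<Rightarrow>\<^sub>L 'a"
  have "closed D"
  proof -
    have "D = bounded_operators \<inter> {z. norm z \<le> \<eta>} \<inter>
        (\<Inter>u. \<Inter>v. {z. cinner (blinfun_apply z u) v = cinner u (blinfun_apply z v)})"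
      by (auto simp: D_def)
    also have "closed \<dots>"
      by (intro closed_Int closed_INT ballI closed_bounded_operators closed_Collect_eq closed_Collect_le
          continuous_intros cinner.continuous_on)
    finally show ?thesis .
  qed
  then have "complete D"
    by (simp add: complete_eq_closed)
  moreover have "D \<noteq> {}"
  proof -
    have "y \<in> D"
      unfolding D_def using y yn yadj by blast
    then show ?thesis by blast
  qed
  moreover have "F ` D \<subseteq> D"
  proof (intro image_subsetI)
    fix z assume z: "z \<in> D"
    have "norm (F z) \<le> (1/2) * (norm y + norm (z o\<^sub>L z))"
      using norm_triangle_ineq[of y "z o\<^sub>L z"] by (simp add: F_def)
    also have "norm (z o\<^sub>L z) \<le> norm z * norm z"
      by (rule norm_blinfun_compose)
    also have "norm z * norm z \<le> 1 * \<eta>"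
      using z \<eta> by (intro mult_mono) (auto simp: D_def)
    finally have "norm (F z) \<le> \<eta>"
      using yn by simp
    then show "F z \<in> D"
      using z y yadj by (auto simp: D_def F_def blinfun.bilinear_simps cinner.scaleR_left cinner.scaleR_right
          cinner_add_left cinner_add_right)
  qed
  moreover have "dist (F z) (F w) \<le> \<eta> * dist z w" if "z \<in> D" "w \<in> D" for z w
  proof -
    have "F z - F w = (1/2) *\<^sub>R ((z o\<^sub>L (z - w)) + ((z - w) o\<^sub>L w))"
      unfolding F_def by (rule blinfun_eqI) (simp add: blinfun.bilinear_simps algebra_simps)
    also have "norm \<dots> \<le> (1/2) * (norm z * norm (z - w) + norm (z - w) * norm w)"
      using norm_triangle_ineq[of "z o\<^sub>L (z - w)" "(z - w) o\<^sub>L w"]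
        norm_blinfun_compose[of z "z - w"] norm_blinfun_compose[of "z - w" w] by simp
    also have "\<dots> \<le> (1/2) * (\<eta> * norm (z - w) + norm (z - w) * \<eta>)"
      using that \<eta>(1) by (intro mult_left_mono add_mono mult_mono) (auto simp: D_def)
    finally show ?thesis
      by (simp add: dist_norm)
  qed
  ultimately obtain z where z: "z \<in> D" "F z = z"
    using Banach_fix[OF _ _ \<eta>(1,2), of D F] by blast
  have zz: "2 *\<^sub>R z = y + (z o\<^sub>L z)"
    using arg_cong[OF z(2), of "\<lambda>x. 2 *\<^sub>R x"] by (simp add: F_def)
  obtain R where R: "inverse_operators (id_blinfun - z) R"
    using ex_inverse_id_minus[OF _ _ \<eta>(2), of z] z(1) by (auto simp: D_def)
  have "blinfun_apply (id_blinfun - z) (blinfun_apply (id_blinfun - z) x) = c *\<^sub>R Q x" for x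
  proof -
    have "2 *\<^sub>R z x = (x - c *\<^sub>R Q x) + z (z x)"
      using arg_cong[OF zz, of "\<lambda>T. blinfun_apply T x"] by (simp add: blinfun.bilinear_simps y_def)
    then have "x - 2 *\<^sub>R z x + z (z x) = c *\<^sub>R Q x"
      by (simp add: algebra_simps)
    then show ?thesis
      by (simp add: blinfun.bilinear_simps scaleR_2 algebra_simps)
  qed
  moreover have "cinner (blinfun_apply (id_blinfun - z) u) v = cinner u (blinfun_apply (id_blinfun - z) v)" for u v
    using z(1) by (simp add: D_def blinfun.diff_left cinner.diff_left cinner.diff_right)
  ultimately show ?thesis
    using R c by blast
qed

text \<open>An invariant inner product exists by compactness, since averaging over
  one involution keeps the invariance under the others and the bounds.\<close>

theorem similar_to_self_adjoint_involutions:
  fixes G :: "('a::complex_hilbert_space \<Rightarrow>\<^sub>L 'a) set"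
  assumes G: "G \<subseteq> bounded_operators" "id_blinfun \<in> G"
    and mult: "\<And>g h. g \<in> G \<Longrightarrow> h \<in> G \<Longrightarrow> g o\<^sub>L h \<in> G"
    and comm: "\<And>g h. g \<in> G \<Longrightarrow> h \<in> G \<Longrightarrow> g o\<^sub>L h = h o\<^sub>L g"
    and inv: "\<And>g. g \<in> G \<Longrightarrow> g o\<^sub>L g = id_blinfun"
    and bd: "\<And>g. g \<in> G \<Longrightarrow> norm g \<le> M"
  shows "\<exists>S R. inverse_operators S R \<and>
    (\<forall>g\<in>G. \<forall>x y. cinner (blinfun_apply (S o\<^sub>L g o\<^sub>L R) x) y = cinner x (blinfun_apply (S o\<^sub>L g o\<^sub>L R) y))"
proof -
  define N where "N = max 1 M"
  have N: "1 \<le> N" "\<And>g. g \<in> G \<Longrightarrow> norm g \<le> N"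
    using bd by (auto simp: N_def le_max_iff_disj)
  \<comment> \<open>Forms are treated as mere functions on pairs: the product of closed discs is
    compact by Tychonoff, and the conditions in \<open>H\<close> and \<open>I\<close> are closed
    because each single equation or inequality involves finitely many values.\<close>
  define K where "K = {B :: 'a \<times> 'a \<Rightarrow> complex. \<forall>z. B z \<in> cball 0 (N\<^sup>2 * norm (fst z) * norm (snd z))}"
  have "compactin (product_topology (\<lambda>i. euclidean) UNIV)
      (Pi\<^sub>E UNIV (\<lambda>z::'a \<times> 'a. cball (0::complex) (N\<^sup>2 * norm (fst z) * norm (snd z))))"
    by (subst compactin_PiE) auto
  moreover have "K = Pi\<^sub>E UNIV (\<lambda>z. cball 0 (N\<^sup>2 * norm (fst z) * norm (snd z)))"
    unfolding K_def PiE_UNIV_domain by (simp add: Pi_def)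
  ultimately have "compact K"
    by (metis compactin_euclidean_iff euclidean_product_topology)
  \<comment> \<open>The bounds are imposed on all translates of the form by G, and not only on the
    form itself; this makes them stable under averaging with a translate.\<close>
  define H where "H = {B. (\<forall>x y z. B (x + y, z) = B (x, z) + B (y, z)) \<and> (\<forall>c x y. B (c *\<^sub>C x, y) = c * B (x, y)) \<and>
    (\<forall>x y. B (x, y) = cnj (B (y, x))) \<and>
    (\<forall>g\<in>G. (\<forall>x y. cmod (B (blinfun_apply g x, blinfun_apply g y)) \<le> N\<^sup>2 * norm x * norm y) \<and>
      (\<forall>x. (norm x)\<^sup>2 / N\<^sup>2 \<le> Re (B (blinfun_apply g x, blinfun_apply g x))))}"
  have HD: "B (x + y, z) = B (x, z) + B (y, z)" "B (c *\<^sub>C x, y) = c * B (x, y)" "B (x, y) = cnj (B (y, x))"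
    "g \<in> G \<Longrightarrow> cmod (B (blinfun_apply g x, blinfun_apply g y)) \<le> N\<^sup>2 * norm x * norm y"
    "g \<in> G \<Longrightarrow> (norm x)\<^sup>2 / N\<^sup>2 \<le> Re (B (blinfun_apply g x, blinfun_apply g x))"
    if "B \<in> H" for B x y z c g
    using that unfolding H_def by blast+
  have ev: "continuous_on UNIV (\<lambda>B :: 'a \<times> 'a \<Rightarrow> complex. B z)" for z
    by simp
  have "closed H"
    unfolding H_def Collect_conj_eq Collect_all_eq Collect_ball_eq
    by (intro closed_Int closed_INT ballI closed_Collect_eq closed_Collect_le continuous_intros ev)
  moreover have "H \<subseteq> K"
  proof
    fix B assume "B \<in> H"
    then show "B \<in> K"
      using HD(4)[of B id_blinfun, OF _ G(2)] by (simp add: K_def)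
  qed
  ultimately have "compact H"
    using \<open>compact K\<close> by (metis compact_Int_closed inf.absorb_iff2)
  define I where "I g = {B :: 'a \<times> 'a \<Rightarrow> complex. \<forall>x y. B (blinfun_apply g x, blinfun_apply g y) = B (x, y)}" for g
  have "H \<inter> (\<Inter>g\<in>G. I g) \<noteq> {}"
  proof (rule compact_imp_fip_image[OF \<open>compact H\<close>])
    show "closed (I g)" for g
      unfolding I_def Collect_all_eq
      by (intro closed_INT ballI closed_Collect_eq ev)
    fix F assume "finite F" "F \<subseteq> G"
    then show "H \<inter> (\<Inter>g\<in>F. I g) \<noteq> {}"
    proof (induction F rule: finite_induct)
      case empty
      have "(\<lambda>(x, y). cinner x y) \<in> H"
      proof -
        have "cmod (cinner (g x) (g y)) \<le> N\<^sup>2 * norm x * norm y" if "g \<in> G" for g x y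
        proof -
          have gn: "norm (g x) \<le> N * norm x" for x
            using order_trans[OF norm_blinfun mult_right_mono[OF N(2)[OF that] norm_ge_zero]] .
          have "cmod (cinner (g x) (g y)) \<le> (N * norm x) * (N * norm y)"
            using order_trans[OF cauchy_schwarz mult_mono[OF gn gn]] N(1) by simp
          then show ?thesis
            by (simp add: power2_eq_square mult_ac)
        qed
        moreover have "(norm x)\<^sup>2 / N\<^sup>2 \<le> Re (cinner (g x) (g x))" if "g \<in> G" for g x
        proof -
          have "g (g x) = x"
            using arg_cong[OF inv[OF that], of "\<lambda>T. blinfun_apply T x"] by simp
          then have "norm x \<le> N * norm (g x)"
            using order_trans[OF norm_blinfun[of g "g x"] mult_right_mono[OF N(2)[OF that] norm_ge_zero]] by simp
          then have "(norm x)\<^sup>2 \<le> N\<^sup>2 * (norm (g x))\<^sup>2"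
            using power_mono[of "norm x" "N * norm (g x)" 2] by (simp add: power_mult_distrib)
          then show ?thesis
            using N(1) by (simp add: norm_square_cinner[symmetric] divide_le_eq mult.commute)
        qed
        ultimately show ?thesis
          unfolding H_def mem_Collect_eq prod.case
          by (intro conjI allI ballI cinner_add_left cinner_scaleC_left cinner_commute)
      qed
      then show ?case by auto
    next
      case (insert h F)
      then obtain B where B: "B \<in> H" "\<And>g. g \<in> F \<Longrightarrow> B \<in> I g" by auto
      have h: "h \<in> G" "h \<in> bounded_operators"
        using insert.prems G(1) by auto
      \<comment> \<open>The average over the group generated by h. Invariance under h uses that h is
        an involution, invariance under the earlier elements that they commute with h.\<close>
      define B' where "B' = (\<lambda>(x, y). (B (x, y) + B (h x, h y)) / 2)"
      have hh: "h (h x) = x" for x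
        using arg_cong[OF inv[OF h(1)], of "\<lambda>T. blinfun_apply T x"] by simp
      have "B' \<in> H"
      proof -
        have add: "B' (x + y, z) = B' (x, z) + B' (y, z)" for x y z
          by (simp add: B'_def blinfun.add_right HD(1)[OF B(1)] add_divide_distrib)
        have scale: "B' (c *\<^sub>C x, y) = c * B' (x, y)" for c x y
          by (simp add: B'_def bounded_operatorsD[OF h(2)] HD(2)[OF B(1)] distrib_left)
        have herm: "B' (x, y) = cnj (B' (y, x))" for x y
        proof -
          have "B (x, y) = cnj (B (y, x))" "B (h x, h y) = cnj (B (h y, h x))"
            by (rule HD(3)[OF B(1)])+
          then show ?thesis
            by (simp add: B'_def)
        qed
        have bb: "cmod (B' (g x, g y)) \<le> N\<^sup>2 * norm x * norm y" and lb: "(norm x)\<^sup>2 / N\<^sup>2 \<le> Re (B' (g x, g x))"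
          if "g \<in> G" for g x y
        proof -
          have hg: "h o\<^sub>L g \<in> G"
            using mult h(1) that by blast
          have 1: "cmod (B (g x, g y)) \<le> N\<^sup>2 * norm x * norm y" "(norm x)\<^sup>2 / N\<^sup>2 \<le> Re (B (g x, g x))"
            using HD(4,5)[OF B(1) that] by blast+
          have 2: "cmod (B ((h o\<^sub>L g) x, (h o\<^sub>L g) y)) \<le> N\<^sup>2 * norm x * norm y"
            "(norm x)\<^sup>2 / N\<^sup>2 \<le> Re (B ((h o\<^sub>L g) x, (h o\<^sub>L g) x))"
            using HD(4,5)[OF B(1) hg] by blast+
          show "cmod (B' (g x, g y)) \<le> N\<^sup>2 * norm x * norm y"
            using 1(1) 2(1) norm_triangle_ineq[of "B (g x, g y)" "B (h (g x), h (g y))"]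
            by (simp add: B'_def norm_divide)
          show "(norm x)\<^sup>2 / N\<^sup>2 \<le> Re (B' (g x, g x))"
            using add_mono[OF 1(2) 2(2)] by (simp add: B'_def mult.commute)
        qed
        show ?thesis
          unfolding H_def using add scale herm bb lb by blast
      qed
      moreover have "B' \<in> I h"
        by (simp add: I_def B'_def hh add.commute)
      moreover have "B' \<in> I g" if g: "g \<in> F" for g
      proof -
        have "h (g x) = g (h x)" for x
          using arg_cong[OF comm[of h g], of "\<lambda>T. blinfun_apply T x"] h(1) g insert.prems by auto
        then show ?thesis
          using B(2)[OF g] by (simp add: I_def B'_def)
      qed
      ultimately show ?case by auto
    qed
  qed
  then obtain B where B: "B \<in> H" "\<And>g. g \<in> G \<Longrightarrow> B \<in> I g" by auto
  have herm: "B (x, y) = cnj (B (y, x))" for x y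
    by (rule HD(3)[OF B(1)])
  have add: "B (x + y, z) = B (x, z) + B (y, z)" and scale: "B (c *\<^sub>C x, y) = c * B (x, y)" for x y z c
    by (rule HD[OF B(1)])+
  have Bd: "cmod (B (x, y)) \<le> N\<^sup>2 * norm x * norm y" and Bl: "(norm x)\<^sup>2 / N\<^sup>2 \<le> Re (B (x, x))" for x y
    using HD(4,5)[OF B(1) G(2)] by simp_all
  have "\<exists>Q\<in>bounded_operators. (\<forall>x y. B (x, y) = cinner (blinfun_apply Q x) y) \<and> norm Q \<le> \<bar>N\<^sup>2\<bar>"
  proof (rule sesquilinear_representation[of "\<lambda>x y. B (x, y)"])
    show "B (x, y + z) = B (x, y) + B (x, z)" for x y z
      using herm add by (metis complex_cnj_add)
    show "B (x, c *\<^sub>C y) = cnj c * B (x, y)" for c x y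
      using herm scale by (metis complex_cnj_mult)
  qed (rule add scale Bd)+
  then obtain Q where Q: "Q \<in> bounded_operators" "\<And>x y. B (x, y) = cinner (blinfun_apply Q x) y"
    by blast
  have adj: "cinner (Q x) y = cinner x (Q y)" for x y
    by (metis herm Q(2) cinner_commute)
  \<comment> \<open>Since S is self-adjoint with S^2 = c Q, the inner product of S x and S y is c
    times the invariant form. An involution that preserves the form is symmetric for it, so its
    conjugate by S is self-adjoint.\<close>
  have "\<exists>c>0. \<exists>S R. inverse_operators S R \<and>
    (\<forall>x y. cinner (blinfun_apply S x) y = cinner x (blinfun_apply S y)) \<and> (\<forall>x. blinfun_apply S (blinfun_apply S x) = c *\<^sub>R blinfun_apply Q x)"
  proof (rule ex_positive_square_root[OF Q(1) adj])
    show "0 < 1 / N\<^sup>2"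
      using N(1) by simp
    show "1 / N\<^sup>2 * (norm x)\<^sup>2 \<le> Re (cinner (Q x) x)" for x
      using Bl[of x] by (simp add: Q(2))
  qed
  then obtain c S R where c: "c > 0" and SR: "inverse_operators S R"
    and Sadj: "\<And>x y. cinner (blinfun_apply S x) y = cinner x (blinfun_apply S y)"
    and SS: "\<And>x. blinfun_apply S (blinfun_apply S x) = c *\<^sub>R blinfun_apply Q x"
    by blast
  have "cinner ((S o\<^sub>L g o\<^sub>L R) x) y = cinner x ((S o\<^sub>L g o\<^sub>L R) y)" if g: "g \<in> G" for g x y
  proof -
    have SRx: "S (R x) = x" for x
      by (rule inverse_operatorsD[OF SR])
    have gg: "g (g u) = u" for u
      using arg_cong[OF inv[OF g], of "\<lambda>T. blinfun_apply T u"] by simp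
    have Bg: "B (g u, v) = B (u, g v)" for u v
      using B(2)[OF g] gg by (simp add: I_def) metis
    have "cinner (S (g u)) (S v) = cinner (S u) (S (g v))" for u v
    proof -
      have "cinner (S (g u)) (S v) = cinner (S (S (g u))) v"
        by (simp add: Sadj)
      also have "\<dots> = complex_of_real c * B (g u, v)"
        by (simp add: SS cinner.scaleR_left Q(2) scaleR_conv_of_real)
      also have "\<dots> = cinner (S (S u)) (g v)"
        unfolding Bg by (simp add: SS cinner.scaleR_left Q(2) scaleR_conv_of_real)
      also have "\<dots> = cinner (S u) (S (g v))"
        by (simp add: Sadj)
      finally show ?thesis .
    qed
    from this[of "R x" "R y"] show ?thesis
      by (simp add: SRx)
  qed
  with SR show ?thesis by blast
qed

context crp_algebra
begin

theorem central_idempotents_similar_self_adjoint: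
  "\<exists>S R. inverse_operators S R \<and>
    (\<forall>q\<in>Z. \<forall>x y. cinner (blinfun_apply (S o\<^sub>L q o\<^sub>L R) x) y = cinner x (blinfun_apply (S o\<^sub>L q o\<^sub>L R) y))"
proof -
  \<comment> \<open>Idempotents are replaced by the involutions 2q - 1, which form a group.\<close>
  define G where "G = (\<lambda>q. 2 *\<^sub>R q - id_blinfun) ` Z"
  obtain K where K: "\<And>q. q \<in> Z \<Longrightarrow> norm q \<le> K"
    using Z_bounded by blast
  have qb: "q \<in> bounded_operators" if "q \<in> Z" for q
    using that by (auto simp: Z_def commutant_def)
  have qq: "q (q x) = q x" if "q \<in> Z" for q x
  proof -
    have "q o\<^sub>L q = q"
      using that by (simp add: Z_def)
    from arg_cong[OF this, of "\<lambda>T. blinfun_apply T x"] show ?thesis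
      by simp
  qed
  have qr: "q (r x) = r (q x)" if "q \<in> Z" "r \<in> Z" for q r x
    using that by (intro commutantD(2)[where D = "commutant A"]) (auto simp: Z_def)
  have id: "id_blinfun \<in> Z"
    by (auto simp: Z_def intro!: blinfun_eqI)
  have "\<exists>S R. inverse_operators S R \<and>
    (\<forall>g\<in>G. \<forall>x y. cinner (blinfun_apply (S o\<^sub>L g o\<^sub>L R) x) y = cinner x (blinfun_apply (S o\<^sub>L g o\<^sub>L R) y))"
  proof (rule similar_to_self_adjoint_involutions)
    show "G \<subseteq> bounded_operators"
      using qb by (auto simp: G_def)
    show "id_blinfun \<in> G"
      unfolding G_def by (rule image_eqI[OF _ id]) (simp add: scaleR_2)
    show "g o\<^sub>L h = h o\<^sub>L g" if "g \<in> G" "h \<in> G" for g h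
      using that qr by (auto simp: G_def blinfun.bilinear_simps algebra_simps intro!: blinfun_eqI)
    show "g o\<^sub>L g = id_blinfun" if "g \<in> G" for g
      using that qq by (auto simp: G_def blinfun.bilinear_simps scaleR_2 intro!: blinfun_eqI)
    show "norm g \<le> 2 * K + norm (id_blinfun :: 'a \<Rightarrow>\<^sub>L 'a)" if g: "g \<in> G" for g
    proof -
      obtain q where q: "q \<in> Z" "g = 2 *\<^sub>R q - id_blinfun"
        using g by (auto simp: G_def)
      show ?thesis
        using norm_triangle_ineq4[of "2 *\<^sub>R q" id_blinfun] K[OF q(1)] unfolding q(2) by simp
    qed
    show "g o\<^sub>L h \<in> G" if gh: "g \<in> G" "h \<in> G" for g h
    proof -
      obtain q r where q: "q \<in> Z" "g = 2 *\<^sub>R q - id_blinfun" and r: "r \<in> Z" "h = 2 *\<^sub>R r - id_blinfun"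
        using gh by (auto simp: G_def)
      \<comment> \<open>The solution p of (2q - 1)(2r - 1) = 2p - 1.\<close>
      let ?p = "2 *\<^sub>R (q o\<^sub>L r) - q - r + id_blinfun"
      have "?p o\<^sub>L ?p = ?p"
        by (rule blinfun_eqI) (simp add: blinfun.bilinear_simps qq q(1) r(1) qr[OF r(1) q(1)] scaleR_2)
      moreover have "?p \<in> commutant A" "?p \<in> commutant (commutant A)"
        using q(1) r(1) unfolding Z_def by auto
      ultimately have "?p \<in> Z"
        by (simp add: Z_def)
      moreover have "g o\<^sub>L h = 2 *\<^sub>R ?p - id_blinfun"
        unfolding q(2) r(2) by (rule blinfun_eqI) (simp add: blinfun.bilinear_simps scaleR_2 algebra_simps)
      ultimately show ?thesis
        by (auto simp: G_def)
    qed
  qed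
  then obtain S R where SR: "inverse_operators S R"
    and sa: "\<And>g x y. g \<in> G \<Longrightarrow> cinner (blinfun_apply (S o\<^sub>L g o\<^sub>L R) x) y = cinner x (blinfun_apply (S o\<^sub>L g o\<^sub>L R) y)"
    by blast
  have SRx: "S (R x) = x" for x
    by (rule inverse_operatorsD[OF SR])
  have "cinner (blinfun_apply (S o\<^sub>L q o\<^sub>L R) x) y = cinner x (blinfun_apply (S o\<^sub>L q o\<^sub>L R) y)" if q: "q \<in> Z" for q x y
  proof -
    have "2 *\<^sub>R q - id_blinfun \<in> G"
      using q by (auto simp: G_def)
    from sa[OF this, of x y] show ?thesis
      by (simp add: blinfun.bilinear_simps SRx cinner.diff_left cinner.diff_right cinner.scaleR_left cinner.scaleR_right)
  qed
  with SR show ?thesis by blast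
qed

end

section \<open>Joint eigenvectors\<close>

lemma compact_closed_subset:
  fixes S K :: "'x::t2_space set"
  assumes "compact K" "closed S" "S \<subseteq> K"
  shows "compact S"
  using compact_Int_closed[OF assms(1,2)] assms(3) by (simp add: Int_absorb1)

text \<open>These are the unit vectors at which k attains its norm. They are described by an
  eigenvalue equation because this condition is linear and survives projections that commute with k
  and its adjoint.\<close>

lemma sphere_max_vector:
  fixes k :: "'a::complex_hilbert_space \<Rightarrow>\<^sub>L 'a"
  assumes k: "k \<in> compact_operators" "k \<noteq> 0"
  defines "h \<equiv> cadj k o\<^sub>L k"
  shows "\<exists>x. norm x = 1 \<and> blinfun_apply h x = (norm k)\<^sup>2 *\<^sub>R x"
    and "compact {x. norm x = 1 \<and> blinfun_apply h x = (norm k)\<^sup>2 *\<^sub>R x}"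
proof -
  have kb: "k \<in> bounded_operators"
    using k(1) by (simp add: compact_operators_def)
  obtain K0 where K0: "compact K0" "blinfun_apply k ` cball 0 1 \<subseteq> K0"
    using compact_operators_image[OF k(1)] by blast
  \<comment> \<open>Up to an error tending to 0, a maximising sequence equals its image under h
    divided by the square of the norm of k, and those images lie in the compact set K.\<close>
  define K where "K = (\<lambda>y. (1 / (norm k)\<^sup>2) *\<^sub>R blinfun_apply (cadj k) y) ` K0"
  have K: "compact K"
    unfolding K_def by (intro compact_continuous_image continuous_intros K0)
  have hK: "(1 / (norm k)\<^sup>2) *\<^sub>R h x \<in> K" if "norm x \<le> 1" for x
    unfolding K_def h_def using K0(2) that by (auto simp: image_subset_iff)
  have k0: "norm k > 0"
    using k(2) by simp
  have "\<exists>x. norm x = 1 \<and> norm (k x) > norm k - norm k / real (Suc n)" for n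
  proof (rule ccontr)
    assume no: "\<nexists>x. norm x = 1 \<and> norm (k x) > norm k - norm k / real (Suc n)"
    have le: "norm k / real (Suc n) \<le> norm k"
      using k0 by (simp add: divide_le_eq)
    have "norm k \<le> norm k - norm k / real (Suc n)"
    proof (rule norm_blinfun_bound)
      fix x
      show "norm (k x) \<le> (norm k - norm k / real (Suc n)) * norm x"
      proof (cases "x = 0")
        case False
        then have "norm ((1 / norm x) *\<^sub>R x) = 1"
          by simp
        then have "norm (k ((1 / norm x) *\<^sub>R x)) \<le> norm k - norm k / real (Suc n)"
          using no not_le by blast
        with False show ?thesis
          by (simp add: blinfun.scaleR_right divide_le_eq)
      qed simp
    qed (use le in simp)
    moreover have "0 < norm k / real (Suc n)"
      using k0 by simp
    ultimately show False by linarith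
  qed
  then obtain x where x: "\<And>n. norm (x n) = 1" "\<And>n. norm (k (x n)) > norm k - norm k / real (Suc n)"
    by metis
  have lim: "(\<lambda>n. h (x n) - (norm k)\<^sup>2 *\<^sub>R x n) \<longlonglongrightarrow> 0"
  proof (rule Lim_null_comparison)
    \<comment> \<open>The bound comes from expanding the square: the norm of h x is at most the
      square of the norm of k, and the inner product of h x with x is the square of the norm of k
      x.\<close>
    let ?b = "\<lambda>n. sqrt (2 * (norm k)^4 - 2 * (norm k)\<^sup>2 * (norm k - norm k / real (Suc n))\<^sup>2)"
    show "\<forall>\<^sub>F n in sequentially. norm (h (x n) - (norm k)\<^sup>2 *\<^sub>R x n) \<le> ?b n"
    proof (intro always_eventually allI real_le_rsqrt)
      fix n
      have "norm (h (x n)) \<le> norm k * norm (k (x n))"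
        unfolding h_def using order_trans[OF norm_blinfun mult_right_mono[OF cadj(4)[OF kb] norm_ge_zero]] by simp
      also have "\<dots> \<le> norm k * norm k"
        using norm_blinfun[of k "x n"] x(1)[of n] by (intro mult_left_mono) auto
      finally have "(norm (h (x n)))\<^sup>2 \<le> (norm k * norm k)\<^sup>2"
        by (intro power_mono) auto
      moreover have "(norm k - norm k / real (Suc n))\<^sup>2 \<le> (norm (k (x n)))\<^sup>2"
        using x(2)[of n] k0 by (intro power_mono) (auto simp: divide_le_eq)
      then have "(norm k)\<^sup>2 * (norm k - norm k / real (Suc n))\<^sup>2 \<le> (norm k)\<^sup>2 * (norm (k (x n)))\<^sup>2"
        by (intro mult_left_mono) auto
      moreover have "Re (cinner (h (x n)) ((norm k)\<^sup>2 *\<^sub>R x n)) = (norm k)\<^sup>2 * (norm (k (x n)))\<^sup>2"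
        by (simp add: h_def cinner.scaleR_right cadj(3)[OF kb] norm_square_cinner)
      moreover have "(norm ((norm k)\<^sup>2 *\<^sub>R x n))\<^sup>2 = (norm k * norm k)\<^sup>2"
        using x(1)[of n] by (simp add: power2_eq_square)
      moreover have "(norm k * norm k)\<^sup>2 = (norm k)^4"
        by (simp add: power2_eq_square power4_eq_xxxx)
      ultimately show "(norm (h (x n) - (norm k)\<^sup>2 *\<^sub>R x n))\<^sup>2
          \<le> 2 * (norm k)^4 - 2 * (norm k)\<^sup>2 * (norm k - norm k / real (Suc n))\<^sup>2"
        unfolding norm_square_diff by linarith
    qed
    have "(\<lambda>n. norm k / real (Suc n)) \<longlonglongrightarrow> 0"
      using tendsto_mult_right_zero[OF LIMSEQ_inverse_real_of_nat, of "norm k"] by (simp add: divide_inverse)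
    then have "?b \<longlonglongrightarrow> sqrt (2 * (norm k)^4 - 2 * (norm k)\<^sup>2 * (norm k - 0)\<^sup>2)"
      by (intro tendsto_intros)
    then show "?b \<longlonglongrightarrow> 0"
      by (simp add: power2_eq_square power4_eq_xxxx)
  qed
  have "(1 / (norm k)\<^sup>2) *\<^sub>R h (x n) \<in> K" for n
    by (rule hK) (simp add: x)
  then obtain y \<sigma> where y: "y \<in> K" "strict_mono \<sigma>" "(\<lambda>n. (1 / (norm k)\<^sup>2) *\<^sub>R h (x (\<sigma> n))) \<longlonglongrightarrow> y"
    using K[unfolded compact_eq_seq_compact_metric seq_compact_def, rule_format,
        of "\<lambda>n. (1 / (norm k)\<^sup>2) *\<^sub>R h (x n)"] by (auto simp: o_def)
  have "(\<lambda>n. h (x (\<sigma> n)) - (norm k)\<^sup>2 *\<^sub>R x (\<sigma> n)) \<longlonglongrightarrow> 0"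
    using LIMSEQ_subseq_LIMSEQ[OF lim y(2)] by (simp add: o_def)
  from tendsto_diff[OF y(3) tendsto_scaleR[OF tendsto_const this, of "1 / (norm k)\<^sup>2"]]
  have xy: "(\<lambda>n. x (\<sigma> n)) \<longlonglongrightarrow> y"
    using k0 by (simp add: scaleR_diff_right)
  have "norm y = 1"
    using LIMSEQ_unique[OF tendsto_norm[OF xy]] x(1) by simp
  moreover have "h y = (norm k)\<^sup>2 *\<^sub>R y"
  proof -
    have "(\<lambda>n. h (x (\<sigma> n))) \<longlonglongrightarrow> h y"
      by (intro tendsto_intros xy)
    moreover have "(\<lambda>n. (norm k)\<^sup>2 *\<^sub>R ((1 / (norm k)\<^sup>2) *\<^sub>R h (x (\<sigma> n)))) \<longlonglongrightarrow> (norm k)\<^sup>2 *\<^sub>R y"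
      by (intro tendsto_intros y(3))
    ultimately show ?thesis
      using k0 LIMSEQ_unique by simp
  qed
  ultimately show "\<exists>x. norm x = 1 \<and> blinfun_apply h x = (norm k)\<^sup>2 *\<^sub>R x"
    by blast
  have "{x. norm x = 1 \<and> h x = (norm k)\<^sup>2 *\<^sub>R x} \<subseteq> K"
  proof
    fix x assume "x \<in> {x. norm x = 1 \<and> h x = (norm k)\<^sup>2 *\<^sub>R x}"
    then have "norm x \<le> 1" "(1 / (norm k)\<^sup>2) *\<^sub>R h x = x"
      using k0 by simp_all
    then show "x \<in> K"
      using hK by metis
  qed
  moreover have "closed {x. norm x = 1 \<and> h x = (norm k)\<^sup>2 *\<^sub>R x}"
    by (intro closed_Collect_conj closed_Collect_eq continuous_intros)
  ultimately show "compact {x. norm x = 1 \<and> h x = (norm k)\<^sup>2 *\<^sub>R x}"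
    by (intro compact_closed_subset[OF K])
qed

lemma finite_chain_has_least:
  assumes "finite F" "F \<noteq> {}" "\<And>U V. U \<in> F \<Longrightarrow> V \<in> F \<Longrightarrow> U \<subseteq> V \<or> V \<subseteq> U"
  shows "\<Inter>F \<in> F"
  using assms
proof (induction F rule: finite_ne_induct)
  case (insert U F)
  then have "\<Inter>F \<in> F" by blast
  then have "U \<subseteq> \<Inter>F \<or> \<Inter>F \<subseteq> U"
    using insert.prems by blast
  then have "\<Inter>(insert U F) = U \<or> \<Inter>(insert U F) = \<Inter>F"
    by auto
  with \<open>\<Inter>F \<in> F\<close> show ?case by auto
qed simp

section \<open>Subspaces invariant under the commutant\<close>

definition invariant :: "('a::complex_hilbert_space \<Rightarrow>\<^sub>L 'a) set \<Rightarrow> 'a set \<Rightarrow> bool"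
  where "invariant B U \<longleftrightarrow> csubspace U \<and> closed U \<and> (\<forall>T\<in>B. \<forall>x\<in>U. blinfun_apply T x \<in> U)"

lemma invariantD:
  assumes "invariant B U"
  shows "csubspace U" "closed U" "T \<in> B \<Longrightarrow> x \<in> U \<Longrightarrow> blinfun_apply T x \<in> U"
  using assms by (auto simp: invariant_def)

lemma invariant_Inter: "(\<And>U. U \<in> F \<Longrightarrow> invariant B U) \<Longrightarrow> invariant B (\<Inter>F)"
  unfolding invariant_def by (auto intro!: complex_vector.subspace_Inter closed_Inter)

lemma invariant_Int: "invariant B U \<Longrightarrow> invariant B V \<Longrightarrow> invariant B (U \<inter> V)"
  unfolding invariant_def by (auto intro!: complex_vector.subspace_inter)

lemma invariant_eigenspace:
  assumes "B \<subseteq> bounded_operators" "a \<in> commutant B"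
  shows "invariant B {x. blinfun_apply a x = c *\<^sub>C x}"
proof -
  have "{x. blinfun_apply a x = c *\<^sub>C x} = {x. blinfun_apply a x = blinfun_apply (scaleC_op c id_blinfun) x}"
    by simp
  moreover have "a \<in> bounded_operators"
    using assms(2) commutantD by blast
  ultimately show ?thesis
    unfolding invariant_def using csubspace_eq_set[of a "scaleC_op c id_blinfun"] closed_eq_set[of a "scaleC_op c id_blinfun"]
      commutantD(2)[OF assms(2)] assms(1)
    by (auto simp: bounded_operatorsD subset_iff)
qed

text \<open>The situation after Dixmier's similarity.\<close>

locale reducing_algebra =
  fixes A :: "('a::complex_hilbert_space \<Rightarrow>\<^sub>L 'a) set"
  assumes A: "A \<subseteq> bounded_operators" and abel: "abelian A"
    and red: "\<And>U. invariant (commutant A) U \<Longrightarrow> invariant (commutant A) (orth U)"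
    and nondeg: "acts_nondegenerately (commutant A \<inter> compact_operators)"
begin

abbreviation "B \<equiv> commutant A"

lemma AB: "A \<subseteq> B"
  using A abel by (auto simp: commutant_def abelian_def)

lemma B_bounded: "B \<subseteq> bounded_operators"
  by (auto simp: commutant_def)

lemma A_BB: "A \<subseteq> commutant B"
  using A by (rule subset_commutant_commutant)

lemma cproj_commutes:
  assumes U: "invariant B U" and T: "T \<in> B"
  shows "blinfun_apply T (blinfun_apply (cproj U) x) = blinfun_apply (cproj U) (blinfun_apply T x)"
proof (rule cproj_unique[OF invariantD(1,2)[OF U], symmetric])
  note P = cproj[OF invariantD(1,2)[OF U]]
  show "T (cproj U x) \<in> U"
    using invariantD(3)[OF U T P(2)] .
  show "T x - T (cproj U x) \<in> orth U"
    using invariantD(3)[OF red[OF U] T P(3)] by (simp add: blinfun.diff_right)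
qed

lemma cproj_commutant:
  assumes U: "invariant B U"
  shows "cproj U \<in> commutant B" "cproj U \<in> B"
proof -
  show "cproj U \<in> commutant B"
    by (rule commutantI) (simp_all add: cproj(1)[OF invariantD(1,2)[OF U]] cproj_commutes[OF U])
  then show "cproj U \<in> B"
    using commutant_antimono[OF AB] by blast
qed

definition E where "E = {x. \<forall>a\<in>A. \<exists>c. blinfun_apply a x = c *\<^sub>C x}"

lemma E_invariant:
  assumes "T \<in> B" "x \<in> E" shows "blinfun_apply T x \<in> E"
proof -
  have "\<exists>c. a (T x) = c *\<^sub>C T x" if a: "a \<in> A" for a
  proof -
    obtain c where "a x = c *\<^sub>C x"
      using assms(2) a by (auto simp: E_def)
    then have "a (T x) = c *\<^sub>C T x"
      using commutantD(2)[OF assms(1) a, of x] bounded_operatorsD[OF commutantD(1)[OF assms(1)]] by simp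
    then show ?thesis by blast
  qed
  then show ?thesis by (simp add: E_def)
qed

lemma invariant_closed_span_E: "invariant B (closure (cspan E))"
  unfolding invariant_def
proof (intro conjI ballI)
  fix T x assume T: "T \<in> B" and x: "x \<in> closure (cspan E)"
  show "T x \<in> closure (cspan E)"
  proof (rule invariant_closed_cspan[OF commutantD(1)[OF T] _ x])
    fix y assume "y \<in> E"
    then show "T y \<in> closure (cspan E)"
      using E_invariant[OF T] by (intro subsetD[OF closure_subset] complex_vector.span_base)
  qed
qed (auto intro: csubspace_closure)

text \<open>Zorn's lemma is applied to invariant subspaces that meet the compact set S of
  norm-attaining unit vectors, since the intersection of a chain keeps a point of S, whereas
  subspaces that are merely nonzero could shrink to 0. A smaller invariant U1 reduces k and its
  adjoint. If a vector of S has a nonzero projection to U1, this is an eigenvector of h for the same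
  eigenvalue, and U1 meets S; otherwise the vector lies in \<open>orth U1\<close>, and minimality is
  applied to \<open>U \<inter> orth U1\<close>.\<close>

lemma minimal_invariant_subspace:
  assumes k: "k \<in> B" "k \<in> compact_operators" "k \<noteq> 0"
  shows "\<exists>U. invariant B U \<and> (\<exists>x\<in>U. blinfun_apply k x \<noteq> 0) \<and>
    (\<forall>U1. invariant B U1 \<longrightarrow> U1 \<subseteq> U \<longrightarrow> U1 = U \<or> U1 \<subseteq> {0})"
proof -
  define h where "h = cadj k o\<^sub>L k"
  have kb: "k \<in> bounded_operators"
    using k(1) commutantD(1) by blast
  have hb: "h \<in> bounded_operators"
    unfolding h_def by (intro bounded_operators_simps cadj kb)
  define S where "S = {x. norm x = 1 \<and> h x = (norm k)\<^sup>2 *\<^sub>R x}"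
  have S: "S \<noteq> {}" "compact S"
    using sphere_max_vector[OF k(2,3)] unfolding S_def h_def by auto
  define \<C> where "\<C> = {U. invariant B U \<and> S \<inter> U \<noteq> {}}"
  \<comment> \<open>Complements turn descending chains into the ascending ones of Zorn's
    lemma.\<close>
  have "\<exists>M\<in>uminus ` \<C>. \<forall>X\<in>uminus ` \<C>. M \<subseteq> X \<longrightarrow> X = M"
  proof (rule subset_Zorn')
    fix C assume C: "subset.chain (uminus ` \<C>) C"
    define D where "D = uminus ` C"
    have DC: "D \<subseteq> \<C>"
      using C unfolding D_def subset.chain_def by auto
    have ch: "U \<subseteq> V \<or> V \<subseteq> U" if "U \<in> D" "V \<in> D" for U V
    proof -
      have "- U \<in> C" "- V \<in> C"
        using that by (auto simp: D_def)
      then show ?thesis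
        using C unfolding subset.chain_def by blast
    qed
    have "S \<inter> (\<Inter>U\<in>D. U) \<noteq> {}"
    proof (rule compact_imp_fip_image[OF S(2)])
      show "closed U" if "U \<in> D" for U
        using that DC by (auto simp: \<C>_def invariant_def)
      fix F assume F: "finite F" "F \<subseteq> D"
      show "S \<inter> (\<Inter>U\<in>F. U) \<noteq> {}"
      proof (cases "F = {}")
        case False
        have "\<Inter>F \<in> F"
          by (rule finite_chain_has_least[OF F(1) False]) (use ch F(2) in blast)
        then show ?thesis
          using F(2) DC by (auto simp: \<C>_def)
      qed (use S in simp)
    qed
    moreover have "invariant B (\<Inter>D)"
      using DC by (intro invariant_Inter) (auto simp: \<C>_def)
    ultimately have "\<Inter>D \<in> \<C>"
      by (simp add: \<C>_def)
    moreover have "\<Union>C = - \<Inter>D"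
      by (auto simp: D_def)
    ultimately show "\<Union>C \<in> uminus ` \<C>"
      by blast
  qed
  then obtain U where U: "U \<in> \<C>" and minU: "\<And>X. X \<in> \<C> \<Longrightarrow> X \<subseteq> U \<Longrightarrow> X = U"
    by (auto simp: image_iff)
  have inv: "invariant B U"
    using U by (simp add: \<C>_def)
  obtain x where x: "x \<in> S" "x \<in> U"
    using U by (auto simp: \<C>_def)
  have in_C: "V \<in> \<C>" if V: "invariant B V" and y: "y \<in> V" "y \<noteq> 0" "h y = (norm k)\<^sup>2 *\<^sub>R y" for V y
  proof -
    have "(1 / norm y) *\<^sub>R y \<in> S \<inter> V"
      using y invariantD(1)[OF V] by (simp add: S_def blinfun.scaleR_right csubspace_scaleR)
    with V show ?thesis
      by (auto simp: \<C>_def)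
  qed
  have "U1 = U \<or> U1 \<subseteq> {0}" if U1: "invariant B U1" "U1 \<subseteq> U" for U1
  proof -
    note cl = invariantD(1,2)[OF U1(1)]
    define P where "P = cproj U1"
    have Pb: "P \<in> bounded_operators"
      unfolding P_def by (rule cproj(1)[OF cl])
    have Padj: "cinner (P u) v = cinner u (P v)" for u v
    proof -
      have "cinner (P u) (v - P v) = 0"
        using cproj(2)[OF cl, of u] cproj(3)[OF cl, of v] cinner_eq_zero_commute unfolding P_def orth_def by auto
      moreover have "cinner (u - P u) (P v) = 0"
        using cproj(2)[OF cl, of v] cproj(3)[OF cl, of u] unfolding P_def orth_def by auto
      ultimately show ?thesis
        by (simp add: cinner.diff_left cinner.diff_right)
    qed
    have Pk: "P (k u) = k (P u)" for u
      unfolding P_def by (rule cproj_commutes[OF U1(1) k(1), symmetric])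
    have Pk': "P (cadj k u) = cadj k (P u)" for u
      by (rule cinner_ext) (simp add: Padj cadj(3)[OF kb] Pk)
    have hP: "h (P u) = P (h u)" for u
      by (simp add: h_def Pk Pk')
    show ?thesis
    proof (cases "P x = 0")
      case False
      have "P x \<in> U1"
        unfolding P_def by (rule cproj(2)[OF cl])
      moreover have "h (P x) = (norm k)\<^sup>2 *\<^sub>R P x"
        using x(1) by (simp add: hP S_def blinfun.scaleR_right)
      ultimately have "U1 \<in> \<C>"
        using in_C[OF U1(1)] False by blast
      then show ?thesis
        using minU U1(2) by blast
    next
      case True
      then have "x \<in> orth U1"
        using cproj(3)[OF cl, of x] by (simp add: P_def)
      then have "U \<inter> orth U1 \<in> \<C>"
        using x invariant_Int[OF inv red[OF U1(1)]] by (auto simp: \<C>_def)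
      then have "U \<inter> orth U1 = U"
        using minU by blast
      then show ?thesis
        using U1(2) orth_disjoint by blast
    qed
  qed
  moreover have "k x \<noteq> 0"
    using x(1) k(3) by (auto simp: S_def h_def)
  ultimately show ?thesis
    using inv x(2) by blast
qed

theorem joint_eigenvectors_total: "closure (cspan E) = UNIV"
proof (rule ccontr)
  let ?V = "closure (cspan E)"
  note V = invariant_closed_span_E
  note cl = invariantD(1,2)[OF V]
  assume ne: "?V \<noteq> UNIV"
  have "\<exists>k\<in>B \<inter> compact_operators. \<exists>x. k x \<notin> ?V"
  proof (rule ccontr)
    assume "\<not> ?thesis"
    then have "{blinfun_apply T x | T x. T \<in> B \<inter> compact_operators} \<subseteq> ?V"
      by blast
    from closed_cspan_subset[OF cl this] show False
      using nondeg ne unfolding acts_nondegenerately_def by blast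
  qed
  then obtain k0 x0 where k0: "k0 \<in> B" "k0 \<in> compact_operators" "k0 x0 \<notin> ?V"
    by blast
  \<comment> \<open>The cut-down keeps k compact and in B, and makes its range orthogonal to all
    joint eigenvectors. The contradiction will be a vector u of U with k u nonzero, where U consists
    of joint eigenvectors and is invariant under k.\<close>
  define k where "k = (id_blinfun - cproj ?V) o\<^sub>L k0"
  have kB: "k \<in> B"
    unfolding k_def by (intro commutant_simps cproj_commutant(2)[OF V] k0(1))
  have k_orth: "k x \<in> orth ?V" for x
    using cproj(3)[OF cl] by (simp add: k_def blinfun.diff_left)
  have "k x0 \<noteq> 0"
    using k0(3) cproj(2)[OF cl, of "k0 x0"] by (auto simp: k_def blinfun.diff_left)
  then have kne: "k \<noteq> 0"
    by auto
  have kc: "k \<in> compact_operators"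
  proof -
    have "blinfun_apply k ` cball 0 1 \<subseteq> blinfun_apply (id_blinfun - cproj ?V) ` closure (blinfun_apply k0 ` cball 0 1)"
      unfolding k_def using closure_subset[of "blinfun_apply k0 ` cball 0 1"] by fastforce
    moreover have cc: "compact (blinfun_apply (id_blinfun - cproj ?V) ` closure (blinfun_apply k0 ` cball 0 1))"
      using k0(2) by (intro compact_continuous_image continuous_intros) (simp add: compact_operators_def)
    ultimately have "closure (blinfun_apply k ` cball 0 1)
        \<subseteq> blinfun_apply (id_blinfun - cproj ?V) ` closure (blinfun_apply k0 ` cball 0 1)"
      by (intro closure_minimal compact_imp_closed)
    with cc have "compact (closure (blinfun_apply k ` cball 0 1))"
      by (intro compact_closed_subset[OF cc]) auto
    then show ?thesis
      using kB commutantD(1) by (auto simp: compact_operators_def)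
  qed
  obtain U where U: "invariant B U" and kU: "\<exists>x\<in>U. k x \<noteq> 0"
    and min: "\<And>U1. invariant B U1 \<Longrightarrow> U1 \<subseteq> U \<Longrightarrow> U1 = U \<or> U1 \<subseteq> {0}"
    using minimal_invariant_subspace[OF kB kc kne] by blast
  obtain u where u: "u \<in> U" "k u \<noteq> 0"
    using kU by blast
  have trans: "U \<subseteq> closure {blinfun_apply T y | T. T \<in> B}" if y: "y \<in> U" "y \<noteq> 0" for y
  proof -
    let ?W = "closure {blinfun_apply T y | T. T \<in> B}"
    have "csubspace {blinfun_apply T y | T. T \<in> B}"
    proof (rule complex_vector.subspaceI)
      show "0 \<in> {blinfun_apply T y | T. T \<in> B}"
        by (auto intro!: exI[of _ 0])
      show "u + v \<in> {blinfun_apply T y | T. T \<in> B}"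
        if "u \<in> {blinfun_apply T y | T. T \<in> B}" "v \<in> {blinfun_apply T y | T. T \<in> B}" for u v
        using that by (auto simp: blinfun.add_left[symmetric])
      show "c *\<^sub>C u \<in> {blinfun_apply T y | T. T \<in> B}" if u: "u \<in> {blinfun_apply T y | T. T \<in> B}" for c u
      proof -
        obtain T where "T \<in> B" "u = T y"
          using u by blast
        then show ?thesis
          using A by (intro CollectI exI[of _ "scaleC_op c T"]) auto
      qed
    qed
    then have "csubspace ?W"
      by (rule csubspace_closure)
    moreover have "T x \<in> ?W" if T: "T \<in> B" and x: "x \<in> ?W" for T x
    proof -
      have "{blinfun_apply T y | T. T \<in> B} \<subseteq> blinfun_apply T -` ?W"
      proof
        fix z assume "z \<in> {blinfun_apply T y | T. T \<in> B}"
        then obtain S where S: "S \<in> B" "z = S y" by blast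
        have "(T o\<^sub>L S) y \<in> {blinfun_apply T y | T. T \<in> B}"
          using T S(1) by blast
        then show "z \<in> blinfun_apply T -` ?W"
          using S(2) closure_subset by fastforce
      qed
      moreover have "closed (blinfun_apply T -` ?W)"
        by (intro closed_vimage continuous_intros) simp
      ultimately show ?thesis
        using x closure_minimal by blast
    qed
    ultimately have W: "invariant B ?W"
      by (simp add: invariant_def)
    have "{blinfun_apply T y | T. T \<in> B} \<subseteq> U"
      using invariantD(3)[OF U _ y(1)] by blast
    then have "?W \<subseteq> U"
      using invariantD(2)[OF U] by (rule closure_minimal)
    moreover have "id_blinfun y \<in> {blinfun_apply T y | T. T \<in> B}"
      by blast
    then have "y \<in> ?W"
      using closure_subset by fastforce
    ultimately show ?thesis
      using min[OF W] y(2) by blast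
  qed
  have "\<exists>T\<in>B. \<exists>x\<in>U. x \<noteq> 0 \<and> T (k x) = x"
    by (rule lomonosov[OF _ _ _ invariantD[OF U] kc invariantD(3)[OF U kB] trans u]) auto
  then obtain T x1 where T: "T \<in> B" and x1: "x1 \<in> U" "x1 \<noteq> 0" "T (k x1) = x1"
    by blast
  have "U \<subseteq> E"
  proof
    fix x assume x: "x \<in> U"
    have "\<exists>c. a x = c *\<^sub>C x" if a: "a \<in> A" for a
    proof -
      \<comment> \<open>The fixed vectors of T k in U are invariant under a, because T and k commute
        with it, and their unit ball lies in a compact image, so a has an eigenvector there. Its
        eigenspace in U is invariant under B, hence all of U by minimality.\<close>
      let ?F = "U \<inter> {x. (T o\<^sub>L k) x = id_blinfun x}"
      have "csubspace ?F"
        by (intro complex_vector.subspace_inter invariantD(1)[OF U] csubspace_eq_set)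
          (use T kB commutantD(1) in auto)
      moreover have "compact (blinfun_apply T ` closure (blinfun_apply k ` cball 0 1))"
        using kc by (intro compact_continuous_image continuous_intros) (simp add: compact_operators_def)
      moreover have "?F \<inter> cball 0 1 \<subseteq> blinfun_apply T ` closure (blinfun_apply k ` cball 0 1)"
      proof
        fix z assume z: "z \<in> ?F \<inter> cball 0 1"
        show "z \<in> blinfun_apply T ` closure (blinfun_apply k ` cball 0 1)"
        proof (rule image_eqI)
          show "z = T (k z)"
            using z by simp
          show "k z \<in> closure (blinfun_apply k ` cball 0 1)"
            using z by (intro subsetD[OF closure_subset] imageI) simp
        qed
      qed
      moreover have "a z \<in> ?F" if z: "z \<in> ?F" for z
      proof -
        have "T (k (a z)) = a (T (k z))"
          using commutantD(2)[OF T a] commutantD(2)[OF kB a] by simp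
        with z show ?thesis
          using invariantD(3)[OF U subsetD[OF AB a]] by simp
      qed
      moreover have "a \<in> bounded_operators" "x1 \<in> ?F"
        using A a x1 by auto
      ultimately obtain c z where z: "z \<in> ?F" "z \<noteq> 0" "a z = c *\<^sub>C z"
        using invariant_compact_ball_eigenvector[of ?F _ a x1] x1(2) by blast
      have "invariant B (U \<inter> {x. a x = c *\<^sub>C x})"
        by (intro invariant_Int U invariant_eigenspace B_bounded subsetD[OF A_BB a])
      from min[OF this] have "U \<inter> {x. a x = c *\<^sub>C x} = U"
        using z by blast
      then show ?thesis
        using x by blast
    qed
    then show "x \<in> E"
      by (simp add: E_def)
  qed
  then have "k u \<in> ?V"
    using invariantD(3)[OF U kB u(1)] complex_vector.span_superset closure_subset by blast
  then show False
    using k_orth[of u] orth_disjoint u(2) by blast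
qed

end

section \<open>Bicommutants\<close>

text \<open>Without a unit in A the double commutant can be too large: an operator approximated by A
  must vanish wherever all of A does.\<close>

definition essential_bicommutant :: "('a::complex_hilbert_space \<Rightarrow>\<^sub>L 'a) set \<Rightarrow> ('a \<Rightarrow>\<^sub>L 'a) set"
  where "essential_bicommutant A =
    {T \<in> commutant (commutant A). \<forall>x. (\<forall>a\<in>A. blinfun_apply a x = 0) \<longrightarrow> blinfun_apply T x = 0}"

lemma closed_commutant: "closed (commutant D)"
proof -
  have "commutant D = bounded_operators \<inter> (\<Inter>S\<in>D. {T. T o\<^sub>L S = S o\<^sub>L T})"
    by (auto simp: commutant_def)
  also have "closed \<dots>"
    by (intro closed_Int closed_INT ballI closed_bounded_operators closed_Collect_eq continuous_intros
        bounded_bilinear.continuous_on[OF bounded_bilinear_blinfun_compose])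
  finally show ?thesis .
qed

lemma commutant_bounded: "commutant D \<subseteq> bounded_operators"
  by (auto simp: commutant_def)

lemma subalgebra_bicommutant: "subalgebra (commutant (commutant A))"
  by (auto simp: subalgebra_def commutant_bounded dest: commutantD(1))

lemma subalgebra_essential_bicommutant: "subalgebra (essential_bicommutant A)"
  by (auto simp: subalgebra_def essential_bicommutant_def commutant_bounded blinfun.add_left dest: commutantD(1))

lemma closed_essential_bicommutant: "closed (essential_bicommutant A)"
proof -
  have "essential_bicommutant A = commutant (commutant A) \<inter>
      (\<Inter>x\<in>{x. \<forall>a\<in>A. blinfun_apply a x = 0}. {T. blinfun_apply T x = 0})"
    by (auto simp: essential_bicommutant_def)
  also have "closed \<dots>"
    by (intro closed_Int closed_INT ballI closed_commutant closed_Collect_eq continuous_intros)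
  finally show ?thesis .
qed

context reducing_algebra
begin

text \<open>Y is the joint eigenspace with the eigenvalues of x. It reduces A, so a rank-one
  operator given by two vectors of Y lies in B; commuting with all of these forces T, and also its
  adjoint, to be scalar on Y.\<close>

lemma bicommutant_scalar_on_eigenspace:
  assumes T: "T \<in> commutant B" and x: "x \<in> E" "x \<noteq> 0"
  shows "\<exists>c Y. invariant B Y \<and> x \<in> Y \<and> (\<forall>y\<in>Y. blinfun_apply T y = c *\<^sub>C y \<and> blinfun_apply (cadj T) y = cnj c *\<^sub>C y)"
proof -
  have "\<forall>a\<in>A. \<exists>c. blinfun_apply a x = c *\<^sub>C x"
    using x(1) by (simp add: E_def)
  from bchoice[OF this] obtain ch where ch: "\<And>a. a \<in> A \<Longrightarrow> blinfun_apply a x = ch a *\<^sub>C x"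
    by blast
  define Y where "Y = (\<Inter>a\<in>A. {y. blinfun_apply a y = ch a *\<^sub>C y})"
  have Y: "invariant B Y"
    unfolding Y_def using A_BB by (intro invariant_Inter) (auto intro!: invariant_eigenspace[OF B_bounded])
  note cl = invariantD(1,2)[OF Y]
  have xY: "x \<in> Y"
    using ch by (auto simp: Y_def)
  have aY: "a y = ch a *\<^sub>C y" if "a \<in> A" "y \<in> Y" for a y
    using that by (auto simp: Y_def)
  have Tb: "T \<in> bounded_operators"
    using T commutantD(1) by blast
  \<comment> \<open>The component of h orthogonal to Y stays orthogonal under a, so only the
    eigenvalue on Y is seen.\<close>
  have inner: "cinner (a h) y = ch a * cinner h y" if a: "a \<in> A" and y: "y \<in> Y" for a h y
  proof -
    have "a (h - cproj Y h) \<in> orth Y"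
      by (rule invariantD(3)[OF red[OF Y] subsetD[OF AB a] cproj(3)[OF cl]])
    then have "cinner (a h) y = cinner (a (cproj Y h)) y"
      using y by (simp add: orth_def blinfun.diff_right cinner.diff_left)
    also have "\<dots> = ch a * cinner (cproj Y h) y"
      by (simp add: aY[OF a cproj(2)[OF cl]] cinner_scaleC_left)
    also have "cinner (cproj Y h) y = cinner h y"
      using cproj(3)[OF cl, of h] y by (simp add: orth_def cinner.diff_left)
    finally show ?thesis .
  qed
  have rank1: "cinner h y *\<^sub>C blinfun_apply T z = cinner (T h) y *\<^sub>C z" if y: "y \<in> Y" and z: "z \<in> Y" for h y z
  proof -
    obtain X where X: "X \<in> bounded_operators" "\<And>h. blinfun_apply X h = cinner h y *\<^sub>C z"
    proof -
      have "norm (cinner h y *\<^sub>C z) \<le> (norm y * norm z) * norm h" for h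
        using mult_right_mono[OF cauchy_schwarz[of h y] norm_ge_zero[of z]] by (simp add: norm_scaleC mult_ac)
      then have "\<exists>X\<in>bounded_operators. (\<forall>h. blinfun_apply X h = cinner h y *\<^sub>C z) \<and> norm X \<le> \<bar>norm y * norm z\<bar>"
        by (intro ex_operator) (auto simp: cinner_add_left cinner_scaleC_left scaleC_add_left scaleC_scaleC)
      then show ?thesis
        using that by blast
    qed
    have "X \<in> B"
      by (rule commutantI[OF X(1)])
        (use A in \<open>auto simp: X(2) inner[OF _ y] aY[OF _ z] bounded_operatorsD subset_iff scaleC_scaleC mult.commute\<close>)
    from commutantD(2)[OF T this, of h] show ?thesis
      by (simp add: X(2) bounded_operatorsD[OF Tb])
  qed
  define c where "c = cinner (T x) x / complex_of_real ((norm x)\<^sup>2)"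
  have nx: "complex_of_real ((norm x)\<^sup>2) \<noteq> 0"
    using x(2) by simp
  have Ty: "T y = c *\<^sub>C y" if y: "y \<in> Y" for y
  proof -
    have "inverse (complex_of_real ((norm x)\<^sup>2)) *\<^sub>C complex_of_real ((norm x)\<^sup>2) *\<^sub>C T y = c *\<^sub>C y"
      using rank1[OF xY y, of x] by (simp only: cinner_self scaleC_scaleC c_def divide_inverse mult.commute)
    then show ?thesis
      using nx by (simp add: scaleC_scaleC scaleC_one)
  qed
  have "cadj T y = cnj c *\<^sub>C y" if y: "y \<in> Y" for y
  proof (rule cinner_ext)
    fix h
    have "cinner h y *\<^sub>C c *\<^sub>C x = cinner (T h) y *\<^sub>C x"
      using rank1[OF y xY, of h] Ty[OF xY] by simp
    then have "(cinner h y * c - cinner (T h) y) *\<^sub>C x = 0"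
      by (simp add: scaleC_scaleC scaleC.diff_left)
    then have "cinner (T h) y = cinner h y * c"
      using x(2) norm_scaleC[of "cinner h y * c - cinner (T h) y" x] by auto
    then have "cinner y (T h) = cnj c * cinner y h"
      by (metis cinner_commute complex_cnj_mult mult.commute)
    then show "cinner (cadj T y) h = cinner (cnj c *\<^sub>C y) h"
      by (simp add: cadj(3)[OF Tb] cinner_scaleC_left)
  qed
  with Y xY Ty show ?thesis
    by blast
qed

text \<open>Commutation with B is tested on joint eigenvectors, where the adjoint acts by one scalar
  on a subspace invariant under B.\<close>

lemma cadj_bicommutant:
  assumes T: "T \<in> commutant B"
  shows "cadj T \<in> commutant B"
proof -
  have Tb: "cadj T \<in> bounded_operators"
    using T commutantD(1) cadj(1) by blast
  have "cadj T o\<^sub>L X = X o\<^sub>L cadj T" if X: "X \<in> B" for X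
  proof (rule operators_eq_if_eq_on_total[OF _ _ joint_eigenvectors_total])
    fix x assume x: "x \<in> E"
    show "(cadj T o\<^sub>L X) x = (X o\<^sub>L cadj T) x"
    proof (cases "x = 0")
      case False
      from bicommutant_scalar_on_eigenspace[OF T x False] obtain c Y where
        Y: "invariant B Y" "x \<in> Y" "\<And>y. y \<in> Y \<Longrightarrow> cadj T y = cnj c *\<^sub>C y"
        by blast
      have "X x \<in> Y"
        using invariantD(3)[OF Y(1) X Y(2)] .
      then show ?thesis
        using Y(2,3) bounded_operatorsD[OF commutantD(1)[OF X]] by simp
    qed simp
  qed (use X Tb commutantD(1) in auto)
  then show ?thesis
    using Tb by (simp add: commutant_def)
qed

lemma cadj_essential_bicommutant:
  assumes T: "T \<in> essential_bicommutant A"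
  shows "cadj T \<in> essential_bicommutant A"
proof -
  have TB: "T \<in> commutant B"
    using T by (simp add: essential_bicommutant_def)
  have "cadj T x = 0" if x: "\<And>a. a \<in> A \<Longrightarrow> blinfun_apply a x = 0" for x
  proof (cases "x = 0")
    case False
    have "x \<in> E"
      using x by (auto simp: E_def intro!: exI[of _ 0])
    from bicommutant_scalar_on_eigenspace[OF TB this False] obtain c where
      c: "T x = c *\<^sub>C x" "cadj T x = cnj c *\<^sub>C x"
      by blast
    have "T x = 0"
      using T x by (simp add: essential_bicommutant_def)
    then have "c = 0"
      using c(1) False norm_scaleC[of c x] by auto
    with c(2) show ?thesis by simp
  qed simp
  then show ?thesis
    using cadj_bicommutant[OF TB] by (simp add: essential_bicommutant_def)
qed

lemma is_adjoint_cadj: "T \<in> bounded_operators \<Longrightarrow> is_adjoint T (cadj T)"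
  by (simp add: is_adjoint_def cadj(2))

lemma cstar_bicommutant: "cstar_subalgebra (commutant B)"
  unfolding cstar_subalgebra_def self_adjoint_set_def
  using subalgebra_bicommutant closed_commutant cadj_bicommutant is_adjoint_cadj commutantD(1) by blast

lemma cstar_essential_bicommutant: "cstar_subalgebra (essential_bicommutant A)"
  unfolding cstar_subalgebra_def self_adjoint_set_def
  using subalgebra_essential_bicommutant closed_essential_bicommutant cadj_essential_bicommutant is_adjoint_cadj
  by (metis (no_types, lifting) subalgebra_def subsetD)

lemma abelian_bicommutant: "abelian (commutant B)"
  using commutant_antimono[OF AB] by (auto simp: abelian_def commutant_def)

end

subsection \<open>Similarity\<close>

lemma conjugate_commutant:
  assumes SR: "inverse_operators S R" and D: "D \<subseteq> bounded_operators"
  shows "commutant (conjugate S R D) = conjugate S R (commutant D)"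
proof -
  note I = inverse_operatorsD[OF SR]
  show ?thesis
  proof (intro equalityI subsetI)
    fix T assume "T \<in> conjugate S R (commutant D)"
    then obtain T0 where T0: "T0 \<in> commutant D" "T = S o\<^sub>L T0 o\<^sub>L R"
      by (auto simp: conjugate_def)
    show "T \<in> commutant (conjugate S R D)"
    proof (rule commutantI)
      show "T \<in> bounded_operators"
        unfolding T0(2) by (intro bounded_operators_simps I commutantD(1)[OF T0(1)])
      show "T (U x) = U (T x)" if "U \<in> conjugate S R D" for U x
        using that commutantD(2)[OF T0(1)] by (auto simp: conjugate_def T0(2) I)
    qed
  next
    fix T assume T: "T \<in> commutant (conjugate S R D)"
    have "R o\<^sub>L T o\<^sub>L S \<in> commutant D"
    proof (rule commutantI)
      show "R o\<^sub>L T o\<^sub>L S \<in> bounded_operators"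
        by (intro bounded_operators_simps I commutantD(1)[OF T])
      fix U x assume "U \<in> D"
      then have "S o\<^sub>L U o\<^sub>L R \<in> conjugate S R D"
        by (simp add: conjugate_def)
      from commutantD(2)[OF T this, of "S x"] show "(R o\<^sub>L T o\<^sub>L S) (U x) = U ((R o\<^sub>L T o\<^sub>L S) x)"
        by (simp add: I)
    qed
    moreover have "T = S o\<^sub>L (R o\<^sub>L T o\<^sub>L S) o\<^sub>L R"
      by (rule blinfun_eqI) (simp add: I)
    ultimately show "T \<in> conjugate S R (commutant D)"
      unfolding conjugate_def by blast
  qed
qed

text \<open>This lets the sigma-weak closure be computed for the original algebra, where complete
  reduction is assumed, and the result be conjugated afterwards.\<close>

lemma conjugate_essential_bicommutant:
  assumes SR: "inverse_operators S R" and D: "D \<subseteq> bounded_operators"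
  shows "essential_bicommutant (conjugate S R D) = conjugate S R (essential_bicommutant D)"
proof -
  note I = inverse_operatorsD[OF SR]
  have bic: "commutant (commutant (conjugate S R D)) = conjugate S R (commutant (commutant D))"
    using conjugate_commutant[OF SR D] conjugate_commutant[OF SR commutant_bounded] by metis
  have ker: "(\<forall>a\<in>conjugate S R D. blinfun_apply a x = 0) \<longleftrightarrow> (\<forall>a\<in>D. blinfun_apply a (R x) = 0)" for x
  proof -
    have "S y = 0 \<longleftrightarrow> y = 0" for y
      using I(4)[of y] by auto
    then show ?thesis
      by (simp add: conjugate_def)
  qed
  show ?thesis
  proof (intro equalityI subsetI)
    fix T assume "T \<in> essential_bicommutant (conjugate S R D)"
    then have T: "T \<in> conjugate S R (commutant (commutant D))" "\<And>x. (\<forall>a\<in>D. blinfun_apply a (R x) = 0) \<Longrightarrow> T x = 0"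
      unfolding essential_bicommutant_def bic ker by auto
    then obtain T0 where T0: "T0 \<in> commutant (commutant D)" "T = S o\<^sub>L T0 o\<^sub>L R"
      by (auto simp: conjugate_def)
    have "T0 x = 0" if "\<forall>a\<in>D. blinfun_apply a x = 0" for x
    proof -
      have "T (S x) = 0"
        by (rule T(2)) (use that in \<open>simp add: I\<close>)
      then show ?thesis
        using I(4)[of "T0 x"] by (simp add: T0(2) I)
    qed
    then show "T \<in> conjugate S R (essential_bicommutant D)"
      using T0 by (auto simp: conjugate_def essential_bicommutant_def)
  next
    fix T assume "T \<in> conjugate S R (essential_bicommutant D)"
    then obtain T0 where T0: "T0 \<in> essential_bicommutant D" "T = S o\<^sub>L T0 o\<^sub>L R"
      by (auto simp: conjugate_def)
    then have "T \<in> conjugate S R (commutant (commutant D))"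
      by (auto simp: conjugate_def essential_bicommutant_def)
    moreover have "T x = 0" if "\<forall>a\<in>D. blinfun_apply a (R x) = 0" for x
      using T0 that by (simp add: essential_bicommutant_def)
    ultimately show "T \<in> essential_bicommutant (conjugate S R D)"
      unfolding essential_bicommutant_def bic ker by blast
  qed
qed

section \<open>Transport of the hypotheses along the similarity\<close>

lemma compact_operators_conjugate:
  assumes "S \<in> bounded_operators" "R \<in> bounded_operators" "T \<in> compact_operators"
  shows "S o\<^sub>L T o\<^sub>L R \<in> compact_operators"
proof -
  obtain K where K: "compact K" "blinfun_apply T ` cball 0 (norm R) \<subseteq> K"
    using compact_operators_image[OF assms(3)] by blast
  have SK: "compact (blinfun_apply S ` K)"
    by (intro compact_continuous_image continuous_intros K)
  have "blinfun_apply (S o\<^sub>L T o\<^sub>L R) ` cball 0 1 \<subseteq> blinfun_apply S ` K"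
  proof (intro image_subsetI)
    fix x :: 'a assume "x \<in> cball 0 1"
    then have "norm (R x) \<le> norm R"
      using order_trans[OF norm_blinfun[of R x] mult_left_le[of "norm x" "norm R"]] by simp
    then have "T (R x) \<in> K"
      by (intro subsetD[OF K(2)] imageI) simp
    then show "(S o\<^sub>L T o\<^sub>L R) x \<in> blinfun_apply S ` K"
      by simp
  qed
  then have "closure (blinfun_apply (S o\<^sub>L T o\<^sub>L R) ` cball 0 1) \<subseteq> blinfun_apply S ` K"
    by (intro closure_minimal compact_imp_closed SK)
  then have "compact (closure (blinfun_apply (S o\<^sub>L T o\<^sub>L R) ` cball 0 1))"
    by (intro compact_closed_subset[OF SK]) auto
  then show ?thesis
    using assms by (auto simp: compact_operators_def)
qed

context crp_algebra
begin

theorem similar_to_reducing_algebra: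
  assumes nondeg: "acts_nondegenerately (commutant A \<inter> compact_operators)"
  shows "\<exists>S R. inverse_operators S R \<and> reducing_algebra (conjugate S R A)"
proof -
  obtain S R where SR: "inverse_operators S R"
    and sa: "\<And>q x y. q \<in> Z \<Longrightarrow> cinner (blinfun_apply (S o\<^sub>L q o\<^sub>L R) x) y = cinner x (blinfun_apply (S o\<^sub>L q o\<^sub>L R) y)"
    using central_idempotents_similar_self_adjoint by blast
  note I = inverse_operatorsD[OF SR]
  let ?A = "conjugate S R A"
  have com: "commutant ?A = conjugate S R (commutant A)"
    by (rule conjugate_commutant[OF SR A])
  have "reducing_algebra ?A"
  proof
    show "?A \<subseteq> bounded_operators"
      using A I(1,2) by (auto simp: conjugate_def)
    show "abelian ?A"
      unfolding abelian_def
    proof (intro ballI blinfun_eqI)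
      fix a b x assume "a \<in> ?A" "b \<in> ?A"
      then obtain a0 b0 where ab: "a0 \<in> A" "a = S o\<^sub>L a0 o\<^sub>L R" "b0 \<in> A" "b = S o\<^sub>L b0 o\<^sub>L R"
        by (auto simp: conjugate_def)
      have "a0 (b0 (R x)) = b0 (a0 (R x))"
        using commutantD(2)[OF subsetD[OF A_subset_commutant ab(1)] ab(3)] .
      then show "(a o\<^sub>L b) x = (b o\<^sub>L a) x"
        by (simp add: ab(2,4) I)
    qed
    show "invariant (commutant ?A) (orth U)" if U: "invariant (commutant ?A) U" for U
    proof -
      define U0 where "U0 = blinfun_apply S -` U"
      have "csubspace U0"
        unfolding U0_def by (intro csubspace_vimage I(1) invariantD(1)[OF U])
      moreover have "closed U0"
        unfolding U0_def by (intro closed_vimage invariantD(2)[OF U] continuous_intros)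
      moreover have "T x \<in> U0" if "T \<in> commutant A" "x \<in> U0" for T x
      proof -
        have "S o\<^sub>L T o\<^sub>L R \<in> commutant ?A"
          unfolding com using that(1) by (simp add: conjugate_def)
        from invariantD(3)[OF U this, of "S x"] that(2) show ?thesis
          by (simp add: U0_def I)
      qed
      ultimately obtain q where q: "q \<in> Z" "U0 = range (blinfun_apply q)"
        using hyperinvariant_central_idempotent by blast
      \<comment> \<open>A self-adjoint idempotent with range U that commutes with the new commutant;
        so its kernel \<open>orth U\<close> is invariant.\<close>
      define p where "p = S o\<^sub>L q o\<^sub>L R"
      have qq: "q (q x) = q x" for x
      proof -
        have "q o\<^sub>L q = q"
          using q(1) by (simp add: Z_def)
        from arg_cong[OF this, of "\<lambda>T. blinfun_apply T x"] show ?thesis by simp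
      qed
      have pU: "p x \<in> U" for x
      proof -
        have "q (R x) \<in> U0"
          using q(2) by blast
        then show ?thesis
          by (simp add: U0_def p_def)
      qed
      have p1: "p x = x" if "x \<in> U" for x
      proof -
        have "R x \<in> U0"
          using that by (simp add: U0_def I)
        then show ?thesis
          using q(2) qq by (auto simp: p_def) (metis I(3))
      qed
      have padj: "cinner (p x) y = cinner x (p y)" for x y
        unfolding p_def by (rule sa[OF q(1)])
      have "T x \<in> orth U" if T: "T \<in> commutant ?A" and x: "x \<in> orth U" for T x
      proof -
        have "cinner (p x) (p x) = 0"
          unfolding padj using x pU by (simp add: orth_def)
        then have px: "p x = 0"
          by simp
        obtain T0 where T0: "T0 \<in> commutant A" "T = S o\<^sub>L T0 o\<^sub>L R"
          using T unfolding com by (auto simp: conjugate_def)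
        have "q (T0 (R x)) = T0 (q (R x))"
          using q(1) T0(1) by (intro commutantD(2)[where D = "commutant A"]) (auto simp: Z_def)
        then have "p (T x) = T (p x)"
          by (simp add: p_def T0(2) I)
        then have "p (T x) = 0"
          using px by simp
        then have "cinner (T x) u = 0" if "u \<in> U" for u
          using padj[of "T x" u] p1[OF that] by simp
        then show ?thesis
          by (simp add: orth_def)
      qed
      then show ?thesis
        by (simp add: invariant_def csubspace_orth closed_orth)
    qed
    show "acts_nondegenerately (commutant ?A \<inter> compact_operators)"
    proof -
      let ?W = "closure (cspan {blinfun_apply T x | T x. T \<in> commutant ?A \<inter> compact_operators})"
      have "{blinfun_apply T x | T x. T \<in> commutant A \<inter> compact_operators} \<subseteq> blinfun_apply S -` ?W"
      proof
        fix z assume "z \<in> {blinfun_apply T x | T x. T \<in> commutant A \<inter> compact_operators}"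
        then obtain T x where T: "T \<in> commutant A" "T \<in> compact_operators" "z = T x"
          by blast
        have "S o\<^sub>L T o\<^sub>L R \<in> commutant ?A \<inter> compact_operators"
          unfolding com using T compact_operators_conjugate[OF I(1,2)] by (auto simp: conjugate_def)
        then have "(S o\<^sub>L T o\<^sub>L R) (S x) \<in> ?W"
          by (intro subsetD[OF closure_subset] complex_vector.span_base) blast
        then show "z \<in> blinfun_apply S -` ?W"
          by (simp add: T(3) I)
      qed
      then have "closure (cspan {blinfun_apply T x | T x. T \<in> commutant A \<inter> compact_operators}) \<subseteq> blinfun_apply S -` ?W"
        by (intro closed_cspan_subset csubspace_vimage I(1) csubspace_closure complex_vector.subspace_span
            closed_vimage continuous_intros closed_closure)
      then have "S (R x) \<in> ?W" for x
        using nondeg unfolding acts_nondegenerately_def by blast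
      then show ?thesis
        unfolding acts_nondegenerately_def by (auto simp: I(3))
    qed
  qed
  with SR show ?thesis by blast
qed

end

section \<open>The sigma-weak closure\<close>

lemma cinner_single_right: "cinner f (ell2_single i x) = cinner (ell2_nth f i) x"
proof -
  have "cinner f (ell2_single i x) = (\<Sum>\<^sub>\<infinity>j. cinner (ell2_nth f j) (if j = i then x else 0))"
    by (simp add: cinner_ell2.rep_eq)
  also have "\<dots> = (\<Sum>\<^sub>\<infinity>j\<in>{i}. cinner (ell2_nth f j) (if j = i then x else 0))"
    by (rule infsum_cong_neutral) auto
  finally show ?thesis by simp
qed

lemma cinner_single_left: "cinner (ell2_single i x) f = cinner x (ell2_nth f i)"
  using cinner_single_right cinner_commute by metis

lemma ell2_single_total: "closure (cspan {ell2_single i x | i x. True}) = (UNIV :: ('i, 'a::complex_hilbert_space) ell2 set)"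
proof (rule closed_csubspace_eq_UNIV)
  show "orth (closure (cspan {ell2_single i x | i x. True})) \<subseteq> ({0} :: ('i, 'a) ell2 set)"
  proof
    fix f :: "('i, 'a) ell2"
    assume f: "f \<in> orth (closure (cspan {ell2_single i x | i x. True}))"
    have "ell2_nth f i = 0" for i
    proof -
      have "ell2_single i (ell2_nth f i) \<in> closure (cspan {ell2_single i x | i x. True})"
        by (intro subsetD[OF closure_subset] complex_vector.span_base) blast
      then have "cinner f (ell2_single i (ell2_nth f i)) = 0"
        using f by (simp add: orth_def)
      then show ?thesis
        by (simp add: cinner_single_right)
    qed
    then show "f \<in> {0}"
      by (simp add: ell2_eqI)
  qed
qed (auto intro: csubspace_closure)

lemma amplification_bounded_operators: "T \<in> bounded_operators \<Longrightarrow> amplification T \<in> bounded_operators"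
  by (auto simp: bounded_operators_def intro!: ell2_eqI)

text \<open>Both products are bounded, so they may be compared on vectors supported on one
  coordinate, which are total.\<close>

lemma amplification_commutes_if_entries_commute:
  fixes P :: "('i, 'a::complex_hilbert_space) ell2 \<Rightarrow>\<^sub>L ('i, 'a) ell2"
  assumes P: "P \<in> bounded_operators" and T: "T \<in> bounded_operators"
    and e: "\<And>i j x. blinfun_apply (entry P i j) (blinfun_apply T x) = blinfun_apply T (blinfun_apply (entry P i j) x)"
  shows "ell2_map T (blinfun_apply P f) = blinfun_apply P (ell2_map T f)"
proof -
  have "amplification T o\<^sub>L P = P o\<^sub>L amplification T"
  proof (rule operators_eq_if_eq_on_total[OF _ _ ell2_single_total])
    fix f :: "('i, 'a) ell2" assume "f \<in> {ell2_single i x | i x. True}"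
    then obtain j x where f: "f = ell2_single j x" by blast
    show "(amplification T o\<^sub>L P) f = (P o\<^sub>L amplification T) f"
      by (rule ell2_eqI) (use e in \<open>simp add: f amplification_single[unfolded amplification.rep_eq]\<close>)
  qed (use P T amplification_bounded_operators in auto)
  from arg_cong[OF this, of "\<lambda>U. blinfun_apply U f"] show ?thesis
    by (simp add: amplification.rep_eq)
qed

lemma ell2_map_diff: "ell2_map T (f - g) = ell2_map T f - ell2_map T g"
  by (rule ell2_eqI) (simp add: blinfun.diff_right)

lemma sigma_weak_functional_eq: "sigma_weak_functional x y T = cinner (ell2_map T x) y"
  by (simp add: sigma_weak_functional_def cinner_ell2.rep_eq)

section \<open>One sequence that controls finitely many functionals\<close>

lemma norm_ell2_subfamily:
  fixes y :: "('i, 'a::complex_hilbert_space) ell2" and z :: "('j, 'a) ell2"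
  assumes "inj f" "\<And>i. ell2_nth y i = ell2_nth z (f i)"
  shows "norm y \<le> norm z"
proof (rule norm_ell2_leI)
  fix F :: "'i set" assume F: "finite F"
  have "L2_set (\<lambda>i. norm (ell2_nth y i)) F = L2_set (\<lambda>j. norm (ell2_nth z j)) (f ` F)"
    unfolding L2_set_def by (subst sum.reindex) (use assms in \<open>auto intro: inj_on_subset\<close>)
  also have "\<dots> \<le> norm z"
    by (rule L2_set_le_norm_ell2) (use F in simp)
  finally show "L2_set (\<lambda>i. norm (ell2_nth y i)) F \<le> norm z" .
qed

text \<open>Row i of the natural numbers arranged as pairs. Finitely many sequences are thus merged
  into one without leaving the index type of \<open>complete_reduction_property\<close>.\<close>

lift_definition ell2_row :: "nat \<Rightarrow> (nat, 'a) ell2 \<Rightarrow> (nat, 'a::complex_hilbert_space) ell2"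
  is "\<lambda>i f k. if fst (prod_decode k) = i then f (snd (prod_decode k)) else 0"
proof -
  fix i and f :: "nat \<Rightarrow> 'a"
  assume f: "square_summable f"
  let ?g = "\<lambda>k. if fst (prod_decode k) = i then f (snd (prod_decode k)) else 0"
  show "square_summable ?g"
  proof (rule square_summable_bound)
    fix F :: "nat set" assume F: "finite F"
    let ?G = "{k\<in>F. fst (prod_decode k) = i}"
    have "(\<Sum>k\<in>F. (norm (?g k))\<^sup>2) = (\<Sum>k\<in>?G. (norm (f (snd (prod_decode k))))\<^sup>2)"
      using F by (intro sum.mono_neutral_cong_right) auto
    also have "\<dots> = (\<Sum>m\<in>(\<lambda>k. snd (prod_decode k)) ` ?G. (norm (f m))\<^sup>2)"
    proof (subst sum.reindex)
      show "inj_on (\<lambda>k. snd (prod_decode k)) ?G"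
        by (rule inj_onI) (metis (mono_tags, lifting) mem_Collect_eq prod_decode_inverse prod_eq_iff)
    qed simp
    also have "\<dots> \<le> (\<Sum>\<^sub>\<infinity>m. (norm (f m))\<^sup>2)"
      using f F unfolding square_summable_def by (intro finite_sum_le_infsum) auto
    finally show "(\<Sum>k\<in>F. (norm (?g k))\<^sup>2) \<le> (\<Sum>\<^sub>\<infinity>m. (norm (f m))\<^sup>2)" .
  qed
qed

lemma ell2_nth_sum: "ell2_nth (\<Sum>i\<in>I. f i) k = (\<Sum>i\<in>I. ell2_nth (f i) k)"
  by (induction I rule: infinite_finite_induct) simp_all

text \<open>\<open>z\<close> interleaves the sequences in \<open>F\<close>.\<close>

lemma ex_interleaving:
  fixes F :: "(nat, 'a::complex_hilbert_space) ell2 set"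
  assumes "finite F"
  shows "\<exists>z :: (nat, 'a) ell2. \<forall>x\<in>F. \<forall>T. norm (ell2_map T x) \<le> norm (ell2_map T z)"
proof -
  obtain n and x :: "nat \<Rightarrow> (nat, 'a) ell2" where x: "F = x ` {i. i < n}"
    using finite_imp_nat_seg_image_inj_on[OF assms] by auto
  define z where "z = (\<Sum>i<n. ell2_row i (x i))"
  have z: "ell2_nth z (prod_encode (i, m)) = ell2_nth (x i) m" if "i < n" for i m
  proof -
    have "ell2_nth z (prod_encode (i, m)) = (\<Sum>j<n. if j = i then ell2_nth (x i) m else 0)"
      unfolding z_def ell2_nth_sum by (intro sum.cong) (auto simp: ell2_row.rep_eq)
    then show ?thesis
      using that by simp
  qed
  have "norm (ell2_map T (x i)) \<le> norm (ell2_map T z)" if "i < n" for i T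
    by (rule norm_ell2_subfamily[of "\<lambda>m. prod_encode (i, m)"])
      (use z that in \<open>auto simp: inj_def prod_encode_eq\<close>)
  then show ?thesis
    unfolding x by blast
qed

text \<open>Induction over the generation of open sets; an intersection merges the finite sets of
  functionals and takes the smaller tolerance.\<close>

lemma sigma_weak_neighbourhood:
  fixes T :: "'a::complex_hilbert_space \<Rightarrow>\<^sub>L 'a"
  assumes "generate_topology_on {sigma_weak_functional x y -` U | x y U. open U} O'" and "T \<in> O'"
  shows "\<exists>F e. finite F \<and> 0 < e \<and> (\<forall>T'. (\<forall>x y. (x, y) \<in> F \<longrightarrow>
    cmod (sigma_weak_functional x y T' - sigma_weak_functional x y T) < e) \<longrightarrow> T' \<in> O')"
  using assms
proof (induction rule: generate_topology_on.induct)
  case (Int a b)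
  have Ta: "T \<in> a" "T \<in> b"
    using Int.prems by auto
  from Int.IH(1)[OF Ta(1)] obtain F1 e1 where
    1: "finite F1" "0 < e1" "\<And>T'. (\<forall>x y. (x, y) \<in> F1 \<longrightarrow> cmod (sigma_weak_functional x y T' - sigma_weak_functional x y T) < e1) \<Longrightarrow> T' \<in> a"
    by blast
  from Int.IH(2)[OF Ta(2)] obtain F2 e2 where
    2: "finite F2" "0 < e2" "\<And>T'. (\<forall>x y. (x, y) \<in> F2 \<longrightarrow> cmod (sigma_weak_functional x y T' - sigma_weak_functional x y T) < e2) \<Longrightarrow> T' \<in> b"
    by blast
  show ?case
  proof (intro exI[of _ "F1 \<union> F2"] exI[of _ "min e1 e2"] conjI allI impI IntI)
    fix T' assume T': "\<forall>x y. (x, y) \<in> F1 \<union> F2 \<longrightarrow> cmod (sigma_weak_functional x y T' - sigma_weak_functional x y T) < min e1 e2"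
    show "T' \<in> a"
      by (rule 1(3)) (use T' in auto)
    show "T' \<in> b"
      by (rule 2(3)) (use T' in auto)
  qed (use 1 2 in auto)
next
  case (UN K)
  then obtain k where k: "k \<in> K" "T \<in> k" by blast
  from UN.IH[OF k] obtain F e where
    "finite F" "0 < e" "\<And>T'. (\<forall>x y. (x, y) \<in> F \<longrightarrow> cmod (sigma_weak_functional x y T' - sigma_weak_functional x y T) < e) \<Longrightarrow> T' \<in> k"
    by blast
  with k(1) show ?case
    by (intro exI[of _ F] exI[of _ e]) blast
next
  case (Basis s)
  then obtain x y U where s: "s = sigma_weak_functional x y -` U" "open U" by blast
  then obtain e where e: "0 < e" "\<And>c. dist c (sigma_weak_functional x y T) < e \<Longrightarrow> c \<in> U"
    using Basis.prems by (auto simp: open_dist)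
  show ?case
    by (intro exI[of _ "{(x, y)}"] exI[of _ e]) (use e s(1) in \<open>auto simp: dist_norm\<close>)
qed simp

text \<open>The difference of the two coefficients is a single sigma-weak functional, given by
  vectors with two coordinates, so the set where it is nonzero is open. Relations of this kind
  express both commutation with \<open>commutant A\<close> and vanishing on a vector.\<close>

lemma sigma_weak_closure_relation:
  assumes T: "T \<in> sigma_weak_topology closure_of A"
    and eq: "\<And>a. a \<in> A \<Longrightarrow> cinner (blinfun_apply a u) v = cinner (blinfun_apply a u') v'"
  shows "cinner (blinfun_apply T u) v = cinner (blinfun_apply T u') v'"
proof (rule ccontr)
  assume ne: "\<not> ?thesis"
  define \<xi> where "\<xi> = ell2_single (0::nat) u + ell2_single 1 u'"
  define \<eta> where "\<eta> = ell2_single (0::nat) v - ell2_single 1 v'"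
  have f: "sigma_weak_functional \<xi> \<eta> S = cinner (blinfun_apply S u) v - cinner (blinfun_apply S u') v'" for S
    unfolding sigma_weak_functional_eq \<eta>_def
    by (simp add: cinner.diff_right cinner_single_right \<xi>_def)
  let ?O = "sigma_weak_functional \<xi> \<eta> -` (- {0}) \<inter> bounded_operators"
  have "openin (topology_generated_by {sigma_weak_functional x y -` U | x y U. open U}) (sigma_weak_functional \<xi> \<eta> -` (- {0}))"
  proof (rule topology_generated_by_Basis)
    have "open (- {0::complex})"
      by (intro open_Compl closed_singleton)
    then show "sigma_weak_functional \<xi> \<eta> -` (- {0}) \<in> {sigma_weak_functional x y -` U | x y U. open U}"
      by blast
  qed
  then have "openin sigma_weak_topology ?O"
    unfolding sigma_weak_topology_def by (auto simp: openin_subtopology)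
  moreover have "T \<in> ?O"
    using T ne by (auto simp: in_closure_of sigma_weak_topology_def f)
  moreover have "\<exists>y. y \<in> A \<and> y \<in> V" if "T \<in> V" "openin sigma_weak_topology V" for V
    using T that unfolding in_closure_of by blast
  ultimately obtain a where "a \<in> A" "a \<in> ?O"
    by meson
  then show False
    using eq f by auto
qed

lemma sigma_weak_closure_subset:
  assumes A: "A \<subseteq> bounded_operators"
  shows "sigma_weak_topology closure_of A \<subseteq> essential_bicommutant A"
proof
  fix T assume T: "T \<in> sigma_weak_topology closure_of A"
  then have Tb: "T \<in> bounded_operators"
    by (auto simp: in_closure_of sigma_weak_topology_def)
  have "T \<in> commutant (commutant A)"
  proof (rule commutantI[OF Tb], rule cinner_ext)
    fix X x y assume X: "X \<in> commutant A"
    have "cinner (T (X x)) y = cinner (T x) (cadj X y)"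
    proof (rule sigma_weak_closure_relation[OF T])
      show "cinner (a (X x)) y = cinner (a x) (cadj X y)" if "a \<in> A" for a
        using commutantD(2)[OF X that, of x] cadj(2)[OF commutantD(1)[OF X], of "a x" y] by simp
    qed
    then show "cinner (T (X x)) y = cinner (X (T x)) y"
      by (simp add: cadj(2)[OF commutantD(1)[OF X]])
  qed
  moreover have "T x = 0" if "\<forall>a\<in>A. blinfun_apply a x = 0" for x
  proof (rule cinner_ext)
    fix y
    have "cinner (T x) y = cinner (T 0) y"
      by (rule sigma_weak_closure_relation[OF T]) (use that in simp)
    then show "cinner (T x) y = cinner 0 y"
      by simp
  qed
  ultimately show "T \<in> essential_bicommutant A"
    by (simp add: essential_bicommutant_def)
qed

context crp_algebra
begin

text \<open>Von Neumann's density argument with a module projection P in place of an orthogonal one.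
  T commutes with P because it commutes with the entries of P.\<close>

lemma essential_bicommutant_approx:
  fixes z :: "(nat, 'a) ell2"
  assumes sub: "subalgebra A" and T: "T \<in> essential_bicommutant A" and e: "0 < e"
  shows "\<exists>a\<in>A. norm (ell2_map (a - T) z) < e"
proof -
  let ?X = "{ell2_map a z | a. a \<in> A}"
  have "csubspace ?X"
  proof (rule complex_vector.subspaceI)
    have "ell2_map 0 z = 0"
      by (rule ell2_eqI) simp
    then show "0 \<in> ?X"
      using sub unfolding subalgebra_def by (metis (mono_tags, lifting) mem_Collect_eq)
    show "x + y \<in> ?X" if xy: "x \<in> ?X" "y \<in> ?X" for x y
    proof -
      obtain a b where "a \<in> A" "b \<in> A" "x = ell2_map a z" "y = ell2_map b z"
        using xy by blast
      moreover have "ell2_map a z + ell2_map b z = ell2_map (a + b) z"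
        by (rule ell2_eqI) (simp add: blinfun.add_left)
      ultimately show ?thesis
        using sub by (auto simp: subalgebra_def)
    qed
    show "c *\<^sub>C x \<in> ?X" if x: "x \<in> ?X" for c x
    proof -
      obtain a where "a \<in> A" "x = ell2_map a z"
        using x by blast
      moreover have "c *\<^sub>C ell2_map a z = ell2_map (scaleC_op c a) z"
        by (rule ell2_eqI) simp
      ultimately show ?thesis
        using sub by (auto simp: subalgebra_def)
    qed
  qed
  then have V: "csubspace (closure ?X)"
    by (rule csubspace_closure)
  have inv: "ell2_map a \<xi> \<in> closure ?X" if a: "a \<in> A" and \<xi>: "\<xi> \<in> closure ?X" for a \<xi>
  proof -
    have "?X \<subseteq> ell2_map a -` closure ?X"
    proof
      fix y assume "y \<in> ?X"
      then obtain b where b: "b \<in> A" "y = ell2_map b z" by blast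
      have "ell2_map a y = ell2_map (a o\<^sub>L b) z"
        by (rule ell2_eqI) (simp add: b(2))
      moreover have "a o\<^sub>L b \<in> A"
        using sub a b(1) by (auto simp: subalgebra_def)
      ultimately show "y \<in> ell2_map a -` closure ?X"
        using closure_subset[of ?X] by auto
    qed
    moreover have "closed (ell2_map a -` closure ?X)"
      by (intro closed_vimage closed_closure linear_continuous_on bounded_linear_ell2_map)
    ultimately show ?thesis
      using \<xi> closure_minimal by blast
  qed
  obtain P where P: "P \<in> bounded_operators" "\<And>\<xi>. blinfun_apply P \<xi> \<in> closure ?X"
    "\<And>\<xi>. \<xi> \<in> closure ?X \<Longrightarrow> blinfun_apply P \<xi> = \<xi>" "\<And>i j. entry P i j \<in> commutant A"
    "\<And>a \<xi>. a \<in> A \<Longrightarrow> ell2_map a (blinfun_apply P \<xi>) = blinfun_apply P (ell2_map a \<xi>)"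
    using crp_projection[OF V closed_closure inv] by blast
  have TB: "T \<in> commutant (commutant A)"
    using T by (simp add: essential_bicommutant_def)
  \<comment> \<open>A may lack a unit, so z need not lie in the closure. The remainder w is
    annihilated by A, so its coordinates lie in the common kernel, where T vanishes; hence T z = T P
    z = P T z.\<close>
  define w where "w = z - P z"
  have "ell2_map a w = 0" if a: "a \<in> A" for a
  proof -
    have "ell2_map a z \<in> closure ?X"
      using a by (intro subsetD[OF closure_subset]) blast
    from P(3)[OF this] show ?thesis
      using P(5)[OF a, of z]
      by (simp add: w_def ell2_map_diff)
  qed
  then have "a (ell2_nth w i) = 0" if "a \<in> A" for a i
    using that by (metis ell2_map.rep_eq zero_ell2.rep_eq)
  then have "T (ell2_nth w i) = 0" for i
    using T by (simp add: essential_bicommutant_def)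
  then have "ell2_map T w = 0"
    by (intro ell2_eqI) simp
  then have "ell2_map T z = ell2_map T (P z)"
    by (simp add: w_def ell2_map_diff)
  also have "\<dots> = P (ell2_map T z)"
    using commutantD(1)[OF TB] commutantD(2)[OF TB P(4)]
    by (intro amplification_commutes_if_entries_commute P(1)) simp_all
  finally have eq: "ell2_map T z = P (ell2_map T z)" .
  have "ell2_map T z \<in> closure ?X"
    by (subst eq) (rule P(2))
  then obtain a where "a \<in> A" "dist (ell2_map a z) (ell2_map T z) < e"
    unfolding closure_approachable using e by blast
  moreover have "ell2_map a z - ell2_map T z = ell2_map (a - T) z"
    by (rule ell2_eqI) (simp add: blinfun.diff_left)
  ultimately show ?thesis
    by (auto simp: dist_norm)
qed

theorem sigma_weak_closure_eq:
  assumes sub: "subalgebra A"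
  shows "sigma_weak_topology closure_of A = essential_bicommutant A"
proof
  show "sigma_weak_topology closure_of A \<subseteq> essential_bicommutant A"
    by (rule sigma_weak_closure_subset[OF A])
  show "essential_bicommutant A \<subseteq> sigma_weak_topology closure_of A"
  proof
    fix T assume T: "T \<in> essential_bicommutant A"
    have Tb: "T \<in> bounded_operators"
      using T commutantD(1) by (auto simp: essential_bicommutant_def)
    have "UNIV \<in> {sigma_weak_functional x y -` U | x y U. open U}"
      by (auto intro!: exI[of _ UNIV])
    then have top: "topspace sigma_weak_topology = bounded_operators"
      unfolding sigma_weak_topology_def by (auto simp: topology_generated_by_topspace)
    show "T \<in> sigma_weak_topology closure_of A"
      unfolding in_closure_of top
    proof (intro conjI allI impI Tb)
      fix O' assume "T \<in> O' \<and> openin sigma_weak_topology O'"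
      then obtain O1 where O1: "generate_topology_on {sigma_weak_functional x y -` U | x y U. open U} O1"
        "O' = O1 \<inter> bounded_operators" "T \<in> O1"
        unfolding sigma_weak_topology_def openin_subtopology openin_topology_generated_by_iff by blast
      from sigma_weak_neighbourhood[OF O1(1,3)] obtain F e where F: "finite F" "0 < e"
        "\<And>T'. (\<forall>x y. (x, y) \<in> F \<longrightarrow> cmod (sigma_weak_functional x y T' - sigma_weak_functional x y T) < e) \<Longrightarrow> T' \<in> O1"
        by blast
      obtain z :: "(nat, 'a) ell2" where z: "\<And>x T. x \<in> fst ` F \<Longrightarrow> norm (ell2_map T x) \<le> norm (ell2_map T z)"
        using ex_interleaving[of "fst ` F"] F(1) by blast
      \<comment> \<open>A common bound for the second arguments of the functionals; the summand 1
        keeps it positive.\<close>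
      define C where "C = 1 + (\<Sum>p\<in>F. norm (snd p))"
      have C: "0 < C"
        unfolding C_def by (intro add_pos_nonneg sum_nonneg) auto
      obtain a where a: "a \<in> A" "norm (ell2_map (a - T) z) < e / C"
        using essential_bicommutant_approx[OF sub T, of "e / C" z] F(2) C by auto
      have "cmod (sigma_weak_functional x y a - sigma_weak_functional x y T) < e" if p: "(x, y) \<in> F" for x y
      proof -
        have "sigma_weak_functional x y a - sigma_weak_functional x y T = cinner (ell2_map (a - T) x) y"
        proof -
          have "ell2_map (a - T) x = ell2_map a x - ell2_map T x"
            by (rule ell2_eqI) (simp add: blinfun.diff_left)
          then show ?thesis
            by (simp add: sigma_weak_functional_eq cinner.diff_left)
        qed
        also have "cmod \<dots> \<le> norm (ell2_map (a - T) x) * norm y"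
          by (rule cauchy_schwarz)
        also have "\<dots> \<le> norm (ell2_map (a - T) z) * C"
        proof (rule mult_mono)
          show "norm (ell2_map (a - T) x) \<le> norm (ell2_map (a - T) z)"
            using z p by force
          show "norm y \<le> C"
            unfolding C_def using member_le_sum[OF p, of "\<lambda>p. norm (snd p)"] F(1) by simp
        qed simp_all
        also have "\<dots> < e"
          using a(2) C by (simp add: pos_less_divide_eq)
        finally show ?thesis .
      qed
      then have "a \<in> O1"
        by (intro F(3)) auto
      then show "\<exists>y. y \<in> A \<and> y \<in> O'"
        using a(1) A O1(2) by auto
    qed
  qed
qed

end

section \<open>Fuglede's theorem\<close>

text \<open>Cauchy's estimate for the first coefficient, with the integral replaced by a mean over
  the roots of unity of order m + 1. The weight w^(k m) = w^(-k) selects j = 1, the only j between 0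
  and m with m + j divisible by m + 1.\<close>

lemma linear_coefficient_bound:
  fixes c :: "nat \<Rightarrow> complex"
  assumes m: "1 \<le> m" and t: "0 < t" and bd: "\<And>z. cmod z = t \<Longrightarrow> cmod (\<Sum>j\<le>m. c j * z ^ j) \<le> M"
  shows "cmod (c 1) * t \<le> M"
proof -
  define n where "n = Suc m"
  define w where "w = exp (2 * of_real pi * \<i> / of_nat n)"
  have w_power: "w ^ a = exp (2 * of_real pi * \<i> * of_nat a / of_nat n)" for a
    unfolding w_def by (subst exp_of_nat_mult[symmetric]) (simp add: mult_ac)
  have w1: "w ^ a = 1 \<longleftrightarrow> a mod n = 0" for a
    using complex_root_unity_eq[of n a 0] unfolding w_power by (simp add: n_def)
  have nw: "cmod w = 1"
    by (simp add: w_def norm_exp_eq_Re)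
  have inner: "(\<Sum>k<n. w ^ (k * (m + j))) = (if j = 1 then of_nat n else 0)" if j: "j \<le> m" for j
  proof -
    have "(m + j) mod n = 0 \<longleftrightarrow> j = 1"
    proof (cases j)
      case 0
      then show ?thesis
        using m by (simp add: n_def)
    next
      case (Suc i)
      then have "m + j = i + n"
        by (simp add: n_def)
      then have "(m + j) mod n = i mod n"
        by simp
      then show ?thesis
        using Suc j by (simp add: n_def)
    qed
    then have eq: "w ^ (m + j) = 1 \<longleftrightarrow> j = 1"
      by (simp add: w1)
    have "(\<Sum>k<n. w ^ (k * (m + j))) = (\<Sum>k<n. (w ^ (m + j)) ^ k)"
      by (simp add: power_mult[symmetric] mult.commute)
    also have "\<dots> = (if j = 1 then of_nat n else 0)"
    proof (cases "j = 1")
      case True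
      then show ?thesis
        using eq by simp
    next
      case False
      then have "w ^ (m + j) \<noteq> 1"
        using eq by simp
      moreover have "(w ^ (m + j)) ^ n = 1"
        unfolding power_mult[symmetric] w1 by simp
      ultimately show ?thesis
        using False geometric_sum[of "w ^ (m + j)" n] by simp
    qed
    finally show ?thesis .
  qed
  have "(\<Sum>k<n. w ^ (k * m) * (\<Sum>j\<le>m. c j * (of_real t * w ^ k) ^ j)) =
      (\<Sum>j\<le>m. c j * of_real t ^ j * (\<Sum>k<n. w ^ (k * (m + j))))"
    unfolding sum_distrib_left
    by (subst sum.swap) (simp add: power_mult_distrib power_mult[symmetric] power_add distrib_left mult_ac)
  also have "\<dots> = (\<Sum>j\<le>m. if j = 1 then c 1 * of_real t * of_nat n else 0)"
    by (intro sum.cong) (simp_all add: inner)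
  also have "\<dots> = c 1 * of_real t * of_nat n"
    using m by simp
  finally have "cmod (c 1) * t * real n = cmod (\<Sum>k<n. w ^ (k * m) * (\<Sum>j\<le>m. c j * (of_real t * w ^ k) ^ j))"
    using t by (simp add: norm_mult)
  also have "\<dots> \<le> (\<Sum>k<n. M)"
  proof (rule sum_norm_le)
    fix k
    show "cmod (w ^ (k * m) * (\<Sum>j\<le>m. c j * (of_real t * w ^ k) ^ j)) \<le> M"
      using bd[of "of_real t * w ^ k"] t by (simp add: norm_mult norm_power nw)
  qed
  finally have "real n * (cmod (c 1) * t) \<le> real n * M"
    by (simp add: mult.commute)
  then show ?thesis
    by (simp add: n_def)
qed

text \<open>The operator X + s (K X - X K) equals (1 + s K) X (1 - s K) + s^2 K X K. For
  skew-adjoint K the outer factors stretch norms only to second order in s, so the bound has no term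
  linear in s. This keeps m iterations with steps of size 1 / root m bounded.\<close>

lemma norm_add_commutator_skew_le:
  fixes K X :: "'a::complex_hilbert_space \<Rightarrow>\<^sub>L 'a"
  assumes skew: "\<And>x y. cinner (blinfun_apply K x) y = - cinner x (blinfun_apply K y)" and K: "norm K \<le> \<kappa>"
  shows "norm (X + s *\<^sub>R ((K o\<^sub>L X) - (X o\<^sub>L K))) \<le> (1 + 2 * s\<^sup>2 * \<kappa>\<^sup>2) * norm X"
proof (rule norm_blinfun_bound)
  have \<kappa>: "0 \<le> \<kappa>"
    using K norm_ge_zero order_trans by blast
  have Kx: "norm (K x) \<le> \<kappa> * norm x" for x
    using order_trans[OF norm_blinfun mult_right_mono[OF K norm_ge_zero]] .
  have re: "Re (cinner x (K x)) = 0" for x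
  proof -
    have "cinner x (K x) = - cnj (cinner x (K x))"
      using skew[of x x] cinner_commute[of "K x" x] by simp
    from arg_cong[OF this, of Re] show ?thesis
      by simp
  qed
  define q where "q = sqrt (1 + s\<^sup>2 * \<kappa>\<^sup>2)"
  have q: "0 \<le> q" "q * q = 1 + s\<^sup>2 * \<kappa>\<^sup>2"
    unfolding q_def by (simp_all add: real_sqrt_mult_self)
  have iso: "norm (x + r *\<^sub>R K x) \<le> q * norm x" if "\<bar>r\<bar> = \<bar>s\<bar>" for x r
  proof (rule power2_le_imp_le)
    have "(norm (x + r *\<^sub>R K x))\<^sup>2 = (norm x)\<^sup>2 + s\<^sup>2 * (norm (K x))\<^sup>2"
    proof -
      have "r\<^sup>2 = s\<^sup>2"
        using that by (metis power2_abs)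
      then show ?thesis
        using re[of x] by (simp add: norm_square_add cinner.scaleR_right power_mult_distrib)
    qed
    also have "\<dots> \<le> (norm x)\<^sup>2 + s\<^sup>2 * (\<kappa> * norm x)\<^sup>2"
      using Kx[of x] by (intro add_left_mono mult_left_mono power_mono) auto
    also have "\<dots> = (q * norm x)\<^sup>2"
    proof -
      have "(q * norm x)\<^sup>2 = (q * q) * (norm x)\<^sup>2"
        by (simp add: power2_eq_square)
      then show ?thesis
        unfolding q(2) by (simp add: power_mult_distrib algebra_simps)
    qed
    finally show "(norm (x + r *\<^sub>R K x))\<^sup>2 \<le> (q * norm x)\<^sup>2" .
  qed (use q in simp)
  fix x
  let ?u = "X (x - s *\<^sub>R K x)"
  have "blinfun_apply (X + s *\<^sub>R ((K o\<^sub>L X) - (X o\<^sub>L K))) x = (?u + s *\<^sub>R K ?u) + s\<^sup>2 *\<^sub>R K (X (K x))"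
    by (simp add: blinfun.bilinear_simps algebra_simps power2_eq_square)
  also have "norm \<dots> \<le> norm (?u + s *\<^sub>R K ?u) + norm (s\<^sup>2 *\<^sub>R K (X (K x)))"
    by (rule norm_triangle_ineq)
  also have "norm (?u + s *\<^sub>R K ?u) \<le> q * (norm X * (q * norm x))"
  proof -
    have "norm ?u \<le> norm X * (q * norm x)"
      using order_trans[OF norm_blinfun mult_left_mono[OF iso[of "- s" x] norm_ge_zero[of X]]] by simp
    then show ?thesis
      using order_trans[OF iso[of s ?u] mult_left_mono[OF _ q(1)]] by simp
  qed
  also have "q * (norm X * (q * norm x)) = (1 + s\<^sup>2 * \<kappa>\<^sup>2) * norm X * norm x"
    unfolding q(2)[symmetric] by (simp add: mult_ac)
  also have "norm (s\<^sup>2 *\<^sub>R K (X (K x))) \<le> s\<^sup>2 * (\<kappa> * (norm X * (\<kappa> * norm x)))"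
  proof -
    have "norm (X (K x)) \<le> norm X * (\<kappa> * norm x)"
      using order_trans[OF norm_blinfun mult_left_mono[OF Kx norm_ge_zero]] .
    then have "norm (K (X (K x))) \<le> \<kappa> * (norm X * (\<kappa> * norm x))"
      using order_trans[OF Kx mult_left_mono[OF _ \<kappa>]] by blast
    then show ?thesis
      by (simp add: mult_left_mono)
  qed
  finally show "norm (blinfun_apply (X + s *\<^sub>R ((K o\<^sub>L X) - (X o\<^sub>L K))) x) \<le> (1 + 2 * s\<^sup>2 * \<kappa>\<^sup>2) * norm X * norm x"
    by (simp add: power2_eq_square algebra_simps)
qed simp

text \<open>With \<open>\<delta> = ad N\<^sup>*\<close>, the polynomial \<open>(1 + (z / m) \<delta>)\<^sup>m P\<close> in \<open>z\<close> is bounded for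
  \<open>|z| = \<surd>m\<close> independently of \<open>m\<close>, because \<open>\<delta>\<close> agrees on the commutant of \<open>N\<close> with a unimodular
  multiple of the derivation by a skew-adjoint operator. Its linear coefficient is \<open>\<delta> P\<close>, which
  therefore vanishes.\<close>

theorem fuglede:
  fixes N P :: "'a::complex_hilbert_space \<Rightarrow>\<^sub>L 'a"
  assumes N: "N \<in> bounded_operators" and P: "P \<in> bounded_operators"
    and normal: "N o\<^sub>L cadj N = cadj N o\<^sub>L N" and com: "P o\<^sub>L N = N o\<^sub>L P"
  shows "P o\<^sub>L cadj N = cadj N o\<^sub>L P"
proof -
  define N' where "N' = cadj N"
  have N': "N' \<in> bounded_operators" "norm N' \<le> norm N"
    unfolding N'_def by (rule cadj[OF N])+
  have NN': "N (N' x) = N' (N x)" for x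
    using arg_cong[OF normal, of "\<lambda>T. blinfun_apply T x"] by (simp add: N'_def)
  have adj: "cinner (N x) y = cinner x (N' y)" "cinner (N' x) y = cinner x (N y)" for x y
    unfolding N'_def using cadj[OF N] by blast+
  define \<delta> where "\<delta> X = (N' o\<^sub>L X) - (X o\<^sub>L N')" for X :: "'a \<Rightarrow>\<^sub>L 'a"
  define D where "D = {X \<in> bounded_operators. \<forall>x. blinfun_apply X (blinfun_apply N x) = blinfun_apply N (blinfun_apply X x)}"
  have PD: "P \<in> D"
    using P arg_cong[OF com, of "\<lambda>T. blinfun_apply T _"] by (auto simp: D_def)
  define \<kappa> where "\<kappa> = 2 * norm N"
  define step where "step \<mu> X = X + scaleC_op \<mu> (\<delta> X)" for \<mu> X
  have stepD: "step \<mu> X \<in> D" if "X \<in> D" for \<mu> X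
    using that N' by (auto simp: D_def step_def \<delta>_def blinfun.bilinear_simps NN'[symmetric]
        scaleC.diff_right bounded_operatorsD[OF N])
  have step_norm: "norm (step \<mu> X) \<le> (1 + 2 * (cmod \<mu>)\<^sup>2 * \<kappa>\<^sup>2) * norm X" if X: "X \<in> D" for \<mu> X
  proof -
    define s where "s = cmod \<mu>"
    obtain u where u: "cmod u = 1" "\<mu> = of_real s * u"
    proof (cases "\<mu> = 0")
      case False
      then show ?thesis
        using that[of "\<mu> / of_real s"] by (simp add: s_def norm_divide)
    qed (use that[of 1] in \<open>simp add: s_def\<close>)
    \<comment> \<open>As N commutes with X, subtracting a multiple of N leaves the commutator with X
      unchanged and makes K skew-adjoint.\<close>
    define K where "K = scaleC_op u N' - scaleC_op (cnj u) N"
    have skew: "cinner (K x) y = - cinner x (K y)" for x y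
      by (simp add: K_def blinfun.diff_left cinner.diff_left cinner.diff_right cinner_scaleC_left
          cinner_scaleC_right adj)
    have "norm K \<le> \<kappa>"
      using norm_triangle_ineq4[of "scaleC_op u N'" "scaleC_op (cnj u) N"] N'(2) u(1)
      by (simp add: K_def norm_scaleC_op \<kappa>_def)
    from norm_add_commutator_skew_le[OF skew this, of X s]
    have "norm (X + s *\<^sub>R ((K o\<^sub>L X) - (X o\<^sub>L K))) \<le> (1 + 2 * s\<^sup>2 * \<kappa>\<^sup>2) * norm X" .
    moreover have "X + s *\<^sub>R ((K o\<^sub>L X) - (X o\<^sub>L K)) = step \<mu> X"
    proof (rule blinfun_eqI)
      fix x
      show "blinfun_apply (X + s *\<^sub>R ((K o\<^sub>L X) - (X o\<^sub>L K))) x = blinfun_apply (step \<mu> X) x"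
        using X by (simp add: K_def step_def \<delta>_def D_def u(2) blinfun.bilinear_simps bounded_operatorsD
            scaleR_scaleC scaleC_scaleC scaleC.diff_right algebra_simps)
    qed
    ultimately show ?thesis
      by (simp add: s_def)
  qed
  have iter: "(step \<mu> ^^ k) P \<in> D \<and> norm ((step \<mu> ^^ k) P) \<le> (1 + 2 * (cmod \<mu>)\<^sup>2 * \<kappa>\<^sup>2) ^ k * norm P" for \<mu> k
  proof (induction k)
    case (Suc k)
    have "norm (step \<mu> ((step \<mu> ^^ k) P)) \<le> (1 + 2 * (cmod \<mu>)\<^sup>2 * \<kappa>\<^sup>2) * norm ((step \<mu> ^^ k) P)"
      by (rule step_norm) (use Suc in blast)
    also have "\<dots> \<le> (1 + 2 * (cmod \<mu>)\<^sup>2 * \<kappa>\<^sup>2) * ((1 + 2 * (cmod \<mu>)\<^sup>2 * \<kappa>\<^sup>2) ^ k * norm P)"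
      using Suc by (intro mult_left_mono) auto
    finally show ?case
      using Suc stepD by (simp add: mult.assoc)
  qed (use PD in simp)
  \<comment> \<open>The coefficients of (1 + \<mu> \<delta>)^k P as a polynomial in \<mu>, by
    Pascal's rule; the linear one is k \<delta> P.\<close>
  define co :: "nat \<Rightarrow> nat \<Rightarrow> 'a \<Rightarrow>\<^sub>L 'a" where
    "co = rec_nat (\<lambda>j. if j = 0 then P else 0) (\<lambda>k c j. c j + (if j = 0 then 0 else \<delta> (c (j - 1))))"
  have co_0: "co 0 j = (if j = 0 then P else 0)" and
    co_Suc: "co (Suc k) j = co k j + (if j = 0 then 0 else \<delta> (co k (j - 1)))" for k j
    by (simp_all add: co_def)
  have \<delta>0: "\<delta> 0 = 0"
    by (simp add: \<delta>_def)
  have co_gt: "co k j = 0" if "k < j" for k j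
    using that by (induction k arbitrary: j) (auto simp: co_0 co_Suc \<delta>0)
  have co_k0: "co k 0 = P" for k
    by (induction k) (simp_all add: co_0 co_Suc)
  have co_k1: "co k 1 = real k *\<^sub>R \<delta> P" for k
    by (induction k) (simp_all add: co_0 co_Suc co_k0 scaleR_left_distrib)
  have \<delta>_apply: "blinfun_apply (\<delta> X) x = N' (X x) - X (N' x)" for X x
    by (simp add: \<delta>_def blinfun.diff_left)
  have expand: "blinfun_apply ((step \<mu> ^^ k) P) x = (\<Sum>j\<le>k. \<mu> ^ j *\<^sub>C blinfun_apply (co k j) x)" for \<mu> k x
  proof (induction k arbitrary: x)
    case (Suc k)
    have "blinfun_apply ((step \<mu> ^^ Suc k) P) x =
        (\<Sum>j\<le>k. \<mu> ^ j *\<^sub>C co k j x) + (\<Sum>j\<le>k. \<mu> ^ Suc j *\<^sub>C \<delta> (co k j) x)"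
      by (simp add: step_def \<delta>_apply blinfun.add_left Suc blinfun.sum_right bounded_operatorsD[OF N'(1)]
          sum_subtractf[symmetric] scaleC.sum_right scaleC.diff_right scaleC_scaleC)
    also have "(\<Sum>j\<le>k. \<mu> ^ j *\<^sub>C co k j x) = (\<Sum>j\<le>Suc k. \<mu> ^ j *\<^sub>C co k j x)"
      by (simp add: co_gt)
    also have "(\<Sum>j\<le>k. \<mu> ^ Suc j *\<^sub>C \<delta> (co k j) x) =
        (\<Sum>j\<le>Suc k. \<mu> ^ j *\<^sub>C blinfun_apply (if j = 0 then 0 else \<delta> (co k (j - 1))) x)"
      by (subst sum.atMost_Suc_shift) simp
    finally show ?case
      by (simp only: co_Suc blinfun.add_left scaleC_add_right sum.distrib)
  qed (simp add: co_0 scaleC_one)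
  have "cinner (\<delta> P x) y = 0" for x y
  proof -
    define C where "C = exp (2 * \<kappa>\<^sup>2) * norm P * norm x * norm y"
    have "sqrt (real (Suc l)) * cmod (cinner (\<delta> P x) y) \<le> C" for l
    proof -
      define m where "m = Suc l"
      have m: "1 \<le> m" "0 < real m"
        by (simp_all add: m_def)
      \<comment> \<open>The substitution \<mu> = z / m makes the linear coefficient independent of
        m, while the radius root m grows; an estimate valid for all m forces that coefficient to be
        0.\<close>
      define c where "c j = cinner (co m j x) y / of_nat m ^ j" for j
      have "cmod (c 1) * sqrt (real m) \<le> C"
      proof (rule linear_coefficient_bound[OF m(1)])
        show "0 < sqrt (real m)"
          using m by simp
        fix z assume z: "cmod z = sqrt (real m)"
        have "(\<Sum>j\<le>m. c j * z ^ j) = cinner ((step (z / of_nat m) ^^ m) P x) y"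
          by (simp add: expand cinner.sum_left cinner_scaleC_left c_def power_divide mult.commute)
        also have "cmod \<dots> \<le> norm ((step (z / of_nat m) ^^ m) P x) * norm y"
          by (rule cauchy_schwarz)
        also have "\<dots> \<le> (exp (2 * \<kappa>\<^sup>2) * norm P * norm x) * norm y"
        proof (rule mult_right_mono)
          have "2 * (cmod (z / of_nat m))\<^sup>2 * \<kappa>\<^sup>2 = 2 * \<kappa>\<^sup>2 / real m"
            using z m by (simp add: norm_divide power_divide power2_eq_square)
          then have "norm ((step (z / of_nat m) ^^ m) P) \<le> (1 + 2 * \<kappa>\<^sup>2 / real m) ^ m * norm P"
            using iter[where \<mu> = "z / of_nat m" and k = m] by simp
          also have "\<dots> \<le> exp (2 * \<kappa>\<^sup>2) * norm P"
          proof (intro mult_right_mono exp_ge_one_plus_x_over_n_power_n)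
            show "- real m \<le> 2 * \<kappa>\<^sup>2"
              using zero_le_power2[of \<kappa>] m by linarith
          qed (use m in auto)
          finally show "norm ((step (z / of_nat m) ^^ m) P x) \<le> exp (2 * \<kappa>\<^sup>2) * norm P * norm x"
            using order_trans[OF norm_blinfun mult_right_mono[OF _ norm_ge_zero]] by blast
        qed simp
        finally show "cmod (\<Sum>j\<le>m. c j * z ^ j) \<le> C"
          by (simp add: C_def)
      qed
      moreover have "c 1 = cinner (\<delta> P x) y"
        using m by (simp add: c_def co_k1[unfolded One_nat_def] blinfun.scaleR_left cinner.scaleR_left scaleR_conv_of_real)
      ultimately show ?thesis
        by (simp add: m_def mult.commute)
    qed
    note le = this
    have "real l * (cmod (cinner (\<delta> P x) y))\<^sup>2 \<le> C\<^sup>2" for l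
    proof -
      have "real l * (cmod (cinner (\<delta> P x) y))\<^sup>2 \<le> (sqrt (real (Suc l)) * cmod (cinner (\<delta> P x) y))\<^sup>2"
        by (simp add: power_mult_distrib mult_right_mono)
      also have "\<dots> \<le> C\<^sup>2"
        using le by (intro power_mono) auto
      finally show ?thesis .
    qed
    then have "(cmod (cinner (\<delta> P x) y))\<^sup>2 = 0"
      by (intro real_archimedian_rdiv_eq_0[of _ "C\<^sup>2"]) auto
    then show ?thesis by simp
  qed
  then have "\<delta> P x = 0" for x
    using cinner_ext[of "\<delta> P x" 0] by simp
  then show ?thesis
    by (intro blinfun_eqI) (simp add: \<delta>_apply N'_def)
qed

section \<open>Separating states\<close>

definition sublinear :: "('v::real_vector \<Rightarrow> real) \<Rightarrow> bool"
  where "sublinear q \<longleftrightarrow> (\<forall>x y. q (x + y) \<le> q x + q y) \<and> (\<forall>r>0. \<forall>x. q (r *\<^sub>R x) \<le> r * q x)"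

lemma sublinear_scaleR:
  assumes q: "sublinear q" and r: "0 \<le> r"
  shows "q (r *\<^sub>R x) = r * q x"
proof (cases "r = 0")
  case True
  have "q 0 \<le> q 0 + q 0"
    using q unfolding sublinear_def by (metis add.right_neutral)
  moreover have "q ((1/2) *\<^sub>R 0) \<le> (1/2) * q 0"
    using q unfolding sublinear_def by (meson half_gt_zero zero_less_one)
  ultimately have "q 0 = 0"
    by simp
  then show ?thesis
    using True by simp
next
  case False
  then have r: "0 < r"
    using r by simp
  have "q (inverse r *\<^sub>R (r *\<^sub>R x)) \<le> inverse r * q (r *\<^sub>R x)"
    using q r unfolding sublinear_def by (meson positive_imp_inverse_positive)
  then have "r * q x \<le> q (r *\<^sub>R x)"
    using r by (simp add: field_simps)
  moreover have "q (r *\<^sub>R x) \<le> r * q x"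
    using q r unfolding sublinear_def by blast
  ultimately show ?thesis by simp
qed

lemma sublinear_zero: "sublinear q \<Longrightarrow> q 0 = 0"
  using sublinear_scaleR[of q 0 0] by simp

lemma sublinear_add: "sublinear q \<Longrightarrow> q (x + y) \<le> q x + q y"
  by (simp add: sublinear_def)

lemma sublinear_minus: "sublinear q \<Longrightarrow> - q (- x) \<le> q x"
  using sublinear_add[of q x "- x"] sublinear_zero[of q] by simp

text \<open>The infimum over a chain is finite because every q in it is bounded below by - p (- x);
  comparability within the chain makes the infimum subadditive.\<close>

lemma ex_minimal_sublinear:
  fixes p :: "'v::real_vector \<Rightarrow> real"
  assumes p: "sublinear p"
  shows "\<exists>q. sublinear q \<and> (\<forall>x. q x \<le> p x) \<and> (\<forall>q'. sublinear q' \<longrightarrow> (\<forall>x. q' x \<le> q x) \<longrightarrow> q' = q)"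
proof -
  define Q where "Q = {q. sublinear q \<and> (\<forall>x. q x \<le> p x)}"
  define le where "le q q' \<longleftrightarrow> (\<forall>x. q' x \<le> q x)" for q q' :: "'v \<Rightarrow> real"
  have "\<exists>m\<in>Q. \<forall>a\<in>Q. le m a \<longrightarrow> a = m"
  proof (rule predicate_Zorn)
    show "partial_order_on Q (relation_of le Q)"
      by (rule partial_order_on_relation_ofI) (auto simp: le_def fun_eq_iff intro: antisym order_trans)
    fix C assume C: "C \<in> Chains (relation_of le Q)"
    then have CQ: "C \<subseteq> Q"
      by (auto simp: Chains_def relation_of_def)
    have ch: "(\<forall>x. q x \<le> q' x) \<or> (\<forall>x. q' x \<le> q x)" if "q \<in> C" "q' \<in> C" for q q'
      using C that by (auto simp: Chains_def relation_of_def le_def)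
    show "\<exists>u\<in>Q. \<forall>a\<in>C. le a u"
    proof (cases "C = {}")
      case True
      then show ?thesis
        using p by (auto simp: Q_def)
    next
      case False
      define u where "u x = (INF q\<in>C. q x)" for x
      have bdd: "bdd_below ((\<lambda>q. q x) ` C)" for x
      proof (rule bdd_belowI2)
        fix q assume "q \<in> C"
        then have "sublinear q" "q (- x) \<le> p (- x)"
          using CQ by (auto simp: Q_def)
        then show "- p (- x) \<le> q x"
          using sublinear_minus[of q x] by simp
      qed
      have u_le: "u x \<le> q x" if "q \<in> C" for q x
        unfolding u_def using that by (rule cINF_lower[OF bdd])
      have u_ge: "b \<le> u x" if "\<And>q. q \<in> C \<Longrightarrow> b \<le> q x" for b x
        unfolding u_def using False that by (rule cINF_greatest)
      have "sublinear u"
        unfolding sublinear_def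
      proof (intro conjI allI impI)
        fix x y
        have "u (x + y) - q y \<le> u x" if q: "q \<in> C" for q
        proof (rule u_ge)
          fix q' assume q': "q' \<in> C"
          obtain s where s: "s \<in> C" "s x \<le> q' x" "s y \<le> q y"
            using ch[OF q q'] q q' by auto
          have "u (x + y) \<le> s (x + y)"
            by (rule u_le[OF s(1)])
          also have "\<dots> \<le> s x + s y"
            using s(1) CQ by (intro sublinear_add) (auto simp: Q_def)
          finally show "u (x + y) - q y \<le> q' x"
            using s by simp
        qed
        then have "u (x + y) - u x \<le> u y"
          by (intro u_ge) (simp add: algebra_simps)
        then show "u (x + y) \<le> u x + u y" by simp
      next
        fix r :: real and x assume r: "0 < r"
        have "u (r *\<^sub>R x) / r \<le> u x"
        proof (rule u_ge)
          fix q assume q: "q \<in> C"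
          then have "q (r *\<^sub>R x) = r * q x"
            using CQ r by (intro sublinear_scaleR) (auto simp: Q_def)
          then show "u (r *\<^sub>R x) / r \<le> q x"
            using u_le[OF q, of "r *\<^sub>R x"] r by (simp add: divide_le_eq mult.commute)
        qed
        then show "u (r *\<^sub>R x) \<le> r * u x"
          using r by (simp add: divide_le_eq mult.commute)
      qed
      moreover have "u x \<le> p x" for x
      proof -
        obtain q where q: "q \<in> C"
          using False by blast
        then show ?thesis
          using u_le[OF q, of x] CQ by (auto simp: Q_def intro: order_trans)
      qed
      ultimately show ?thesis
        using u_le by (auto simp: Q_def le_def)
    qed
  qed
  then obtain q where q: "q \<in> Q" "\<And>a. a \<in> Q \<Longrightarrow> le q a \<Longrightarrow> a = q"
    by blast
  have "q' = q" if "sublinear q'" "\<forall>x. q' x \<le> q x" for q'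
    using that q(1) by (intro q(2)) (auto simp: Q_def le_def intro: order_trans)
  then show ?thesis
    using q(1) by (auto simp: Q_def)
qed

text \<open>A minimal sublinear functional q is linear: lowering it along the direction x, as in
  \<open>q'\<close>, gives a sublinear functional below q, hence q itself, and the value at - x with
  t = 1 yields q (- x) \<le> - q x.\<close>

theorem hahn_banach_sublinear:
  fixes p :: "'v::real_vector \<Rightarrow> real"
  assumes p: "sublinear p"
  shows "\<exists>f. linear f \<and> (\<forall>x. f x \<le> p x)"
proof -
  obtain q where q: "sublinear q" "\<And>x. q x \<le> p x"
    and min: "\<And>q'. sublinear q' \<Longrightarrow> (\<And>x. q' x \<le> q x) \<Longrightarrow> q' = q"
    using ex_minimal_sublinear[OF p] by blast
  have neg: "q (- x) = - q x" for x
  proof -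
    define X where "X y = (\<lambda>t. q (y + t *\<^sub>R x) - t * q x) ` {0..}" for y
    define q' where "q' y = Inf (X y)" for y
    have lower: "- q (- y) \<le> q (y + t *\<^sub>R x) - t * q x" if "0 \<le> t" for y t
      using sublinear_add[OF q(1), of "y + t *\<^sub>R x" "- y"] sublinear_scaleR[OF q(1) that, of x] by simp
    have bdd: "bdd_below (X y)" for y
      unfolding X_def by (rule bdd_belowI2) (use lower in simp)
    have le: "q' y \<le> q (y + t *\<^sub>R x) - t * q x" if "0 \<le> t" for y t
      unfolding q'_def by (rule cInf_lower[OF _ bdd]) (use that in \<open>auto simp: X_def\<close>)
    have ge: "b \<le> q' y" if "\<And>t. 0 \<le> t \<Longrightarrow> b \<le> q (y + t *\<^sub>R x) - t * q x" for b y
      unfolding q'_def by (rule cInf_greatest) (use that in \<open>auto simp: X_def\<close>)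
    have "sublinear q'"
      unfolding sublinear_def
    proof (intro conjI allI impI)
      fix y z
      have "q' (y + z) - (q (z + s *\<^sub>R x) - s * q x) \<le> q' y" if s: "0 \<le> s" for s
      proof (rule ge)
        fix t :: real assume t: "0 \<le> t"
        have "q' (y + z) \<le> q ((y + z) + (t + s) *\<^sub>R x) - (t + s) * q x"
          by (rule le) (use s t in simp)
        also have "(y + z) + (t + s) *\<^sub>R x = (y + t *\<^sub>R x) + (z + s *\<^sub>R x)"
          by (simp add: algebra_simps)
        also have "q \<dots> \<le> q (y + t *\<^sub>R x) + q (z + s *\<^sub>R x)"
          by (rule sublinear_add[OF q(1)])
        finally show "q' (y + z) - (q (z + s *\<^sub>R x) - s * q x) \<le> q (y + t *\<^sub>R x) - t * q x"
          by (simp add: algebra_simps)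
      qed
      then have "q' (y + z) - q' y \<le> q' z"
        by (intro ge) (simp add: algebra_simps)
      then show "q' (y + z) \<le> q' y + q' z" by simp
    next
      fix r :: real and y assume r: "0 < r"
      have "q' (r *\<^sub>R y) / r \<le> q' y"
      proof (rule ge)
        fix t :: real assume t: "0 \<le> t"
        have "q' (r *\<^sub>R y) \<le> q (r *\<^sub>R y + (r * t) *\<^sub>R x) - (r * t) * q x"
          by (rule le) (use r t in simp)
        also have "r *\<^sub>R y + (r * t) *\<^sub>R x = r *\<^sub>R (y + t *\<^sub>R x)"
          by (simp add: scaleR_right_distrib)
        also have "q \<dots> = r * q (y + t *\<^sub>R x)"
          using r by (intro sublinear_scaleR[OF q(1)]) simp
        finally have "q' (r *\<^sub>R y) \<le> r * (q (y + t *\<^sub>R x) - t * q x)"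
          by (simp add: algebra_simps)
        then show "q' (r *\<^sub>R y) / r \<le> q (y + t *\<^sub>R x) - t * q x"
          using r by (simp add: divide_le_eq mult.commute)
      qed
      then show "q' (r *\<^sub>R y) \<le> r * q' y"
        using r by (simp add: divide_le_eq mult.commute)
    qed
    moreover have "q' y \<le> q y" for y
      using le[of 0 y] by simp
    ultimately have "q' = q"
      by (rule min)
    then have "q (- x) \<le> - q x"
      using le[of 1 "- x"] sublinear_zero[OF q(1)] by simp
    then show ?thesis
      using sublinear_minus[OF q(1), of x] by simp
  qed
  have "linear q"
  proof (rule linearI)
    fix x y
    show "q (x + y) = q x + q y"
      using sublinear_add[OF q(1), of x y] sublinear_add[OF q(1), of "- x" "- y"] neg[of "x + y"] neg[of x] neg[of y]
      by simp
  next
    fix r :: real and x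
    show "q (r *\<^sub>R x) = r *\<^sub>R q x"
    proof (cases "0 \<le> r")
      case True
      then show ?thesis
        by (simp add: sublinear_scaleR[OF q(1)])
    next
      case False
      then show ?thesis
        using sublinear_scaleR[OF q(1), of "- r" x] neg[of "r *\<^sub>R x"] by simp
    qed
  qed
  with q(2) show ?thesis by blast
qed

text \<open>The state is obtained by separating \<open>0\<close> from the convex hull of the quadratic forms
  \<open>x \<mapsto> \<parallel>(S - a) x\<parallel>\<^sup>2 - d\<^sup>2 \<parallel>x\<parallel>\<^sup>2\<close>, which is possible because the norm square is convex.\<close>

lemma ex_separating_state:
  fixes A :: "('a::complex_hilbert_space \<Rightarrow>\<^sub>L 'a) set"
  assumes A: "convex A" "A \<noteq> {}" and S: "S \<in> bounded_operators" "A \<subseteq> bounded_operators"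
    and d: "0 < d" "\<And>a. a \<in> A \<Longrightarrow> d \<le> norm (S - a)"
  shows "\<exists>f. linear f \<and> (\<forall>T s. (\<forall>x. Re (cinner (blinfun_apply T x) x) \<le> s * (norm x)\<^sup>2) \<longrightarrow> f T \<le> s) \<and>
    (\<forall>a\<in>A. d\<^sup>2 \<le> f (cadj (S - a) o\<^sub>L (S - a)))"
proof -
  \<comment> \<open>The infimum of \<open>X T\<close> is the least upper bound for T after adding a
    nonnegative multiple t of one of the separated forms. For a linear f below it, t = 0 gives the
    bound f T \<le> s of a state, and t = 1 with T the negative of
    \<open>cadj (S - a) o\<^sub>L (S - a)\<close> gives the lower bound d^2.\<close>
  define X where "X T = {s. \<exists>t\<ge>0. \<exists>a\<in>A. \<forall>x. Re (cinner (blinfun_apply T x) x) +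
    t * ((norm (blinfun_apply (S - a) x))\<^sup>2 - d\<^sup>2 * (norm x)\<^sup>2) \<le> s * (norm x)\<^sup>2}" for T
  define p where "p T = Inf (X T)" for T
  have re: "\<bar>Re (cinner (T x) x)\<bar> \<le> norm T * (norm x)\<^sup>2" for T :: "'a \<Rightarrow>\<^sub>L 'a" and x
    using order_trans[OF abs_Re_le_cmod order_trans[OF cauchy_schwarz mult_right_mono[OF norm_blinfun norm_ge_zero]]]
    by (simp add: power2_eq_square mult.assoc)
  \<comment> \<open>Finiteness of p, where the distance enters: a value of s below - norm T bounds t
    times the square of the norm of (S - a) x by t d^2 - e times that of x, which would make the
    norm of S - a smaller than d. The case distinctions also cover t = 0 and the zero space.\<close>
  have lower: "- norm T \<le> s" if s: "s \<in> X T" for s T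
  proof (rule ccontr)
    assume "\<not> - norm T \<le> s"
    define e where "e = - (s + norm T)"
    have e: "0 < e"
      using \<open>\<not> - norm T \<le> s\<close> by (simp add: e_def)
    obtain t a where t: "0 \<le> t" "a \<in> A" "\<And>x. Re (cinner (T x) x) + t * ((norm ((S - a) x))\<^sup>2 - d\<^sup>2 * (norm x)\<^sup>2) \<le> s * (norm x)\<^sup>2"
      using s unfolding X_def by blast
    have *: "t * (norm ((S - a) x))\<^sup>2 \<le> (t * d\<^sup>2 - e) * (norm x)\<^sup>2" for x
      using t(3)[of x] re[of T x] by (simp add: e_def algebra_simps)
    have "norm (S - a) < d"
    proof (cases "0 < t * d\<^sup>2 - e")
      case True
      then have t0: "0 < t"
        using t(1) e by (cases "t = 0") auto
      define \<eta> where "\<eta> = sqrt (d\<^sup>2 - e / t)"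
      have pos: "0 \<le> d\<^sup>2 - e / t"
        using True t0 by (simp add: field_simps)
      have "norm (S - a) \<le> \<eta>"
      proof (rule norm_blinfun_bound)
        fix x
        have "(norm ((S - a) x))\<^sup>2 \<le> (d\<^sup>2 - e / t) * (norm x)\<^sup>2"
          using *[of x] t0 by (simp add: field_simps)
        also have "\<dots> = (\<eta> * norm x)\<^sup>2"
          using pos by (simp add: \<eta>_def power_mult_distrib)
        finally show "norm ((S - a) x) \<le> \<eta> * norm x"
          by (rule power2_le_imp_le) (use pos in \<open>simp add: \<eta>_def\<close>)
      qed (use pos in \<open>simp add: \<eta>_def\<close>)
      also have "\<eta> < d"
      proof -
        have "sqrt (d\<^sup>2 - e / t) < sqrt (d\<^sup>2)"
          using e t0 by (intro real_sqrt_less_mono) simp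
        then show ?thesis
          using d(1) by (simp add: \<eta>_def)
      qed
      finally show ?thesis .
    next
      case False
      have "x = 0" for x :: 'a
      proof (cases "0 = t * d\<^sup>2 - e")
        case True
        then have t0: "0 < t"
          using t(1) e by (cases "t = 0") auto
        have "t * (norm ((S - a) y))\<^sup>2 \<le> 0" for y
          using *[of y] True by simp
        then have "(S - a) y = 0" for y
          using t0 by (simp add: mult_le_0_iff)
        then have "S - a = 0"
          by (intro blinfun_eqI) simp
        then show ?thesis
          using d(1) d(2)[OF t(2)] by simp
      next
        case f: False
        have "0 \<le> (t * d\<^sup>2 - e) * (norm x)\<^sup>2"
          by (rule order_trans[OF _ *]) (use t(1) in simp)
        then show ?thesis
          using False f by (simp add: zero_le_mult_iff)
      qed
      then have "S - a = 0"
        by (intro blinfun_eqI) (metis blinfun.zero_left)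
      then show ?thesis
        using d(1) by simp
    qed
    with d(2)[OF t(2)] show False by simp
  qed
  have ne: "norm T \<in> X T" for T
  proof -
    obtain a where "a \<in> A" using A(2) by blast
    then show ?thesis
      unfolding X_def using re[of T] by (auto intro!: exI[of _ 0] simp: abs_le_iff)
  qed
  have bdd: "bdd_below (X T)" for T
    using lower by (rule bdd_belowI)
  have p_le: "p T \<le> s" if "s \<in> X T" for s T
    unfolding p_def by (rule cInf_lower[OF that bdd])
  have p_ge: "b \<le> p T" if "\<And>s. s \<in> X T \<Longrightarrow> b \<le> s" for b T
    unfolding p_def by (rule cInf_greatest) (use ne that in auto)
  have X_add: "s1 + s2 \<in> X (T1 + T2)" if s1: "s1 \<in> X T1" and s2: "s2 \<in> X T2" for s1 s2 T1 T2
  proof -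
    obtain t1 a1 where 1: "0 \<le> t1" "a1 \<in> A" "\<And>x. Re (cinner (T1 x) x) + t1 * ((norm ((S - a1) x))\<^sup>2 - d\<^sup>2 * (norm x)\<^sup>2) \<le> s1 * (norm x)\<^sup>2"
      using s1 unfolding X_def by blast
    obtain t2 a2 where 2: "0 \<le> t2" "a2 \<in> A" "\<And>x. Re (cinner (T2 x) x) + t2 * ((norm ((S - a2) x))\<^sup>2 - d\<^sup>2 * (norm x)\<^sup>2) \<le> s2 * (norm x)\<^sup>2"
      using s2 unfolding X_def by blast
    \<comment> \<open>Convexity of the squared norm: the form at the mean of a1 and a2 with weights
      proportional to t1 and t2 lies below the sum of the two forms.\<close>
    have "\<exists>a\<in>A. \<forall>x. (t1 + t2) * (norm ((S - a) x))\<^sup>2 \<le> t1 * (norm ((S - a1) x))\<^sup>2 + t2 * (norm ((S - a2) x))\<^sup>2"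
    proof (cases "t1 + t2 = 0")
      case True
      then show ?thesis
        using 1 2 by (intro bexI[of _ a1]) auto
    next
      case False
      then have t: "0 < t1 + t2"
        using 1(1) 2(1) by simp
      define u where "u = t1 / (t1 + t2)"
      define w where "w = t2 / (t1 + t2)"
      have uw: "0 \<le> u" "0 \<le> w" "u + w = 1" "(t1 + t2) * u = t1" "(t1 + t2) * w = t2"
        using t 1(1) 2(1) by (simp_all add: u_def w_def add_divide_distrib[symmetric])
      define a where "a = u *\<^sub>R a1 + w *\<^sub>R a2"
      have "a \<in> A"
        unfolding a_def using A(1) 1(2) 2(2) uw by (simp add: convex_def)
      moreover have "(t1 + t2) * (norm ((S - a) x))\<^sup>2 \<le> t1 * (norm ((S - a1) x))\<^sup>2 + t2 * (norm ((S - a2) x))\<^sup>2" for x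
      proof -
        define v1 where "v1 = (S - a1) x"
        define v2 where "v2 = (S - a2) x"
        have "(S - a) x = (u + w) *\<^sub>R S x - a x"
          unfolding uw(3) by (simp add: blinfun.diff_left)
        then have eq: "(S - a) x = u *\<^sub>R v1 + w *\<^sub>R v2"
          by (simp add: a_def v1_def v2_def blinfun.bilinear_simps algebra_simps)
        have "norm ((S - a) x) \<le> u * norm v1 + w * norm v2"
          unfolding eq using norm_triangle_ineq[of "u *\<^sub>R v1" "w *\<^sub>R v2"] uw by simp
        then have "(norm ((S - a) x))\<^sup>2 \<le> (u * norm v1 + w * norm v2)\<^sup>2"
          by (intro power_mono) auto
        also have "\<dots> \<le> u * (norm v1)\<^sup>2 + w * (norm v2)\<^sup>2"
        proof -
          have "u * (norm v1)\<^sup>2 + w * (norm v2)\<^sup>2 - (u * norm v1 + w * norm v2)\<^sup>2 = u * w * (norm v1 - norm v2)\<^sup>2"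
          proof -
            have w: "w = 1 - u"
              using uw(3) by simp
            show ?thesis
              unfolding w by (simp add: power2_eq_square algebra_simps)
          qed
          moreover have "0 \<le> u * w * (norm v1 - norm v2)\<^sup>2"
            using uw by simp
          ultimately show ?thesis by linarith
        qed
        finally have "(t1 + t2) * (norm ((S - a) x))\<^sup>2 \<le> (t1 + t2) * (u * (norm v1)\<^sup>2 + w * (norm v2)\<^sup>2)"
          using t by (intro mult_left_mono) auto
        also have "\<dots> = ((t1 + t2) * u) * (norm v1)\<^sup>2 + ((t1 + t2) * w) * (norm v2)\<^sup>2"
          by (simp add: algebra_simps)
        finally show ?thesis
          unfolding uw(4,5) v1_def v2_def .
      qed
      ultimately show ?thesis by blast
    qed
    then obtain a where a: "a \<in> A" "\<And>x. (t1 + t2) * (norm ((S - a) x))\<^sup>2 \<le> t1 * (norm ((S - a1) x))\<^sup>2 + t2 * (norm ((S - a2) x))\<^sup>2"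
      by blast
    have "Re (cinner ((T1 + T2) x) x) + (t1 + t2) * ((norm ((S - a) x))\<^sup>2 - d\<^sup>2 * (norm x)\<^sup>2) \<le> (s1 + s2) * (norm x)\<^sup>2" for x
      using 1(3)[of x] 2(3)[of x] a(2)[of x] by (simp add: blinfun.add_left cinner_add_left algebra_simps)
    then show ?thesis
      unfolding X_def using a(1) 1(1) 2(1) by (intro CollectI exI[of _ "t1 + t2"]) auto
  qed
  have X_scale: "r * s \<in> X (r *\<^sub>R T)" if s: "s \<in> X T" and r: "0 < r" for s r T
  proof -
    obtain t a where t: "0 \<le> t" "a \<in> A" "\<And>x. Re (cinner (T x) x) + t * ((norm ((S - a) x))\<^sup>2 - d\<^sup>2 * (norm x)\<^sup>2) \<le> s * (norm x)\<^sup>2"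
      using s unfolding X_def by blast
    have "Re (cinner ((r *\<^sub>R T) x) x) + (r * t) * ((norm ((S - a) x))\<^sup>2 - d\<^sup>2 * (norm x)\<^sup>2) \<le> r * s * (norm x)\<^sup>2" for x
      using mult_left_mono[OF t(3)[of x], of r] r
      by (simp add: blinfun.scaleR_left cinner.scaleR_left algebra_simps)
    then show ?thesis
      unfolding X_def using t(1,2) r by (intro CollectI exI[of _ "r * t"]) auto
  qed
  have "sublinear p"
    unfolding sublinear_def
  proof (intro conjI allI impI)
    fix T1 T2
    have "p (T1 + T2) - s2 \<le> p T1" if "s2 \<in> X T2" for s2
      using p_le[OF X_add[OF _ that]] by (intro p_ge) (simp add: algebra_simps)
    then have "p (T1 + T2) - p T1 \<le> p T2"
      by (intro p_ge) (simp add: algebra_simps)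
    then show "p (T1 + T2) \<le> p T1 + p T2"
      by simp
  next
    fix r :: real and T assume r: "0 < r"
    have "p (r *\<^sub>R T) / r \<le> p T"
      using p_le[OF X_scale[OF _ r]] r by (intro p_ge) (simp add: divide_le_eq mult.commute)
    then show "p (r *\<^sub>R T) \<le> r * p T"
      using r by (simp add: divide_le_eq mult.commute)
  qed
  then obtain f where f: "linear f" "\<And>T. f T \<le> p T"
    using hahn_banach_sublinear by blast
  have "f T \<le> s" if "\<forall>x. Re (cinner (blinfun_apply T x) x) \<le> s * (norm x)\<^sup>2" for T s
  proof -
    obtain a where "a \<in> A" using A(2) by blast
    then have "s \<in> X T"
      unfolding X_def using that by (intro CollectI exI[of _ 0]) auto
    then show ?thesis
      using f(2) p_le order_trans by blast
  qed
  moreover have "d\<^sup>2 \<le> f (cadj (S - a) o\<^sub>L (S - a))" if a: "a \<in> A" for a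
  proof -
    let ?U = "cadj (S - a) o\<^sub>L (S - a)"
    have Sa: "S - a \<in> bounded_operators"
      using S a by auto
    have "Re (cinner ((- ?U) x) x) + 1 * ((norm ((S - a) x))\<^sup>2 - d\<^sup>2 * (norm x)\<^sup>2) \<le> (- d\<^sup>2) * (norm x)\<^sup>2" for x
      by (simp add: blinfun.minus_left cinner.minus_left cadj(3)[OF Sa] norm_square_cinner)
    then have "- d\<^sup>2 \<in> X (- ?U)"
      unfolding X_def using a by (intro CollectI exI[of _ 1]) auto
    then have "f (- ?U) \<le> - d\<^sup>2"
      using f(2) p_le order_trans by blast
    then show ?thesis
      by (simp add: linear_neg[OF f(1)])
  qed
  ultimately show ?thesis
    using f(1) by blast
qed

section \<open>The Gelfand-Naimark-Segal representation\<close>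

text \<open>A map prescribed on possibly dependent vectors is given as a linear relation; the bound
  makes it single-valued and extends it to the closure of its domain. The value 0 on the orthogonal
  complement later controls the support of Gram vectors and puts the represented operators into
  \<open>operators_on L\<close>.\<close>

lemma bounded_relation_extends:
  fixes G :: "('a::complex_hilbert_space \<times> 'b::complex_hilbert_space) set"
  assumes zero: "(0, 0) \<in> G" and add: "\<And>x y x' y'. (x, y) \<in> G \<Longrightarrow> (x', y') \<in> G \<Longrightarrow> (x + x', y + y') \<in> G"
    and scale: "\<And>c x y. (x, y) \<in> G \<Longrightarrow> (c *\<^sub>C x, c *\<^sub>C y) \<in> G"
    and K: "0 \<le> K" "\<And>x y. (x, y) \<in> G \<Longrightarrow> norm y \<le> K * norm x"
  shows "\<exists>g. (\<forall>x x'. g (x + x') = g x + g x') \<and> (\<forall>c x. g (c *\<^sub>C x) = c *\<^sub>C g x) \<and>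
    (\<forall>x. norm (g x) \<le> K * norm x) \<and> (\<forall>x y. (x, y) \<in> G \<longrightarrow> g x = y) \<and>
    (\<forall>x\<in>orth (fst ` G). g x = 0) \<and> (\<forall>x. g x \<in> closure (snd ` G))"
proof -
  define H where "H = {(x, y). \<exists>s t. (\<forall>n::nat. (s n, t n) \<in> G) \<and> s \<longlonglongrightarrow> x \<and> t \<longlonglongrightarrow> y}"
  have HI: "(x, y) \<in> H" if "\<forall>n::nat. (s n, t n) \<in> G" "s \<longlonglongrightarrow> x" "t \<longlonglongrightarrow> y" for x y s t
    using that by (auto simp: H_def)
  have diff: "(x - x', y - y') \<in> G" if "(x, y) \<in> G" "(x', y') \<in> G" for x y x' y'
    using add[OF that(1) scale[OF that(2), of "-1"]] by (simp add: scaleC.minus_left scaleC_one)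
  have GH: "(x, y) \<in> H" if "(x, y) \<in> G" for x y
    unfolding H_def using that by (auto intro!: exI[of _ "\<lambda>_. x"] exI[of _ "\<lambda>_. y"])
  have Hadd: "(x + x', y + y') \<in> H" if h: "(x, y) \<in> H" "(x', y') \<in> H" for x y x' y'
  proof -
    obtain s t where 1: "\<And>n::nat. (s n, t n) \<in> G" "s \<longlonglongrightarrow> x" "t \<longlonglongrightarrow> y"
      using h(1) unfolding H_def by blast
    obtain s' t' where 2: "\<And>n::nat. (s' n, t' n) \<in> G" "s' \<longlonglongrightarrow> x'" "t' \<longlonglongrightarrow> y'"
      using h(2) unfolding H_def by blast
    have "\<forall>n. (s n + s' n, t n + t' n) \<in> G"
      using add 1(1) 2(1) by blast
    then show ?thesis
      by (rule HI) (intro tendsto_add 1 2)+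
  qed
  have Hscale: "(c *\<^sub>C x, c *\<^sub>C y) \<in> H" if h: "(x, y) \<in> H" for c x y
  proof -
    obtain s t where 1: "\<And>n::nat. (s n, t n) \<in> G" "s \<longlonglongrightarrow> x" "t \<longlonglongrightarrow> y"
      using h unfolding H_def by blast
    have "\<forall>n. (c *\<^sub>C s n, c *\<^sub>C t n) \<in> G"
      using scale 1(1) by blast
    then show ?thesis
      by (rule HI) (intro scaleC.tendsto tendsto_const 1)+
  qed
  have HK: "norm y \<le> K * norm x" if h: "(x, y) \<in> H" for x y
  proof -
    obtain s t where 1: "\<And>n::nat. (s n, t n) \<in> G" "s \<longlonglongrightarrow> x" "t \<longlonglongrightarrow> y"
      using h unfolding H_def by blast
    show ?thesis
    proof (rule LIMSEQ_le)
      show "(\<lambda>n. norm (t n)) \<longlonglongrightarrow> norm y" "(\<lambda>n. K * norm (s n)) \<longlonglongrightarrow> K * norm x"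
        by (intro tendsto_intros 1)+
      show "\<exists>N. \<forall>n\<ge>N. norm (t n) \<le> K * norm (s n)"
        using K(2)[OF 1(1)] by blast
    qed
  qed
  have Hu: "y = y'" if "(x, y) \<in> H" "(x, y') \<in> H" for x y y'
  proof -
    have "(x + (-1) *\<^sub>C x, y + (-1) *\<^sub>C y') \<in> H"
      using that Hadd Hscale by blast
    from HK[OF this] show ?thesis
      by (simp add: scaleC.minus_left scaleC_one)
  qed
  have Hc: "y \<in> closure (snd ` G)" if "(x, y) \<in> H" for x y
    using that unfolding H_def closure_sequential by force
  have Hex: "\<exists>y. (x, y) \<in> H" if x: "x \<in> closure (fst ` G)" for x
  proof -
    obtain s where s: "\<And>n::nat. s n \<in> fst ` G" "s \<longlonglongrightarrow> x"
      using x unfolding closure_sequential by blast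
    have "\<forall>n. \<exists>y. (s n, y) \<in> G"
    proof
      fix n
      obtain p where "p \<in> G" "s n = fst p"
        using s(1)[of n] by blast
      then show "\<exists>y. (s n, y) \<in> G"
        by (intro exI[of _ "snd p"]) simp
    qed
    from choice[OF this] obtain t where t: "\<And>n. (s n, t n) \<in> G"
      by blast
    have "Cauchy t"
    proof (rule CauchyI)
      fix e :: real assume e: "0 < e"
      have "Cauchy s"
        using s(2) by (rule LIMSEQ_imp_Cauchy)
      then obtain N where N: "\<And>m n. m \<ge> N \<Longrightarrow> n \<ge> N \<Longrightarrow> norm (s m - s n) < e / (K + 1)"
        using CauchyD[of s "e / (K + 1)"] e K(1) by auto
      have "norm (t m - t n) < e" if "m \<ge> N" "n \<ge> N" for m n
      proof -
        have "norm (t m - t n) \<le> K * norm (s m - s n)"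
          using K(2)[OF diff[OF t[of m] t[of n]]] .
        also have "\<dots> \<le> (K + 1) * norm (s m - s n)"
          by (simp add: mult_right_mono)
        also have "\<dots> < e"
          using N[OF that] K(1) by (simp add: pos_less_divide_eq mult.commute)
        finally show ?thesis .
      qed
      then show "\<exists>N. \<forall>m\<ge>N. \<forall>n\<ge>N. norm (t m - t n) < e" by blast
    qed
    then obtain y where "t \<longlonglongrightarrow> y"
      using Cauchy_convergent_iff convergent_def by blast
    with t s(2) show ?thesis
      using HI by blast
  qed
  let ?W = "closure (fst ` G)"
  have "csubspace (fst ` G)"
  proof (rule complex_vector.subspaceI)
    show "0 \<in> fst ` G"
      using zero by force
    show "x + y \<in> fst ` G" if "x \<in> fst ` G" "y \<in> fst ` G" for x y
      using that add by force
    show "c *\<^sub>C x \<in> fst ` G" if "x \<in> fst ` G" for c x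
      using that scale by force
  qed
  then have W: "csubspace ?W" "closed ?W"
    by (simp_all add: csubspace_closure)
  note P = cproj[OF W]
  define g where "g x = (THE y. (cproj ?W x, y) \<in> H)" for x
  have g: "(cproj ?W x, g x) \<in> H" for x
    unfolding g_def by (rule theI') (use Hex[OF P(2)] Hu in blast)
  have gu: "g x = y" if "(cproj ?W x, y) \<in> H" for x y
    using Hu[OF g that] .
  have "g (x + x') = g x + g x'" for x x'
    by (rule gu) (simp add: blinfun.add_right Hadd g)
  moreover have "g (c *\<^sub>C x) = c *\<^sub>C g x" for c x
    by (rule gu) (simp add: bounded_operatorsD[OF P(1)] Hscale g)
  moreover have "norm (g x) \<le> K * norm x" for x
  proof -
    have "cinner (x - cproj ?W x) (cproj ?W x) = 0"
      using P(2)[of x] P(3)[of x] by (auto simp: orth_def)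
    from pythagoras[OF this] have "(norm (cproj ?W x))\<^sup>2 \<le> (norm x)\<^sup>2"
      by simp
    then have "norm (cproj ?W x) \<le> norm x"
      by (rule power2_le_imp_le) simp
    then show ?thesis
      using order_trans[OF HK[OF g] mult_left_mono[OF _ K(1)]] by blast
  qed
  moreover have "g x = y" if xy: "(x, y) \<in> G" for x y
  proof (rule gu)
    have "x \<in> ?W"
      using xy by (intro subsetD[OF closure_subset]) force
    then show "(cproj ?W x, y) \<in> H"
      using GH[OF xy] by (simp add: cproj_same[OF W])
  qed
  moreover have "g x = 0" if x: "x \<in> orth (fst ` G)" for x
  proof (rule gu)
    have "closure (fst ` G) \<subseteq> {y. cinner x y = 0}"
      using x by (intro closure_minimal closed_Collect_eq continuous_intros cinner.continuous_on) (auto simp: orth_def)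
    then have "x \<in> orth ?W"
      by (auto simp: orth_def)
    then show "(cproj ?W x, 0) \<in> H"
      using GH[OF zero] by (simp add: cproj_orth[OF W])
  qed
  ultimately show ?thesis
    using Hc[OF g] by (intro exI[of _ g]) blast
qed

text \<open>The optimal choice is t = - y / \<kappa>; for \<kappa> = 0 large multiples of - y show
  that the linear term vanishes.\<close>

lemma discriminant_bound:
  fixes y :: complex
  assumes "\<And>t. 0 \<le> N + 2 * Re (cnj t * y) + (cmod t)\<^sup>2 * \<kappa>" "0 \<le> \<kappa>" "0 \<le> N"
  shows "(cmod y)\<^sup>2 \<le> \<kappa> * N"
proof -
  have yy: "cnj y * y = of_real ((cmod y)\<^sup>2)"
    using complex_norm_square[of y] by (simp add: mult.commute)
  show ?thesis
  proof (cases "\<kappa> = 0")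
    case True
    have "real n * (2 * (cmod y)\<^sup>2) \<le> N" for n
    proof -
      have "cnj (- of_real (real n) * y) * y = - of_real (real n * (cmod y)\<^sup>2)"
        by (simp add: yy mult.assoc)
      from arg_cong[OF this, of Re]
      have "Re (cnj (- of_real (real n) * y) * y) = - (real n * (cmod y)\<^sup>2)"
        by (simp only: uminus_complex.sel Re_complex_of_real)
      with assms(1)[of "- of_real (real n) * y"] True show ?thesis
        by simp
    qed
    then have "2 * (cmod y)\<^sup>2 = 0"
      by (intro real_archimedian_rdiv_eq_0[of _ N]) auto
    then show ?thesis
      using True by simp
  next
    case False
    then have \<kappa>: "0 < \<kappa>"
      using assms(2) by simp
    have "cnj (- y / of_real \<kappa>) * y = - of_real ((cmod y)\<^sup>2 / \<kappa>)"
      by (simp add: yy)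
    from arg_cong[OF this, of Re]
    have re: "Re (cnj (- y / of_real \<kappa>) * y) = - ((cmod y)\<^sup>2 / \<kappa>)"
      by (simp only: uminus_complex.sel Re_complex_of_real)
    have "(cmod (- y / of_real \<kappa>))\<^sup>2 * \<kappa> = (cmod y)\<^sup>2 / \<kappa>"
      using \<kappa> by (simp add: norm_divide power_divide power2_eq_square)
    with assms(1)[of "- y / of_real \<kappa>"] re have "(cmod y)\<^sup>2 / \<kappa> \<le> N"
      by linarith
    then show ?thesis
      using \<kappa> by (simp add: divide_le_eq mult.commute)
  qed
qed

text \<open>Gram vectors are constructed one index at a time (Zorn), by a Gram-Schmidt step that uses the
  coordinate of the new index only. This keeps the index set fixed.\<close>

theorem gram_realization:
  fixes k :: "'i \<Rightarrow> 'i \<Rightarrow> complex"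
  assumes herm: "\<And>i j. i \<in> J \<Longrightarrow> j \<in> J \<Longrightarrow> k i j = cnj (k j i)"
    and psd: "\<And>F c. finite F \<Longrightarrow> F \<subseteq> J \<Longrightarrow> 0 \<le> Re (\<Sum>i\<in>F. \<Sum>j\<in>F. c i * cnj (c j) * k i j)"
  shows "\<exists>v :: 'i \<Rightarrow> ('i, complex) ell2. \<forall>i\<in>J. \<forall>j\<in>J. cinner (v i) (v j) = k i j"
proof -
  \<comment> \<open>M is the graph of the Gram vectors found so far. The third clause keeps each
    vector inside the coordinates of the indices already treated, so that the coordinate of a new
    index is still free.\<close>
  define good where "good M \<longleftrightarrow> fst ` M \<subseteq> J \<and>
    (\<forall>i x j y. (i, x) \<in> M \<longrightarrow> (j, y) \<in> M \<longrightarrow> cinner x y = k i j) \<and>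
    (\<forall>i x j. (i, x) \<in> M \<longrightarrow> j \<notin> fst ` M \<longrightarrow> ell2_nth x j = 0)" for M :: "('i \<times> ('i, complex) ell2) set"
  have "\<exists>M\<in>{M. good M}. \<forall>X\<in>{M. good M}. M \<subseteq> X \<longrightarrow> X = M"
  proof (rule subset_Zorn')
    fix C assume C: "subset.chain {M. good M} C"
    have g: "good M" if "M \<in> C" for M
      using C that unfolding subset.chain_def by blast
    have ch: "M \<subseteq> N \<or> N \<subseteq> M" if "M \<in> C" "N \<in> C" for M N
      using C that unfolding subset.chain_def by blast
    have "cinner x y = k i j" if ix: "(i, x) \<in> \<Union>C" and jy: "(j, y) \<in> \<Union>C" for i x j y
    proof -
      obtain M N where "M \<in> C" "N \<in> C" "(i, x) \<in> M" "(j, y) \<in> N"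
        using ix jy by blast
      then obtain L where "L \<in> C" "(i, x) \<in> L" "(j, y) \<in> L"
        using ch by blast
      then show ?thesis
        using g[of L] unfolding good_def by blast
    qed
    moreover have "ell2_nth x j = 0" if ix: "(i, x) \<in> \<Union>C" and j: "j \<notin> fst ` \<Union>C" for i x j
    proof -
      obtain M where M: "M \<in> C" "(i, x) \<in> M"
        using ix by blast
      moreover have "j \<notin> fst ` M"
        using j M(1) by blast
      ultimately show ?thesis
        using g[of M] unfolding good_def by blast
    qed
    moreover have "fst ` \<Union>C \<subseteq> J"
      using g unfolding good_def by blast
    ultimately show "\<Union>C \<in> {M. good M}"
      unfolding good_def by blast
  qed
  then obtain M where M: "good M" and max: "\<And>X. good X \<Longrightarrow> M \<subseteq> X \<Longrightarrow> X = M"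
    by blast
  have MJ: "fst ` M \<subseteq> J" and Mk: "\<And>i x j y. (i, x) \<in> M \<Longrightarrow> (j, y) \<in> M \<Longrightarrow> cinner x y = k i j"
    and Ms: "\<And>i x j. (i, x) \<in> M \<Longrightarrow> j \<notin> fst ` M \<Longrightarrow> ell2_nth x j = 0"
    using M unfolding good_def by blast+
  have "\<forall>i\<in>fst ` M. \<exists>x. (i, x) \<in> M"
    by force
  from bchoice[OF this] obtain v where v: "\<And>i. i \<in> fst ` M \<Longrightarrow> (i, v i) \<in> M"
    by blast
  have "fst ` M = J"
  proof (rule ccontr)
    assume "fst ` M \<noteq> J"
    then obtain i where i: "i \<in> J" "i \<notin> fst ` M"
      using MJ by blast
    define \<kappa> where "\<kappa> = Re (k i i)"
    have \<kappa>: "0 \<le> \<kappa>"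
      using psd[of "{i}" "\<lambda>_. 1"] i(1) by (simp add: \<kappa>_def)
    have kii: "k i i = of_real \<kappa>"
      using herm[OF i(1) i(1)] by (simp add: \<kappa>_def complex_eq_iff)
    \<comment> \<open>The inner products that the new vector must have with the old ones, as a
      functional on their span. Positivity of k on F together with i bounds it by root \<kappa>, so
      it is represented by a vector u of norm at most root \<kappa>.\<close>
    define G where "G = {(\<Sum>j\<in>F. c j *\<^sub>C v j, \<Sum>j\<in>F. c j * k j i) | F c. finite F \<and> F \<subseteq> fst ` M}"
    have GI: "(\<Sum>j\<in>F. c j *\<^sub>C v j, \<Sum>j\<in>F. c j * k j i) \<in> G" if "finite F" "F \<subseteq> fst ` M" for F c
      unfolding G_def using that by blast
    have "\<exists>g. (\<forall>x x'. g (x + x') = g x + g x') \<and> (\<forall>c x. g (c *\<^sub>C x) = c *\<^sub>C g x) \<and>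
      (\<forall>x. norm (g x) \<le> sqrt \<kappa> * norm x) \<and> (\<forall>x y. (x, y) \<in> G \<longrightarrow> g x = y) \<and>
      (\<forall>x\<in>orth (fst ` G). g x = 0) \<and> (\<forall>x. g x \<in> closure (snd ` G))"
    proof (rule bounded_relation_extends)
      show "(0, 0) \<in> G"
        using GI[of "{}"] by simp
      show "(x + x', y + y') \<in> G" if xy: "(x, y) \<in> G" and xy': "(x', y') \<in> G" for x y x' y'
      proof -
        obtain F c where 1: "finite F" "F \<subseteq> fst ` M" "x = (\<Sum>j\<in>F. c j *\<^sub>C v j)" "y = (\<Sum>j\<in>F. c j * k j i)"
          using xy unfolding G_def by blast
        obtain F' c' where 2: "finite F'" "F' \<subseteq> fst ` M" "x' = (\<Sum>j\<in>F'. c' j *\<^sub>C v j)" "y' = (\<Sum>j\<in>F'. c' j * k j i)"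
          using xy' unfolding G_def by blast
        define d where "d j = (if j \<in> F then c j else 0) + (if j \<in> F' then c' j else 0)" for j
        have "x + x' = (\<Sum>j\<in>F \<union> F'. d j *\<^sub>C v j)"
        proof -
          have "x = (\<Sum>j\<in>F \<union> F'. (if j \<in> F then c j else 0) *\<^sub>C v j)"
            unfolding 1(3) using 1(1) 2(1) by (intro sum.mono_neutral_cong_left) auto
          moreover have "x' = (\<Sum>j\<in>F \<union> F'. (if j \<in> F' then c' j else 0) *\<^sub>C v j)"
            unfolding 2(3) using 1(1) 2(1) by (intro sum.mono_neutral_cong_left) auto
          ultimately show ?thesis
            by (simp add: d_def scaleC_add_left sum.distrib)
        qed
        moreover have "y + y' = (\<Sum>j\<in>F \<union> F'. d j * k j i)"
        proof -
          have "y = (\<Sum>j\<in>F \<union> F'. (if j \<in> F then c j else 0) * k j i)"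
            unfolding 1(4) using 1(1) 2(1) by (intro sum.mono_neutral_cong_left) auto
          moreover have "y' = (\<Sum>j\<in>F \<union> F'. (if j \<in> F' then c' j else 0) * k j i)"
            unfolding 2(4) using 1(1) 2(1) by (intro sum.mono_neutral_cong_left) auto
          ultimately show ?thesis
            by (simp add: d_def distrib_right sum.distrib)
        qed
        ultimately show ?thesis
          using GI[of "F \<union> F'" d] 1(1,2) 2(1,2) by simp
      qed
      show "(a *\<^sub>C x, a *\<^sub>C y) \<in> G" if xy: "(x, y) \<in> G" for a x y
      proof -
        obtain F c where 1: "finite F" "F \<subseteq> fst ` M" "x = (\<Sum>j\<in>F. c j *\<^sub>C v j)" "y = (\<Sum>j\<in>F. c j * k j i)"
          using xy unfolding G_def by blast
        show ?thesis
          using GI[OF 1(1,2), of "\<lambda>j. a * c j"]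
          by (simp add: 1(3,4) scaleC.sum_right scaleC_scaleC scaleC_complex_def sum_distrib_left mult.assoc)
      qed
      show "0 \<le> sqrt \<kappa>"
        using \<kappa> by simp
      show "norm y \<le> sqrt \<kappa> * norm x" if xy: "(x, y) \<in> G" for x y
      proof -
        obtain F c where 1: "finite F" "F \<subseteq> fst ` M" "x = (\<Sum>j\<in>F. c j *\<^sub>C v j)" "y = (\<Sum>j\<in>F. c j * k j i)"
          using xy unfolding G_def by blast
        have iF: "i \<notin> F"
          using 1(2) i(2) by blast
        have nx: "Re (\<Sum>a\<in>F. \<Sum>b\<in>F. c a * cnj (c b) * k a b) = (norm x)\<^sup>2"
        proof -
          have "cinner x x = (\<Sum>a\<in>F. \<Sum>b\<in>F. c a * cnj (c b) * k a b)"
            unfolding 1(3)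
          proof (subst cinner.sum_left, intro sum.cong refl)
            fix a assume a: "a \<in> F"
            have "cinner (c a *\<^sub>C v a) (c b *\<^sub>C v b) = c a * cnj (c b) * k a b" if b: "b \<in> F" for b
              using Mk[OF v v, of a b] a b 1(2) by (simp add: cinner_scaleC_left cinner_scaleC_right subset_iff)
            then show "cinner (c a *\<^sub>C v a) (\<Sum>j\<in>F. c j *\<^sub>C v j) = (\<Sum>b\<in>F. c a * cnj (c b) * k a b)"
              by (simp add: cinner.sum_right)
          qed
          then show ?thesis
            by (simp add: norm_square_cinner)
        qed
        have "(cmod y)\<^sup>2 \<le> \<kappa> * (norm x)\<^sup>2"
        proof (rule discriminant_bound)
          fix t
          let ?c = "c(i := t)"
          have "0 \<le> Re (\<Sum>a\<in>insert i F. \<Sum>b\<in>insert i F. ?c a * cnj (?c b) * k a b)"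
            by (rule psd) (use 1(1,2) MJ i(1) in auto)
          also have "(\<Sum>a\<in>insert i F. \<Sum>b\<in>insert i F. ?c a * cnj (?c b) * k a b) =
              (\<Sum>a\<in>F. \<Sum>b\<in>F. c a * cnj (c b) * k a b) + cnj t * y + cnj (cnj t * y) + t * cnj t * k i i"
          proof -
            have ne: "a \<noteq> i" if "a \<in> F" for a
              using that iF by blast
            have "(\<Sum>a\<in>F. ?c a * cnj (?c i) * k a i) = cnj t * y"
              unfolding 1(4) sum_distrib_left by (intro sum.cong) (auto dest: ne)
            moreover have "(\<Sum>b\<in>F. ?c i * cnj (?c b) * k i b) = cnj (cnj t * y)"
              unfolding 1(4) sum_distrib_left cnj_sum
            proof (intro sum.cong refl)
              fix b assume b: "b \<in> F"
              then have "k i b = cnj (k b i)"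
                using herm[of i b] i(1) 1(2) MJ by blast
              then show "?c i * cnj (?c b) * k i b = cnj (cnj t * (c b * k b i))"
                using ne[OF b] by simp
            qed
            moreover have "(\<Sum>a\<in>F. \<Sum>b\<in>F. ?c a * cnj (?c b) * k a b) = (\<Sum>a\<in>F. \<Sum>b\<in>F. c a * cnj (c b) * k a b)"
              by (intro sum.cong refl) (auto dest: ne)
            ultimately show ?thesis
              using 1(1) iF by (simp add: sum.distrib)
          qed
          also have "Re \<dots> = (norm x)\<^sup>2 + 2 * Re (cnj t * y) + (cmod t)\<^sup>2 * \<kappa>"
          proof -
            have "t * cnj t = of_real ((cmod t)\<^sup>2)"
              by (rule complex_norm_square[symmetric])
            then have "t * cnj t * k i i = of_real ((cmod t)\<^sup>2 * \<kappa>)"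
              by (simp add: kii)
            then show ?thesis
              using nx by (simp del: of_real_mult of_real_power)
          qed
          finally show "0 \<le> (norm x)\<^sup>2 + 2 * Re (cnj t * y) + (cmod t)\<^sup>2 * \<kappa>" .
        qed (use \<kappa> in auto)
        also have "\<dots> = (sqrt \<kappa> * norm x)\<^sup>2"
          using \<kappa> by (simp add: power_mult_distrib)
        finally show ?thesis
          by (rule power2_le_imp_le) (use \<kappa> in simp)
      qed
    qed
    then obtain g where g: "\<And>x x'. g (x + x') = g x + g x'" "\<And>c x. g (c *\<^sub>C x) = c *\<^sub>C g x"
      "\<And>x. norm (g x) \<le> sqrt \<kappa> * norm x" "\<And>x y. (x, y) \<in> G \<Longrightarrow> g x = y" "\<And>x. x \<in> orth (fst ` G) \<Longrightarrow> g x = 0"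
      by blast
    obtain u where u: "\<And>x. g x = cinner x u" "norm u \<le> \<bar>sqrt \<kappa>\<bar>"
      using riesz_representation[OF g(1) g(2)[unfolded scaleC_complex_def] g(3)] by blast
    have vu: "cinner (v j) u = k j i" if "j \<in> fst ` M" for j
      using g(4)[OF GI[of "{j}" "\<lambda>_. 1"]] that by (simp add: u(1) scaleC_one)
    have us: "ell2_nth u l = 0" if l: "l \<notin> fst ` M" for l
    proof -
      have "ell2_single l 1 \<in> orth (fst ` G)"
        using Ms[OF v] l by (auto simp: orth_def G_def cinner_single_left ell2_nth_sum subset_iff)
      from g(5)[OF this] show ?thesis
        by (simp add: u(1) cinner_single_left cinner_complex_def)
    qed
    define s where "s = sqrt (\<kappa> - (norm u)\<^sup>2)"
    have "(norm u)\<^sup>2 \<le> \<kappa>"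
      using power_mono[OF u(2), of 2] \<kappa> by simp
    then have s: "s\<^sup>2 = \<kappa> - (norm u)\<^sup>2"
      by (simp add: s_def)
    \<comment> \<open>The vector u has the right inner products but may be too short; the free
      coordinate i supplies the missing length without changing them.\<close>
    define w where "w = u + ell2_single i (of_real s)"
    have vw: "cinner (v j) w = k j i" if "j \<in> fst ` M" for j
      using vu[OF that] Ms[OF v[OF that] i(2)] by (simp add: w_def cinner_add_right cinner_single_right)
    have wv: "cinner w (v j) = k i j" if "j \<in> fst ` M" for j
      using vw[OF that] herm[OF i(1), of j] MJ that by (metis cinner_commute subsetD)
    have ww: "cinner w w = k i i"
    proof -
      have "cinner w w = of_real ((norm u)\<^sup>2) + of_real (s\<^sup>2)"
        using us[OF i(2)] cinner_self[of u] by (simp add: w_def cinner_add_left cinner_add_right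
            cinner_single_right cinner_single_left cinner_complex_def power2_eq_square)
      then show ?thesis
        unfolding s kii by simp
    qed
    have "good (insert (i, w) M)"
      unfolding good_def
    proof (intro conjI allI impI)
      show "fst ` insert (i, w) M \<subseteq> J"
        using MJ i(1) by auto
      fix a x b y assume ax: "(a, x) \<in> insert (i, w) M" and b: "(b, y) \<in> insert (i, w) M"
      have vM: "cinner (x' - v a') (x' - v a') = 0" if "(a', x') \<in> M" for a' x'
      proof -
        have "a' \<in> fst ` M"
          using that by force
        then show ?thesis
          using that v[of a'] by (simp add: cinner.diff_left cinner.diff_right Mk)
      qed
      have eq: "x' = v a'" "a' \<in> fst ` M" if "(a', x') \<in> M" for a' x'
        using vM[OF that] that by force+
      have "cinner w x' = k i a'" "cinner x' w = k a' i" if "(a', x') \<in> M" for a' x'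
        using vw[OF eq(2)[OF that]] wv[OF eq(2)[OF that]] eq(1)[OF that] by simp_all
      then show "cinner x y = k a b"
        using ax b ww Mk by auto
    next
      fix a x b assume ax: "(a, x) \<in> insert (i, w) M" and b: "b \<notin> fst ` insert (i, w) M"
      then have bM: "b \<notin> fst ` M" "b \<noteq> i"
        by auto
      show "ell2_nth x b = 0"
        using ax bM us[OF bM(1)] Ms[of a x b] by (auto simp: w_def)
    qed
    then have "insert (i, w) M = M"
      by (rule max) auto
    then show False
      using i(2) by force
  qed
  then show ?thesis
    using Mk v by (intro exI[of _ v]) blast
qed

section \<open>Total reduction\<close>

lemma cadj_compose: "S \<in> bounded_operators \<Longrightarrow> T \<in> bounded_operators \<Longrightarrow> cadj (S o\<^sub>L T) = cadj T o\<^sub>L cadj S"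
  by (rule cadj_unique) (auto simp: cadj(2))

lemma cadj_cadj: "T \<in> bounded_operators \<Longrightarrow> cadj (cadj T) = T"
  by (rule cadj_unique) (auto simp: cadj(1,3))

lemma cadj_scaleC_op: "T \<in> bounded_operators \<Longrightarrow> cadj (scaleC_op c T) = scaleC_op (cnj c) (cadj T)"
  by (rule cadj_unique) (auto simp: cinner_scaleC_left cinner_scaleC_right cadj(2))

text \<open>The Gram vectors are indexed by bounded operators, that is, by elements of the type
  \<open>'a \<Rightarrow>\<^sub>L 'a\<close>; so L lies in the space over which
  \<open>total_reduction_property\<close> quantifies. An operator m acts by sending the vector of c
  to that of m c.\<close>

theorem gns_representation:
  fixes f :: "('a::complex_hilbert_space \<Rightarrow>\<^sub>L 'a) \<Rightarrow> real"
  assumes f: "linear f" and pos: "\<And>T s. (\<And>x. Re (cinner (blinfun_apply T x) x) \<le> s * (norm x)\<^sup>2) \<Longrightarrow> f T \<le> s"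
  shows "\<exists>(L :: ('a \<Rightarrow>\<^sub>L 'a, complex) ell2 set) \<pi> \<xi>. csubspace L \<and> closed L \<and> \<xi> \<in> L \<and>
    (\<forall>m\<in>bounded_operators. \<pi> m \<in> operators_on L \<and> norm (\<pi> m) \<le> norm m \<and> cadj (\<pi> m) = \<pi> (cadj m) \<and>
      (norm (blinfun_apply (\<pi> m) \<xi>))\<^sup>2 = f (cadj m o\<^sub>L m)) \<and>
    (\<forall>m\<in>bounded_operators. \<forall>n\<in>bounded_operators. \<pi> (m + n) = \<pi> m + \<pi> n \<and> \<pi> (m o\<^sub>L n) = \<pi> m o\<^sub>L \<pi> n) \<and>
    (\<forall>c. \<forall>m\<in>bounded_operators. \<pi> (scaleC_op c m) = scaleC_op c (\<pi> m))"
proof -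
  let ?J = "bounded_operators :: ('a \<Rightarrow>\<^sub>L 'a) set"
  \<comment> \<open>The functional f is only real-linear; this is the complex-linear one with real
    part f.\<close>
  define \<omega> where "\<omega> X = complex_of_real (f X) - \<i> * complex_of_real (f (scaleC_op \<i> X))" for X
  define k where "k S T = \<omega> (cadj T o\<^sub>L S)" for S T
  have fmono: "f X \<le> f Y" if "\<And>x. Re (cinner (blinfun_apply X x) x) \<le> Re (cinner (blinfun_apply Y x) x)" for X Y
  proof -
    have "f (X - Y) \<le> 0"
      by (rule pos) (simp add: blinfun.diff_left cinner.diff_left that)
    then show ?thesis
      by (simp add: linear_diff[OF f])
  qed
  have f0: "0 \<le> f X" if "\<And>x. 0 \<le> Re (cinner (blinfun_apply X x) x)" for X
    using fmono[of 0 X] that linear_0[OF f] by simp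
  have fadj: "f (cadj X) = f X" if X: "X \<in> ?J" for X
  proof -
    have "Re (cinner (cadj X x) x) = Re (cinner (X x) x)" for x
    proof -
      have "cinner (cadj X x) x = cnj (cinner (X x) x)"
        using cadj(3)[OF X, of x x] cinner_commute by metis
      then show ?thesis by simp
    qed
    then show ?thesis
      by (intro antisym fmono) auto
  qed
  have f_scaleC: "f (scaleC_op c X) = Re c * f X + Im c * f (scaleC_op \<i> X)" for c X
  proof -
    have "scaleC_op c X = Re c *\<^sub>R X + Im c *\<^sub>R scaleC_op \<i> X"
    proof (rule blinfun_eqI)
      fix x
      have "c *\<^sub>C X x = (of_real (Re c) + of_real (Im c) * \<i>) *\<^sub>C X x"
        by (simp add: complex_eq_iff)
      then show "scaleC_op c X x = (Re c *\<^sub>R X + Im c *\<^sub>R scaleC_op \<i> X) x"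
        by (simp add: blinfun.bilinear_simps scaleR_scaleC scaleC_scaleC scaleC_add_left)
    qed
    then show ?thesis
      by (simp add: linear_add[OF f] linear_scale[OF f])
  qed
  have \<omega>_add: "\<omega> (X + Y) = \<omega> X + \<omega> Y" for X Y
  proof -
    have "scaleC_op \<i> (X + Y) = scaleC_op \<i> X + scaleC_op \<i> Y"
      by (rule blinfun_eqI) (simp add: blinfun.add_left scaleC_add_right)
    then show ?thesis
      by (simp add: \<omega>_def linear_add[OF f] algebra_simps)
  qed
  have \<omega>_scale: "\<omega> (scaleC_op c X) = c * \<omega> X" for c X
  proof -
    have "scaleC_op \<i> (scaleC_op c X) = scaleC_op (\<i> * c) X"
      by (rule blinfun_eqI) (simp add: scaleC_scaleC)
    then show ?thesis
      by (simp add: \<omega>_def f_scaleC[of c] f_scaleC[of "\<i> * c"] complex_eq_iff algebra_simps)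
  qed
  have \<omega>_adj: "\<omega> (cadj X) = cnj (\<omega> X)" if X: "X \<in> ?J" for X
  proof -
    have "scaleC_op \<i> (cadj X) = cadj (scaleC_op (- \<i>) X)"
      using X by (simp add: cadj_scaleC_op)
    then have "f (scaleC_op \<i> (cadj X)) = f (scaleC_op (- \<i>) X)"
      using X by (simp add: fadj)
    also have "\<dots> = - f (scaleC_op \<i> X)"
      by (simp add: f_scaleC[of "- \<i>"])
    finally show ?thesis
      by (simp add: \<omega>_def fadj[OF X])
  qed
  have Re_\<omega>: "Re (\<omega> X) = f X" for X
    by (simp add: \<omega>_def)
  have k_add: "k (S + S') T = k S T + k S' T" for S S' T
  proof -
    have "cadj T o\<^sub>L (S + S') = (cadj T o\<^sub>L S) + (cadj T o\<^sub>L S')"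
      by (rule blinfun_eqI) (simp add: blinfun.bilinear_simps)
    then show ?thesis
      by (simp add: k_def \<omega>_add)
  qed
  have k_scale: "k (scaleC_op c S) T = c * k S T" if "T \<in> ?J" for c S T
  proof -
    have "cadj T o\<^sub>L scaleC_op c S = scaleC_op c (cadj T o\<^sub>L S)"
      by (rule blinfun_eqI) (simp add: bounded_operatorsD[OF cadj(1)[OF that]])
    then show ?thesis
      by (simp add: k_def \<omega>_scale)
  qed
  have herm: "k S T = cnj (k T S)" if "S \<in> ?J" "T \<in> ?J" for S T
    using that by (simp add: k_def \<omega>_adj[symmetric] cadj_compose cadj_cadj cadj(1))
  have k_zero: "k 0 T = 0" if "T \<in> ?J" for T
  proof -
    have "scaleC_op 0 (0 :: 'a \<Rightarrow>\<^sub>L 'a) = 0"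
      by (rule blinfun_eqI) simp
    then show ?thesis
      using k_scale[OF that, of 0 0] by simp
  qed
  have k_sum: "k (\<Sum>i\<in>F. scaleC_op (c i) i) T = (\<Sum>i\<in>F. c i * k i T)" if "finite F" "T \<in> ?J" for F c T
    using that(1) by (induction F rule: finite_induct) (simp_all add: k_zero k_add k_scale that(2))
  have sumJ: "(\<Sum>i\<in>F. scaleC_op (c i) i) \<in> ?J" if "finite F" "F \<subseteq> ?J" for F c
    using that by (induction F rule: finite_induct) auto
  have psd: "0 \<le> Re (\<Sum>i\<in>F. \<Sum>j\<in>F. c i * cnj (c j) * k i j)" if F: "finite F" "F \<subseteq> ?J" for F c
  proof -
    let ?S = "\<Sum>i\<in>F. scaleC_op (c i) i"
    have S: "?S \<in> ?J"
      by (rule sumJ[OF F])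
    have "k ?S ?S = (\<Sum>i\<in>F. c i * k i ?S)"
      by (rule k_sum[OF F(1) S])
    also have "\<dots> = (\<Sum>i\<in>F. \<Sum>j\<in>F. c i * cnj (c j) * k i j)"
    proof (intro sum.cong refl)
      fix i assume i: "i \<in> F"
      then have iJ: "i \<in> ?J"
        using F(2) by blast
      have "k i ?S = cnj (\<Sum>j\<in>F. c j * k j i)"
        using herm[OF iJ S] k_sum[OF F(1) iJ] by simp
      also have "\<dots> = (\<Sum>j\<in>F. cnj (c j) * k i j)"
        unfolding cnj_sum
      proof (intro sum.cong refl)
        fix j assume "j \<in> F"
        then show "cnj (c j * k j i) = cnj (c j) * k i j"
          using herm[OF iJ, of j] F(2) by (simp add: subset_iff)
      qed
      finally show "c i * k i ?S = (\<Sum>j\<in>F. c i * cnj (c j) * k i j)"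
        by (simp add: sum_distrib_left mult.assoc)
    qed
    finally have "Re (\<Sum>i\<in>F. \<Sum>j\<in>F. c i * cnj (c j) * k i j) = f (cadj ?S o\<^sub>L ?S)"
      by (simp add: k_def[symmetric] Re_\<omega>[symmetric])
    also have "0 \<le> \<dots>"
      by (rule f0) (simp add: cadj(3)[OF S] norm_square_cinner[symmetric])
    finally show ?thesis .
  qed
  obtain v :: "('a \<Rightarrow>\<^sub>L 'a) \<Rightarrow> ('a \<Rightarrow>\<^sub>L 'a, complex) ell2"
    where v: "\<And>S T. S \<in> ?J \<Longrightarrow> T \<in> ?J \<Longrightarrow> cinner (v S) (v T) = k S T"
    using gram_realization[of ?J k, OF herm psd] by blast
  have v_norm: "(norm (v S))\<^sup>2 = f (cadj S o\<^sub>L S)" if "S \<in> ?J" for S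
    by (simp add: norm_square_cinner v that k_def Re_\<omega>)
  have v_add: "v (S + T) = v S + v T" if ST: "S \<in> ?J" "T \<in> ?J" for S T
  proof -
    let ?d = "v (S + T) - v S - v T"
    have "cinner ?d (v U) = 0" if "U \<in> ?J" for U
      using ST that by (simp add: cinner.diff_left v k_add)
    then have "cinner ?d ?d = 0"
      using ST by (simp add: cinner.diff_right)
    then have "?d = 0"
      by simp
    then show ?thesis
      by (simp add: algebra_simps)
  qed
  have v_scale: "v (scaleC_op c S) = c *\<^sub>C v S" if S: "S \<in> ?J" for c S
  proof -
    let ?d = "v (scaleC_op c S) - c *\<^sub>C v S"
    have "cinner ?d (v U) = 0" if "U \<in> ?J" for U
      using S that by (simp add: cinner.diff_left cinner_scaleC_left v k_scale)
    then have "cinner ?d ?d = 0"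
      using S by (simp add: cinner.diff_right cinner_scaleC_right)
    then show ?thesis
      by simp
  qed
  have v_0: "v 0 = 0"
    using v_norm[of 0] by (simp add: linear_0[OF f])
  have vJ: "csubspace (v ` ?J)"
  proof (rule complex_vector.subspaceI)
    show "0 \<in> v ` ?J"
      using v_0 by (metis image_eqI bounded_operators_simps(1))
    show "x + y \<in> v ` ?J" if "x \<in> v ` ?J" "y \<in> v ` ?J" for x y
      using that by (auto simp: v_add[symmetric])
    show "c *\<^sub>C x \<in> v ` ?J" if "x \<in> v ` ?J" for c x
      using that by (auto simp: v_scale[symmetric])
  qed
  define L where "L = closure (v ` ?J)"
  have L: "csubspace L" "closed L"
    unfolding L_def by (simp_all add: csubspace_closure vJ)
  have vL: "v c \<in> L" if "c \<in> ?J" for c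
    unfolding L_def using that by (intro subsetD[OF closure_subset] imageI)
  have orthL: "x \<in> orth L" if x: "x \<in> orth (v ` ?J)" for x
  proof -
    have "closure (v ` ?J) \<subseteq> {y. cinner x y = 0}"
      using x by (intro closure_minimal closed_Collect_eq continuous_intros cinner.continuous_on) (auto simp: orth_def)
    then show ?thesis
      by (auto simp: orth_def L_def)
  qed
  \<comment> \<open>The vectors v c and those orthogonal to all of them form a total set, on which
    identities between operators are checked.\<close>
  define E where "E = v ` ?J \<union> orth (v ` ?J)"
  have E0: "z = 0" if "\<And>y. y \<in> E \<Longrightarrow> cinner z y = 0" for z
  proof -
    have "z \<in> orth (v ` ?J)"
      using that by (auto simp: orth_def E_def)
    then show ?thesis
      using that[of z] by (simp add: E_def)
  qed
  have E: "closure (cspan E) = UNIV"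
  proof (rule closed_csubspace_eq_UNIV)
    show "orth (closure (cspan E)) \<subseteq> {0}"
    proof
      fix z assume z: "z \<in> orth (closure (cspan E))"
      have "y \<in> closure (cspan E)" if "y \<in> E" for y
        using that by (intro subsetD[OF closure_subset] complex_vector.span_base)
      then show "z \<in> {0}"
        using z E0[of z] by (simp add: orth_def)
    qed
  qed (auto intro: csubspace_closure)
  have "\<exists>T. T \<in> bounded_operators \<and> (\<forall>c\<in>?J. blinfun_apply T (v c) = v (m o\<^sub>L c)) \<and>
      (\<forall>x\<in>orth (v ` ?J). blinfun_apply T x = 0) \<and> (\<forall>x. blinfun_apply T x \<in> L) \<and> norm T \<le> norm m"
    if m: "m \<in> ?J" for m
  proof -
    define G where "G = {(v c, v (m o\<^sub>L c)) | c. c \<in> ?J}"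
    have GI: "(v c, v (m o\<^sub>L c)) \<in> G" if "c \<in> ?J" for c
      using that by (auto simp: G_def)
    have "\<exists>g. (\<forall>x x'. g (x + x') = g x + g x') \<and> (\<forall>c x. g (c *\<^sub>C x) = c *\<^sub>C g x) \<and>
      (\<forall>x. norm (g x) \<le> norm m * norm x) \<and> (\<forall>x y. (x, y) \<in> G \<longrightarrow> g x = y) \<and>
      (\<forall>x\<in>orth (fst ` G). g x = 0) \<and> (\<forall>x. g x \<in> closure (snd ` G))"
    proof (rule bounded_relation_extends)
      show "(0, 0) \<in> G"
        using GI[of 0] by (simp add: v_0)
      show "(x + x', y + y') \<in> G" if xy: "(x, y) \<in> G" "(x', y') \<in> G" for x y x' y'
      proof -
        obtain c c' where c: "c \<in> ?J" "x = v c" "y = v (m o\<^sub>L c)" "c' \<in> ?J" "x' = v c'" "y' = v (m o\<^sub>L c')"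
          using xy by (auto simp: G_def)
        have "m o\<^sub>L (c + c') = (m o\<^sub>L c) + (m o\<^sub>L c')"
          by (rule blinfun_eqI) (simp add: blinfun.bilinear_simps)
        then show ?thesis
          using GI[of "c + c'"] c m by (simp add: v_add)
      qed
      show "(a *\<^sub>C x, a *\<^sub>C y) \<in> G" if xy: "(x, y) \<in> G" for a x y
      proof -
        obtain c where c: "c \<in> ?J" "x = v c" "y = v (m o\<^sub>L c)"
          using xy by (auto simp: G_def)
        have "m o\<^sub>L scaleC_op a c = scaleC_op a (m o\<^sub>L c)"
          by (rule blinfun_eqI) (simp add: bounded_operatorsD[OF m])
        then show ?thesis
          using GI[of "scaleC_op a c"] c m by (simp add: v_scale)
      qed
      show "norm y \<le> norm m * norm x" if xy: "(x, y) \<in> G" for x y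
      proof -
        obtain c where c: "c \<in> ?J" "x = v c" "y = v (m o\<^sub>L c)"
          using xy by (auto simp: G_def)
        have mc: "m o\<^sub>L c \<in> ?J"
          using m c(1) by auto
        \<comment> \<open>As quadratic forms, the square of m c is at most the squared norm of m
          times the square of c, and f is monotone.\<close>
        have "f (cadj (m o\<^sub>L c) o\<^sub>L (m o\<^sub>L c)) \<le> f ((norm m)\<^sup>2 *\<^sub>R (cadj c o\<^sub>L c))"
        proof (rule fmono)
          fix h
          have "(norm (m (c h)))\<^sup>2 \<le> (norm m * norm (c h))\<^sup>2"
            by (intro power_mono norm_blinfun) simp
          then show "Re (cinner (blinfun_apply (cadj (m o\<^sub>L c) o\<^sub>L (m o\<^sub>L c)) h) h)
              \<le> Re (cinner (blinfun_apply ((norm m)\<^sup>2 *\<^sub>R (cadj c o\<^sub>L c)) h) h)"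
            by (simp add: cadj(3)[OF mc] cadj(3)[OF c(1)] blinfun.scaleR_left cinner.scaleR_left
                norm_square_cinner[symmetric] power_mult_distrib)
        qed
        then have "(norm y)\<^sup>2 \<le> (norm m * norm x)\<^sup>2"
          by (simp add: c(2,3) v_norm[OF mc] v_norm[OF c(1)] linear_scale[OF f] power_mult_distrib)
        then show ?thesis
          by (rule power2_le_imp_le) simp
      qed
    qed simp
    then obtain g where g: "\<And>x x'. g (x + x') = g x + g x'" "\<And>c x. g (c *\<^sub>C x) = c *\<^sub>C g x"
      "\<And>x. norm (g x) \<le> norm m * norm x" "\<And>x y. (x, y) \<in> G \<Longrightarrow> g x = y" "\<And>x. x \<in> orth (fst ` G) \<Longrightarrow> g x = 0"
      "\<And>x. g x \<in> closure (snd ` G)"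
      by blast
    obtain T where T: "T \<in> bounded_operators" "\<And>x. blinfun_apply T x = g x" "norm T \<le> \<bar>norm m\<bar>"
      using ex_operator[OF g(1-3)] by blast
    have "fst ` G = v ` ?J"
      by (force simp: G_def)
    moreover have "snd ` G \<subseteq> v ` ?J"
      using m by (auto simp: G_def)
    then have "closure (snd ` G) \<subseteq> L"
      unfolding L_def by (rule closure_mono)
    ultimately show ?thesis
      using T g(4)[OF GI] g(5,6) by (intro exI[of _ T]) auto
  qed
  then have "\<forall>m\<in>?J. \<exists>T. T \<in> bounded_operators \<and> (\<forall>c\<in>?J. blinfun_apply T (v c) = v (m o\<^sub>L c)) \<and>
      (\<forall>x\<in>orth (v ` ?J). blinfun_apply T x = 0) \<and> (\<forall>x. blinfun_apply T x \<in> L) \<and> norm T \<le> norm m"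
    by blast
  from bchoice[OF this] obtain \<pi> where
    \<pi>: "\<And>m. m \<in> ?J \<Longrightarrow> \<pi> m \<in> bounded_operators" "\<And>m c. m \<in> ?J \<Longrightarrow> c \<in> ?J \<Longrightarrow> \<pi> m (v c) = v (m o\<^sub>L c)"
    "\<And>m x. m \<in> ?J \<Longrightarrow> x \<in> orth (v ` ?J) \<Longrightarrow> \<pi> m x = 0" "\<And>m x. m \<in> ?J \<Longrightarrow> \<pi> m x \<in> L"
    "\<And>m. m \<in> ?J \<Longrightarrow> norm (\<pi> m) \<le> norm m"
    by blast
  have eqI: "S = T" if "S \<in> bounded_operators" "T \<in> bounded_operators"
    "\<And>c. c \<in> ?J \<Longrightarrow> blinfun_apply S (v c) = blinfun_apply T (v c)"
    "\<And>x. x \<in> orth (v ` ?J) \<Longrightarrow> blinfun_apply S x = blinfun_apply T x" for S T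
    by (rule operators_eq_if_eq_on_total[OF that(1,2) E]) (use that(3,4) in \<open>auto simp: E_def\<close>)
  have p1: "\<pi> m \<in> operators_on L" if m: "m \<in> ?J" for m
  proof -
    have "x \<in> orth (v ` ?J)" if "\<forall>y\<in>L. cinner x y = 0" for x
      using that vL by (auto simp: orth_def)
    then show ?thesis
      using \<pi>(1,3,4)[OF m] by (auto simp: operators_on_def)
  qed
  have p2: "cadj (\<pi> m) = \<pi> (cadj m)" if m: "m \<in> ?J" for m
  proof (rule eqI)
    have m': "cadj m \<in> ?J"
      by (rule cadj(1)[OF m])
    show "cadj (\<pi> m) \<in> bounded_operators" "\<pi> (cadj m) \<in> bounded_operators"
      using \<pi>(1)[OF m'] cadj(1)[OF \<pi>(1)[OF m]] by auto
    fix c assume c: "c \<in> ?J"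
    have "cadj (\<pi> m) (v c) - v (cadj m o\<^sub>L c) = 0"
    proof (rule E0)
      fix y assume "y \<in> E"
      then consider d where "d \<in> ?J" "y = v d" | "y \<in> orth (v ` ?J)"
        by (auto simp: E_def)
      then show "cinner (cadj (\<pi> m) (v c) - v (cadj m o\<^sub>L c)) y = 0"
      proof cases
        case 1
        have "cinner (cadj (\<pi> m) (v c)) y = k c (m o\<^sub>L d)"
          using 1 m c by (simp add: cadj(3)[OF \<pi>(1)[OF m]] \<pi>(2) v)
        also have "\<dots> = k (cadj m o\<^sub>L c) d"
        proof -
          have "cadj (m o\<^sub>L d) o\<^sub>L c = cadj d o\<^sub>L (cadj m o\<^sub>L c)"
            using m 1(1) by (intro blinfun_eqI) (simp add: cadj_compose)
          then show ?thesis
            by (simp add: k_def)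
        qed
        also have "\<dots> = cinner (v (cadj m o\<^sub>L c)) y"
          using 1 m' c by (simp add: v)
        finally show ?thesis
          by (simp add: cinner.diff_left)
      next
        case 2
        have "cinner (v (cadj m o\<^sub>L c)) y = 0"
          using 2 m' c cinner_eq_zero_commute by (auto simp: orth_def)
        then show ?thesis
          by (simp add: cinner.diff_left cadj(3)[OF \<pi>(1)[OF m]] \<pi>(3)[OF m 2])
      qed
    qed
    then show "cadj (\<pi> m) (v c) = \<pi> (cadj m) (v c)"
      using \<pi>(2)[OF m' c] by simp
  next
    fix x assume x: "x \<in> orth (v ` ?J)"
    have "cinner (cadj (\<pi> m) x) y = cinner 0 y" for y
      using orthL[OF x] \<pi>(4)[OF m, of y] by (simp add: cadj(3)[OF \<pi>(1)[OF m]] orth_def)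
    then have "cadj (\<pi> m) x = 0"
      by (rule cinner_ext)
    then show "cadj (\<pi> m) x = \<pi> (cadj m) x"
      using \<pi>(3)[OF cadj(1)[OF m] x] by simp
  qed
  have p3: "(norm (\<pi> m (v id_blinfun)))\<^sup>2 = f (cadj m o\<^sub>L m)" if m: "m \<in> ?J" for m
  proof -
    have "m o\<^sub>L id_blinfun = m"
      by (rule blinfun_eqI) simp
    then show ?thesis
      using \<pi>(2)[OF m, of id_blinfun] v_norm[OF m] by simp
  qed
  have p4: "\<pi> (m + n) = \<pi> m + \<pi> n" if m: "m \<in> ?J" "n \<in> ?J" for m n
  proof (rule eqI)
    fix c assume c: "c \<in> ?J"
    have "(m + n) o\<^sub>L c = (m o\<^sub>L c) + (n o\<^sub>L c)"
      by (rule blinfun_eqI) (simp add: blinfun.add_left)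
    then show "\<pi> (m + n) (v c) = (\<pi> m + \<pi> n) (v c)"
      using m c by (simp add: blinfun.add_left \<pi>(2) v_add)
  qed (use m \<pi>(1,3) in \<open>auto simp: blinfun.add_left\<close>)
  have p5: "\<pi> (m o\<^sub>L n) = \<pi> m o\<^sub>L \<pi> n" if m: "m \<in> ?J" "n \<in> ?J" for m n
  proof (rule eqI)
    fix c assume c: "c \<in> ?J"
    have "(m o\<^sub>L n) o\<^sub>L c = m o\<^sub>L (n o\<^sub>L c)"
      by (rule blinfun_eqI) simp
    then show "\<pi> (m o\<^sub>L n) (v c) = (\<pi> m o\<^sub>L \<pi> n) (v c)"
      using m c by (simp add: \<pi>(2))
  qed (use m \<pi>(1,3) in auto)
  have p6: "\<pi> (scaleC_op c m) = scaleC_op c (\<pi> m)" if m: "m \<in> ?J" for c m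
  proof (rule eqI)
    fix d assume d: "d \<in> ?J"
    have "scaleC_op c m o\<^sub>L d = scaleC_op c (m o\<^sub>L d)"
      by (rule blinfun_eqI) simp
    then show "\<pi> (scaleC_op c m) (v d) = scaleC_op c (\<pi> m) (v d)"
      using m d by (simp add: \<pi>(2) v_scale)
  qed (use m \<pi>(1,3) in auto)
  show ?thesis
    by (intro exI[of _ L] exI[of _ \<pi>] exI[of _ "v id_blinfun"] conjI ballI allI L vL p1 p2 p3 p4 p5 p6 \<pi>(5))
      simp_all
qed

section \<open>Closed subalgebras under similarity\<close>

lemma subalgebra_conjugate:
  assumes SR: "inverse_operators S R" and D: "subalgebra D"
  shows "subalgebra (conjugate S R D)"
proof -
  note I = inverse_operatorsD[OF SR]
  have Db: "D \<subseteq> bounded_operators"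
    using D by (simp add: subalgebra_def)
  show ?thesis
    unfolding subalgebra_def
  proof (intro conjI ballI allI)
    show "conjugate S R D \<subseteq> bounded_operators"
      using Db I(1,2) by (auto simp: conjugate_def)
    show "0 \<in> conjugate S R D"
      unfolding conjugate_def by (rule image_eqI[of _ _ 0]) (use D in \<open>simp_all add: subalgebra_def\<close>)
    fix T assume "T \<in> conjugate S R D"
    then obtain T0 where T: "T0 \<in> D" "T = S o\<^sub>L T0 o\<^sub>L R"
      by (auto simp: conjugate_def)
    show "scaleC_op c T \<in> conjugate S R D" for c
      unfolding conjugate_def
    proof (rule image_eqI)
      show "scaleC_op c T = S o\<^sub>L scaleC_op c T0 o\<^sub>L R"
        by (rule blinfun_eqI) (simp add: T(2) bounded_operatorsD[OF I(1)])
      show "scaleC_op c T0 \<in> D"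
        using D T(1) by (simp add: subalgebra_def)
    qed
    fix U assume "U \<in> conjugate S R D"
    then obtain U0 where U: "U0 \<in> D" "U = S o\<^sub>L U0 o\<^sub>L R"
      by (auto simp: conjugate_def)
    show "T + U \<in> conjugate S R D"
      unfolding conjugate_def
    proof (rule image_eqI)
      show "T + U = S o\<^sub>L (T0 + U0) o\<^sub>L R"
        by (rule blinfun_eqI) (simp add: T(2) U(2) blinfun.bilinear_simps)
      show "T0 + U0 \<in> D"
        using D T(1) U(1) by (simp add: subalgebra_def)
    qed
    show "T o\<^sub>L U \<in> conjugate S R D"
      unfolding conjugate_def
    proof (rule image_eqI)
      show "T o\<^sub>L U = S o\<^sub>L (T0 o\<^sub>L U0) o\<^sub>L R"
        by (rule blinfun_eqI) (simp add: T(2) U(2) I)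
      show "T0 o\<^sub>L U0 \<in> D"
        using D T(1) U(1) by (simp add: subalgebra_def)
    qed
  qed
qed

lemma closed_conjugate:
  assumes SR: "inverse_operators S R" and D: "closed D"
  shows "closed (conjugate S R D)"
proof -
  note I = inverse_operatorsD[OF SR]
  have "conjugate S R D = (\<lambda>T. R o\<^sub>L T o\<^sub>L S) -` D"
  proof (intro equalityI subsetI)
    fix T assume "T \<in> conjugate S R D"
    then obtain T0 where T: "T0 \<in> D" "T = S o\<^sub>L T0 o\<^sub>L R"
      by (auto simp: conjugate_def)
    have "R o\<^sub>L T o\<^sub>L S = T0"
      by (rule blinfun_eqI) (simp add: T(2) I)
    then show "T \<in> (\<lambda>T. R o\<^sub>L T o\<^sub>L S) -` D"
      using T(1) by simp
  next
    fix T assume T: "T \<in> (\<lambda>T. R o\<^sub>L T o\<^sub>L S) -` D"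
    have "T = S o\<^sub>L (R o\<^sub>L T o\<^sub>L S) o\<^sub>L R"
      by (rule blinfun_eqI) (simp add: I)
    then show "T \<in> conjugate S R D"
      using T unfolding conjugate_def by blast
  qed
  also have "closed \<dots>"
    by (intro closed_vimage D continuous_intros bounded_bilinear.continuous_on[OF bounded_bilinear_blinfun_compose])
  finally show ?thesis .
qed

lemma subalgebra_convex: "subalgebra D \<Longrightarrow> convex D"
  by (simp add: convex_def subalgebra_def scaleR_eq_scaleC_op)

theorem total_reduction_self_adjoint:
  fixes A :: "('a::complex_hilbert_space \<Rightarrow>\<^sub>L 'a) set"
  assumes sub: "subalgebra A" and cl: "closed A" and tot: "total_reduction_property A"
    and SR: "inverse_operators S R"
    and normal: "\<And>b. b \<in> conjugate S R A \<Longrightarrow> b o\<^sub>L cadj b = cadj b o\<^sub>L b"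
    and b: "b \<in> conjugate S R A"
  shows "cadj b \<in> conjugate S R A"
proof (rule ccontr)
  assume nin: "cadj b \<notin> conjugate S R A"
  let ?A = "conjugate S R A"
  have subA: "subalgebra ?A"
    by (rule subalgebra_conjugate[OF SR sub])
  have Ab: "?A \<subseteq> bounded_operators" "0 \<in> ?A"
    using subA by (simp_all add: subalgebra_def)
  have bb: "b \<in> bounded_operators" "cadj b \<in> bounded_operators"
    using Ab(1) b cadj(1) by blast+
  define d where "d = infdist (cadj b) ?A"
  have d: "0 < d"
    unfolding d_def using closed_conjugate[OF SR cl] Ab(2) nin by (intro infdist_pos_not_in_closed) auto
  have "d \<le> norm (cadj b - a)" if "a \<in> ?A" for a
    using infdist_le[OF that, of "cadj b"] by (simp add: d_def dist_norm)
  then have "\<exists>f. linear f \<and> (\<forall>T s. (\<forall>x. Re (cinner (blinfun_apply T x) x) \<le> s * (norm x)\<^sup>2) \<longrightarrow> f T \<le> s) \<and>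
    (\<forall>a\<in>?A. d\<^sup>2 \<le> f (cadj (cadj b - a) o\<^sub>L (cadj b - a)))"
    using Ab by (intro ex_separating_state subalgebra_convex subA bb d) auto
  then obtain f where f: "linear f" "\<And>T s. (\<And>x. Re (cinner (blinfun_apply T x) x) \<le> s * (norm x)\<^sup>2) \<Longrightarrow> f T \<le> s"
    "\<And>a. a \<in> ?A \<Longrightarrow> d\<^sup>2 \<le> f (cadj (cadj b - a) o\<^sub>L (cadj b - a))"
    by blast
  obtain L :: "('a \<Rightarrow>\<^sub>L 'a, complex) ell2 set" and \<pi> \<xi> where L: "csubspace L" "closed L" "\<xi> \<in> L"
    and \<pi>: "\<And>m. m \<in> bounded_operators \<Longrightarrow> \<pi> m \<in> operators_on L"
      "\<And>m. m \<in> bounded_operators \<Longrightarrow> norm (\<pi> m) \<le> norm m"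
      "\<And>m. m \<in> bounded_operators \<Longrightarrow> cadj (\<pi> m) = \<pi> (cadj m)"
      "\<And>m. m \<in> bounded_operators \<Longrightarrow> (norm (blinfun_apply (\<pi> m) \<xi>))\<^sup>2 = f (cadj m o\<^sub>L m)"
    and \<pi>_add: "\<And>m n. m \<in> bounded_operators \<Longrightarrow> n \<in> bounded_operators \<Longrightarrow> \<pi> (m + n) = \<pi> m + \<pi> n"
    and \<pi>_mult: "\<And>m n. m \<in> bounded_operators \<Longrightarrow> n \<in> bounded_operators \<Longrightarrow> \<pi> (m o\<^sub>L n) = \<pi> m o\<^sub>L \<pi> n"
    and \<pi>_scale: "\<And>c m. m \<in> bounded_operators \<Longrightarrow> \<pi> (scaleC_op c m) = scaleC_op c (\<pi> m)"
    using gns_representation[OF f(1,2)] by blast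
  have \<pi>b: "\<pi> m \<in> bounded_operators" and \<pi>L: "\<pi> m x \<in> L" and \<pi>0: "x \<in> orth L \<Longrightarrow> \<pi> m x = 0"
    if "m \<in> bounded_operators" for m x
    using \<pi>(1)[OF that] by (auto simp: operators_on_def orth_def)
  have \<pi>_diff: "\<pi> (m - n) = \<pi> m - \<pi> n" if "m \<in> bounded_operators" "n \<in> bounded_operators" for m n
  proof -
    have "\<pi> ((m - n) + n) = \<pi> (m - n) + \<pi> n"
      using that by (intro \<pi>_add) auto
    then show ?thesis
      by simp
  qed
  \<comment> \<open>Total reduction is assumed for A, so the representation of the similar algebra
    is pulled back along the similarity.\<close>
  define \<theta> where "\<theta> a = \<pi> (S o\<^sub>L a o\<^sub>L R)" for a
  have I: "S \<in> bounded_operators" "R \<in> bounded_operators" "\<And>x. S (R x) = x" "\<And>x. R (S x) = x"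
    by (rule inverse_operatorsD[OF SR])+
  have A: "A \<subseteq> bounded_operators"
    using sub by (simp add: subalgebra_def)
  have con: "S o\<^sub>L a o\<^sub>L R \<in> bounded_operators" if "a \<in> A" for a
    using that A I(1,2) by auto
  have \<theta>A: "\<theta> ` A = \<pi> ` ?A"
    by (simp add: \<theta>_def conjugate_def image_image)
  have "representation_on A L \<theta>"
    unfolding representation_on_def
  proof (intro conjI ballI allI)
    fix a assume a: "a \<in> A"
    show "\<theta> a \<in> operators_on L"
      unfolding \<theta>_def by (rule \<pi>(1)[OF con[OF a]])
    show "\<theta> (scaleC_op c a) = scaleC_op c (\<theta> a)" for c
    proof -
      have "S o\<^sub>L scaleC_op c a o\<^sub>L R = scaleC_op c (S o\<^sub>L a o\<^sub>L R)"
        by (rule blinfun_eqI) (simp add: bounded_operatorsD[OF I(1)])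
      then show ?thesis
        by (simp add: \<theta>_def \<pi>_scale con[OF a])
    qed
    fix a' assume a': "a' \<in> A"
    have "S o\<^sub>L (a + a') o\<^sub>L R = (S o\<^sub>L a o\<^sub>L R) + (S o\<^sub>L a' o\<^sub>L R)"
      by (rule blinfun_eqI) (simp add: blinfun.bilinear_simps)
    then show "\<theta> (a + a') = \<theta> a + \<theta> a'"
      by (simp add: \<theta>_def \<pi>_add con a a')
    have "S o\<^sub>L (a o\<^sub>L a') o\<^sub>L R = (S o\<^sub>L a o\<^sub>L R) o\<^sub>L (S o\<^sub>L a' o\<^sub>L R)"
      by (rule blinfun_eqI) (simp add: I)
    then show "\<theta> (a o\<^sub>L a') = \<theta> a o\<^sub>L \<theta> a'"
      by (simp add: \<theta>_def \<pi>_mult con a a')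
  next
    have "(norm S * norm R)-lipschitz_on A \<theta>"
    proof (rule lipschitz_onI)
      fix x y assume xy: "x \<in> A" "y \<in> A"
      have eq: "(S o\<^sub>L x o\<^sub>L R) - (S o\<^sub>L y o\<^sub>L R) = S o\<^sub>L (x - y) o\<^sub>L R"
        by (rule blinfun_eqI) (simp add: blinfun.bilinear_simps)
      have "dist (\<theta> x) (\<theta> y) = norm (\<pi> (S o\<^sub>L (x - y) o\<^sub>L R))"
        using xy by (simp add: dist_norm \<theta>_def \<pi>_diff[OF con con, symmetric] eq)
      also have "\<dots> \<le> norm (S o\<^sub>L (x - y) o\<^sub>L R)"
        by (rule \<pi>(2)) (use xy A I(1,2) in auto)
      also have "\<dots> \<le> norm (S o\<^sub>L (x - y)) * norm R"
        by (rule norm_blinfun_compose)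
      also have "\<dots> \<le> (norm S * norm (x - y)) * norm R"
        by (intro mult_right_mono norm_blinfun_compose) simp
      finally show "dist (\<theta> x) (\<theta> y) \<le> norm S * norm R * dist x y"
        by (simp add: dist_norm mult_ac)
    qed simp
    then show "continuous_on A \<theta>"
      by (rule lipschitz_on_continuous_on)
  qed
  then have red: "reduction_property (\<pi> ` ?A) L"
    using tot L unfolding total_reduction_property_def \<theta>A[symmetric] by blast
  let ?X = "{\<pi> a \<xi> | a. a \<in> ?A}"
  define V where "V = closure ?X"
  have X: "csubspace ?X"
  proof (rule complex_vector.subspaceI)
    have "\<pi> 0 \<xi> = 0"
      using \<pi>_diff[of 0 0] by simp
    then show "0 \<in> ?X"
      using Ab(2) by force
    show "x + y \<in> ?X" if xy: "x \<in> ?X" "y \<in> ?X" for x y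
    proof -
      obtain a a' where a: "a \<in> ?A" "a' \<in> ?A" "x = \<pi> a \<xi>" "y = \<pi> a' \<xi>"
        using xy by blast
      have "x + y = \<pi> (a + a') \<xi>"
        using a Ab(1) by (simp add: \<pi>_add subset_iff blinfun.add_left)
      moreover have "a + a' \<in> ?A"
        using subA a by (simp add: subalgebra_def)
      ultimately show ?thesis by blast
    qed
    show "c *\<^sub>C x \<in> ?X" if x: "x \<in> ?X" for c x
    proof -
      obtain a where a: "a \<in> ?A" "x = \<pi> a \<xi>"
        using x by blast
      have "c *\<^sub>C x = \<pi> (scaleC_op c a) \<xi>"
        using a Ab(1) by (simp add: \<pi>_scale subset_iff)
      moreover have "scaleC_op c a \<in> ?A"
        using subA a by (simp add: subalgebra_def)
      ultimately show ?thesis by blast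
    qed
  qed
  have V: "csubspace V" "closed V"
    unfolding V_def by (simp_all add: csubspace_closure X)
  have XV: "\<pi> a \<xi> \<in> V" if "a \<in> ?A" for a
    unfolding V_def by (intro subsetD[OF closure_subset]) (use that in blast)
  have "?X \<subseteq> L"
    using \<pi>L Ab(1) by blast
  then have VL: "V \<subseteq> L"
    unfolding V_def by (rule closure_minimal) (rule L(2))
  have Vinv: "\<pi> a x \<in> V" if a: "a \<in> ?A" and x: "x \<in> V" for a x
  proof -
    have "?X \<subseteq> blinfun_apply (\<pi> a) -` V"
    proof
      fix y assume "y \<in> ?X"
      then obtain a' where a': "a' \<in> ?A" "y = \<pi> a' \<xi>" by blast
      have "\<pi> a y = \<pi> (a o\<^sub>L a') \<xi>"
        using a a' Ab(1) by (simp add: \<pi>_mult subset_iff)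
      moreover have "a o\<^sub>L a' \<in> ?A"
        using subA a a'(1) by (simp add: subalgebra_def)
      ultimately show "y \<in> blinfun_apply (\<pi> a) -` V"
        using XV by simp
    qed
    moreover have "closed (blinfun_apply (\<pi> a) -` V)"
      by (intro closed_vimage V(2) continuous_intros)
    ultimately have "closure ?X \<subseteq> blinfun_apply (\<pi> a) -` V"
      by (rule closure_minimal)
    then show ?thesis
      using x unfolding V_def by blast
  qed
  have "submodule (\<pi> ` ?A) L V"
    unfolding submodule_def using V VL Vinv by auto
  then have "\<exists>W. submodule (\<pi> ` ?A) L W \<and> V \<inter> W = {0} \<and> L = {v + w | v w. v \<in> V \<and> w \<in> W}"
    using red unfolding reduction_property_def by simp
  then obtain W where W: "submodule (\<pi> ` ?A) L W" "V \<inter> W = {0}" "L = {v + w | v w. v \<in> V \<and> w \<in> W}"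
    by auto
  have Ws: "csubspace W" "closed W" "W \<subseteq> L" "\<And>a x. a \<in> ?A \<Longrightarrow> x \<in> W \<Longrightarrow> \<pi> a x \<in> W"
    using W(1) unfolding submodule_def by auto
  note PL = cproj[OF L(1,2)]
  \<comment> \<open>The complement W lies inside L. Adding \<open>orth L\<close>, on which the
    represented operators vanish, gives a complement of V in the ambient space.\<close>
  define W' where "W' = blinfun_apply (cproj L) -` W"
  have W': "csubspace W'" "closed W'"
    unfolding W'_def by (intro csubspace_vimage PL(1) Ws(1) closed_vimage Ws(2) continuous_intros)+
  have \<pi>_cproj: "\<pi> a (cproj L x) = \<pi> a x" if "a \<in> ?A" for a x
  proof -
    have "\<pi> a (x - cproj L x) = 0"
      using that Ab(1) PL(3) by (intro \<pi>0) auto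
    then show ?thesis
      by (simp add: blinfun.diff_right)
  qed
  have "\<exists>P\<in>bounded_operators. (\<forall>x. blinfun_apply P x \<in> V) \<and> (\<forall>x\<in>V. blinfun_apply P x = x) \<and>
    (\<forall>T\<in>\<pi> ` ?A. \<forall>x. blinfun_apply T (blinfun_apply P x) = blinfun_apply P (blinfun_apply T x))"
  proof (rule submodule_complement_projection)
    show "submodule (\<pi> ` ?A) UNIV V"
      unfolding submodule_def using V Vinv by auto
    have "\<pi> a x \<in> W'" if a: "a \<in> ?A" and x: "x \<in> W'" for a x
    proof -
      have "\<pi> a x \<in> W"
        using Ws(4)[OF a, of "cproj L x"] x by (simp add: W'_def \<pi>_cproj[OF a])
      moreover from this have "cproj L (\<pi> a x) = \<pi> a x"
        using Ws(3) by (intro cproj_same[OF L(1,2)]) auto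
      ultimately show ?thesis
        by (simp add: W'_def)
    qed
    then show "submodule (\<pi> ` ?A) UNIV W'"
      unfolding submodule_def using W' by auto
    show "V \<inter> W' = {0}"
    proof (intro equalityI subsetI)
      fix x assume "x \<in> V \<inter> W'"
      then have "x \<in> V \<inter> W"
        using cproj_same[OF L(1,2), of x] VL by (auto simp: W'_def)
      then show "x \<in> {0}"
        unfolding W(2) .
    qed (use V(1) W'(1) complex_vector.subspace_0 in auto)
    show "\<exists>v\<in>V. \<exists>w\<in>W'. x = v + w" for x
    proof -
      have "cproj L x \<in> {v + w | v w. v \<in> V \<and> w \<in> W}"
        using PL(2) W(3) by simp
      then obtain v w where vw: "v \<in> V" "w \<in> W" "cproj L x = v + w"
        by blast
      have "cproj L (x - v) = w"
        using cproj_same[OF L(1,2), of v] vw VL by (auto simp: blinfun.diff_right)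
      then have "x - v \<in> W'"
        using vw(2) by (simp add: W'_def)
      with vw(1) show ?thesis
        by (intro bexI[of _ v] bexI[of _ "x - v"]) auto
    qed
  qed
  then obtain P where P: "P \<in> bounded_operators" "\<And>x. blinfun_apply P x \<in> V" "\<And>x. x \<in> V \<Longrightarrow> blinfun_apply P x = x"
    "\<And>a x. a \<in> ?A \<Longrightarrow> \<pi> a (blinfun_apply P x) = blinfun_apply P (\<pi> a x)"
    by blast
  have nb: "\<pi> b o\<^sub>L cadj (\<pi> b) = cadj (\<pi> b) o\<^sub>L \<pi> b"
    using normal[OF b] by (simp add: \<pi>(3)[OF bb(1)] \<pi>_mult[OF bb(1,2), symmetric] \<pi>_mult[OF bb(2,1), symmetric])
  have "P o\<^sub>L \<pi> b = \<pi> b o\<^sub>L P"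
    by (rule blinfun_eqI) (simp add: P(4)[OF b])
  from fuglede[OF \<pi>b[OF bb(1)] P(1) nb this]
  have "P o\<^sub>L \<pi> (cadj b) = \<pi> (cadj b) o\<^sub>L P"
    by (simp add: \<pi>(3)[OF bb(1)])
  then have Pb: "P (\<pi> (cadj b) x) = \<pi> (cadj b) (P x)" for x
    by (auto dest: arg_cong[of _ _ "\<lambda>T. blinfun_apply T x"])
  \<comment> \<open>Again \<xi> need not lie in V, for want of a unit. The remainder w is killed by
    \<pi> b, and by normality also by its adjoint, so only P \<xi> contributes to \<pi> (cadj b)
    \<xi>.\<close>
  define w where "w = \<xi> - P \<xi>"
  have "\<pi> b w = 0"
    using P(3)[OF XV[OF b]] P(4)[OF b, of \<xi>] by (simp add: w_def blinfun.diff_right)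
  then have "cadj (\<pi> b) (\<pi> b w) = 0"
    by simp
  then have "\<pi> b (cadj (\<pi> b) w) = 0"
    using arg_cong[OF nb, of "\<lambda>T. blinfun_apply T w"] by simp
  then have "cinner (cadj (\<pi> b) w) (cadj (\<pi> b) w) = 0"
    by (simp add: cadj(3)[OF \<pi>b[OF bb(1)]])
  then have "\<pi> (cadj b) w = 0"
    by (simp add: \<pi>(3)[OF bb(1)])
  then have "\<pi> (cadj b) \<xi> = \<pi> (cadj b) (P \<xi>)"
    by (simp add: w_def blinfun.diff_right)
  then have eq: "\<pi> (cadj b) \<xi> = P (\<pi> (cadj b) \<xi>)"
    unfolding Pb .
  have "\<pi> (cadj b) \<xi> \<in> V"
    by (subst eq) (rule P(2))
  then obtain a where a: "a \<in> ?A" "dist (\<pi> a \<xi>) (\<pi> (cadj b) \<xi>) < d"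
    unfolding V_def closure_approachable using d by blast
  have ab: "a \<in> bounded_operators"
    using a(1) Ab(1) by blast
  have "norm (\<pi> (cadj b - a) \<xi>) < d"
    using a(2) by (simp add: \<pi>_diff[OF bb(2) ab] blinfun.diff_left dist_norm norm_minus_commute)
  then have "(norm (\<pi> (cadj b - a) \<xi>))\<^sup>2 < d\<^sup>2"
    by (intro power_strict_mono) auto
  moreover have "d\<^sup>2 \<le> (norm (\<pi> (cadj b - a) \<xi>))\<^sup>2"
    using f(3)[OF a(1)] \<pi>(4)[of "cadj b - a"] bb(2) ab by simp
  ultimately show False
    by simp
qed

theorem theorem4p2p7:
  fixes A :: "('a::complex_hilbert_space \<Rightarrow>\<^sub>L 'a) set"
  assumes "subalgebra A" and "closed A" and "abelian A"
    and "complete_reduction_property A"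
    and "acts_nondegenerately (commutant A \<inter> compact_operators)"
  shows "(\<exists>S R C. inverse_operators S R \<and> cstar_subalgebra C \<and> abelian C \<and> conjugate S R A \<subseteq> C) \<and>
    similar_to_cstar_algebra (sigma_weak_topology closure_of A) \<and>
    (total_reduction_property A \<longrightarrow> similar_to_cstar_algebra A)"
proof -
  have A: "A \<subseteq> bounded_operators"
    using assms(1) by (simp add: subalgebra_def)
  interpret crp_algebra A
    by unfold_locales (use A assms in auto)
  obtain S R where SR: "inverse_operators S R" and red: "reducing_algebra (conjugate S R A)"
    using similar_to_reducing_algebra[OF assms(5)] by blast
  interpret r: reducing_algebra "conjugate S R A"
    by (rule red)
  have "cstar_subalgebra (conjugate S R (sigma_weak_topology closure_of A))"
    unfolding sigma_weak_closure_eq[OF assms(1)] conjugate_essential_bicommutant[OF SR A, symmetric]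
    by (rule r.cstar_essential_bicommutant)
  moreover have "cstar_subalgebra (conjugate S R A)" if tot: "total_reduction_property A"
  proof -
    \<comment> \<open>The similar algebra sits in its double commutant, which is abelian and closed
      under adjoints.\<close>
    have normal: "b o\<^sub>L cadj b = cadj b o\<^sub>L b" if "b \<in> conjugate S R A" for b
      using r.abelian_bicommutant r.cadj_bicommutant r.A_BB that unfolding abelian_def by blast
    have "cadj b \<in> conjugate S R A" if "b \<in> conjugate S R A" for b
      by (rule total_reduction_self_adjoint[OF assms(1,2) tot SR normal that])
    then have "self_adjoint_set (conjugate S R A)"
      unfolding self_adjoint_set_def using r.is_adjoint_cadj r.A by blast
    then show ?thesis
      unfolding cstar_subalgebra_def
      using subalgebra_conjugate[OF SR assms(1)] closed_conjugate[OF SR assms(2)] by blast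
  qed
  ultimately show ?thesis
    unfolding similar_to_cstar_algebra_def
    using SR r.cstar_bicommutant r.abelian_bicommutant r.A_BB by blast
qed

end
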